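(* Let $K$ be a field and let $P=K[a_1,\dots,a_m,x_1,\dots,x_{n-m}]$ (with $0\le m\le n-1$) be non-negatively $\mathbb{Z}$-graded by $W$ such that $\deg_W(a_i)=0$ for all $i$ and $\deg_W(x_j)>0$ for all $j$. Let $X^{+}=(x_1,\dots,x_{n-m})$. Let $I$ be a $W$-homogeneous ideal in $P$ such that $I\cap P_0=\{0\}$, let $\Gamma=(c_1,\dots,c_m)\in K^m$, and let $\mathfrak{M}_\Gamma=\langle a_1-c_1,\dots,a_m-c_m,x_1,\dots,x_{n-m}\rangle$. Then the following claims hold. (a) There is an isomorphism of $K$-vector spaces $$\alpha_\Gamma:\;\mathrm{Lin}_{\mathfrak{M}_\Gamma}(I)\cong\mathrm{Lin}_{\langle X^{+}\rangle}(I_\Gamma)$$ induced by the $K$-algebra homomorphism $\beta:P\to K[X^{+}]$ defined by $\beta(a_i)=c_i$ for $i=1,\dots,m$ and $\beta(x_j)=x_j$ for $j=1,\dots,n-m$. (b) We have $\dim_K\big(\mathrm{Cot}_{\langle X^{+}\rangle}(K[X^{+}]/I_\Gamma)\big)=\dim_K\big(\mathrm{Cot}_{\mathfrak{M}_\Gamma}(P/I)\big)-m$. (c) If the localization $(P/I)_{\mathfrak{M}_\Gamma/I}$ is a regular local ring, then the localization $(K[X^{+}]/I_\Gamma)_{\langle X^{+}\rangle/I_\Gamma}$ of the fiber is a regular local ring, as well. In this case we have $\dim(K[X^{+}]/I_\Gamma)=\dim\big((P/I)_{\mathfrak{M}_\Gamma/I}\big)-m$. (d) If the localization $(K[X^{+}]/I_\Gamma)_{\langle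 X^{+}\rangle/I_\Gamma}$ of the fiber is a regular local ring, then the fiber $K[X^{+}]/I_\Gamma$ is a free $K$-algebra.
   Context: $P_0=K[a_1,\dots,a_m]$ is the degree-$0$ component of $P$. The fiber ideal $I_\Gamma\subseteq K[X^{+}]$ is the image of $I$ under the substitutions $a_i\mapsto c_i$ for $i=1,\dots,m$ (equivalently $I\cdot(P_0/\langle a_1-c_1,\dots,a_m-c_m\rangle)[X^{+}]$); it is contained in $\langle X^{+}\rangle$. Linear parts: let $\mathfrak{n}=\langle y_1-b_1,\dots,y_N-b_N\rangle$ be a $K$-rational maximal ideal of a polynomial ring $K[y_1,\dots,y_N]$. For $f\in\mathfrak{n}$, $\mathrm{Lin}_{\mathfrak{n}}(f)$ is the homogeneous component of degree $1$ of $f$ written as a polynomial in $y_1-b_1,\dots,y_N-b_N$. For an ideal $J\subseteq\mathfrak{n}$, $\mathrm{Lin}_{\mathfrak{n}}(J)$ is the $K$-vector space spanned by $\mathrm{Lin}_{\mathfrak{n}}(f)$ for $f\in J$. The cotangent space is $\mathrm{Cot}_{\mathfrak{n}}(K[y_1,\dots,y_N]/J)=(\mathfrak{n}/J)/(\mathfrak{n}/J)^2$. A $K$-algebra is called a free $K$-algebra if it is isomorphic, as a $K$-algebra, to a polynomial ring (in finitely many indeterminates) over $K$. *)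

theory Defs
  imports
    "Jordan_Normal_Form.VS_Connect"
    "HOL-Algebra.Ring_Divisibility"
    "HOL-Algebra.Ideal_Product"
    "HOL-Library.Poly_Mapping"
    "HOL-Library.Extended_Nat"
begin

text \<open>These names clash with the record fields and the locale of \<open>HOL-Algebra\<close>.\<close>

hide_const (open) Multiset.mult Polynomial.smult Modules.module

section \<open>Polynomial rings as algebras over a field\<close>

text \<open>
  Polynomials in indeterminates indexed by \<^typ>\<open>nat\<close>: a finitely supported family of coefficients,
  indexed by finitely supported exponent vectors.  The base field \<open>K\<close> is a type of class
  \<^class>\<open>field\<close>, regarded as the structure \<^term>\<open>class_ring\<close>.  As in \<^locale>\<open>algebra\<close>, a
  \<open>K\<close>-algebra is a record of type \<^type>\<open>module\<close>, which extends \<^type>\<open>ring\<close>.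
\<close>

type_synonym 'k mpoly = "(nat \<Rightarrow>\<^sub>0 nat) \<Rightarrow>\<^sub>0 'k"

definition Const :: "'k::field \<Rightarrow> 'k mpoly" where
  "Const c = Poly_Mapping.single 0 c"

definition Var :: "nat \<Rightarrow> 'k::field mpoly" where
  "Var i = Poly_Mapping.single (Poly_Mapping.single i 1) 1"

definition poly_alg :: "nat set \<Rightarrow> ('k::field, 'k mpoly) module" where
  "poly_alg V = \<lparr>carrier = {p. \<forall>t\<in>Poly_Mapping.keys p. Poly_Mapping.keys t \<subseteq> V},
     mult = (*), one = 1, zero = 0, add = (+), smult = (\<lambda>c p. Const c * p)\<rparr>"

text \<open>The \<open>K\<close>-algebra homomorphism sending the \<open>i\<close>-th indeterminate to \<open>\<sigma> i\<close>.\<close>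

definition poly_subst :: "(nat \<Rightarrow> 'k::field mpoly) \<Rightarrow> 'k mpoly \<Rightarrow> 'k mpoly" where
  "poly_subst \<sigma> p = (\<Sum>t\<in>Poly_Mapping.keys p. Const (Poly_Mapping.lookup p t) *
     (\<Prod>i\<in>Poly_Mapping.keys t. \<sigma> i ^ Poly_Mapping.lookup t i))"

definition wdeg :: "(nat \<Rightarrow> int) \<Rightarrow> (nat \<Rightarrow>\<^sub>0 nat) \<Rightarrow> int" where
  "wdeg W t = (\<Sum>i\<in>Poly_Mapping.keys t. W i * int (Poly_Mapping.lookup t i))"

definition hom_comp :: "(nat \<Rightarrow> int) \<Rightarrow> int \<Rightarrow> 'k::field mpoly \<Rightarrow> 'k mpoly" where
  "hom_comp W d p = (\<Sum>t\<in>{t \<in> Poly_Mapping.keys p. wdeg W t = d}.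
     Poly_Mapping.single t (Poly_Mapping.lookup p t))"

definition homogeneous_ideal ::
    "nat set \<Rightarrow> (nat \<Rightarrow> int) \<Rightarrow> 'k::field mpoly set \<Rightarrow> bool" where
  "homogeneous_ideal V W I \<longleftrightarrow> ideal I (poly_alg V) \<and> (\<forall>f\<in>I. \<forall>d. hom_comp W d f \<in> I)"

section \<open>Quotient algebras and free algebras\<close>

text \<open>In \<^term>\<open>A Quot I\<close> elements are cosets; \<open>c\<close> times the coset of \<open>x\<close> is the coset of \<open>c x\<close>.\<close>

definition quot_alg :: "('k, 'a, 'z) module_scheme \<Rightarrow> 'a set \<Rightarrow> ('k, 'a set) module" where
  "quot_alg A I = \<lparr>carrier = carrier (A Quot I), mult = mult (A Quot I), one = one (A Quot I),
     zero = zero (A Quot I), add = add (A Quot I),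
     smult = (\<lambda>c X. \<Union>x\<in>X. I +>\<^bsub>A\<^esub> (c \<odot>\<^bsub>A\<^esub> x))\<rparr>"

text \<open>The ideal \<open>J/I\<close> of \<open>A/I\<close>, for an ideal \<open>J\<close> containing \<open>I\<close>.\<close>

definition quot_ideal :: "('a, 'z) ring_scheme \<Rightarrow> 'a set \<Rightarrow> 'a set \<Rightarrow> 'a set set" where
  "quot_ideal A J I = (\<lambda>x. I +>\<^bsub>A\<^esub> x) ` J"

definition free_algebra :: "('k::field, 'a, 'z) module_scheme \<Rightarrow> bool" where
  "free_algebra A \<longleftrightarrow> (\<exists>(r::nat) h. h \<in> ring_iso (poly_alg {..<r} :: ('k, 'k mpoly) module) A \<and>
     (\<forall>c. \<forall>p\<in>carrier (poly_alg {..<r}). h (c \<odot>\<^bsub>poly_alg {..<r}\<^esub> p) = c \<odot>\<^bsub>A\<^esub> h p))"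

section \<open>Linear parts and cotangent spaces\<close>

definition point_ideal :: "nat set \<Rightarrow> (nat \<Rightarrow> 'k::field) \<Rightarrow> 'k mpoly set" where
  "point_ideal V b = Idl\<^bsub>poly_alg V\<^esub> ((\<lambda>i. Var i - Const (b i)) ` V)"

text \<open>
  To write \<open>f\<close> as a polynomial in the \<open>y\<^sub>i - b\<^sub>i\<close>, substitute \<open>y\<^sub>i + b\<^sub>i\<close> for \<open>y\<^sub>i\<close>, and afterwards
  \<open>y\<^sub>i - b\<^sub>i\<close> for \<open>y\<^sub>i\<close>; the component of degree one is taken in between.
\<close>

definition lin_part :: "(nat \<Rightarrow> 'k::field) \<Rightarrow> 'k mpoly \<Rightarrow> 'k mpoly" where
  "lin_part b f = poly_subst (\<lambda>i. Var i - Const (b i))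
     (hom_comp (\<lambda>_. 1) 1 (poly_subst (\<lambda>i. Var i + Const (b i)) f))"

definition lin_space ::
    "nat set \<Rightarrow> (nat \<Rightarrow> 'k::field) \<Rightarrow> 'k mpoly set \<Rightarrow> ('k, 'k mpoly) module" where
  "lin_space V b J =
     (poly_alg V)\<lparr>carrier := LinearCombinations.module.span class_ring (poly_alg V) (lin_part b ` J)\<rparr>"

text \<open>
  The vector space \<open>\<mm>/\<mm>\<^sup>2\<close> for an ideal \<open>\<mm>\<close> of a \<open>K\<close>-algebra, over \<open>K\<close>.  The fields \<open>mult\<close> and
  \<open>one\<close> of a \<^type>\<open>module\<close> record play no role.
\<close>

definition cotangent :: "('k, 'a, 'z) module_scheme \<Rightarrow> 'a set \<Rightarrow> ('k, 'a set) module" where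
  "cotangent A \<mm> = (quot_alg A (\<mm> \<cdot>\<^bsub>A\<^esub> \<mm>))\<lparr>carrier := quot_ideal A \<mm> (\<mm> \<cdot>\<^bsub>A\<^esub> \<mm>)\<rparr>"

text \<open>
  The vector space \<open>\<mm>/\<mm>\<^sup>2\<close> over the residue field \<open>R/\<mm>\<close>: the coset of \<open>r\<close> modulo \<open>\<mm>\<close> times the
  coset of \<open>x\<close> modulo \<open>\<mm>\<^sup>2\<close> is the coset of \<open>r x\<close> modulo \<open>\<mm>\<^sup>2\<close>.
\<close>

definition residue_cotangent ::
    "('a, 'z) ring_scheme \<Rightarrow> 'a set \<Rightarrow> ('a set, 'a set) module" where
  "residue_cotangent R \<mm> = (let Q = R Quot (\<mm> \<cdot>\<^bsub>R\<^esub> \<mm>) in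
     \<lparr>carrier = quot_ideal R \<mm> (\<mm> \<cdot>\<^bsub>R\<^esub> \<mm>), mult = mult Q, one = one Q, zero = zero Q, add = add Q,
      smult = rcoset_mult R (\<mm> \<cdot>\<^bsub>R\<^esub> \<mm>)\<rparr>)"

section \<open>Localization, Krull dimension, regular local rings\<close>

definition frac_rel :: "('a, 'z) ring_scheme \<Rightarrow> 'a set \<Rightarrow> (('a \<times> 'a) \<times> ('a \<times> 'a)) set" where
  "frac_rel R S = {((r, s), (r', s')). r \<in> carrier R \<and> s \<in> S \<and> r' \<in> carrier R \<and> s' \<in> S \<and>
     (\<exists>u\<in>S. u \<otimes>\<^bsub>R\<^esub> (s' \<otimes>\<^bsub>R\<^esub> r \<ominus>\<^bsub>R\<^esub> s \<otimes>\<^bsub>R\<^esub> r') = \<zero>\<^bsub>R\<^esub>)}"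

definition loc_frac :: "('a, 'z) ring_scheme \<Rightarrow> 'a set \<Rightarrow> 'a \<Rightarrow> 'a \<Rightarrow> ('a \<times> 'a) set" where
  "loc_frac R S r s = frac_rel R S `` {(r, s)}"

definition localization :: "('a, 'z) ring_scheme \<Rightarrow> 'a set \<Rightarrow> ('a \<times> 'a) set ring" where
  "localization R S = \<lparr>carrier = (carrier R \<times> S) // frac_rel R S,
     mult = (\<lambda>X Y. \<Union>(r, s)\<in>X. \<Union>(r', s')\<in>Y. loc_frac R S (r \<otimes>\<^bsub>R\<^esub> r') (s \<otimes>\<^bsub>R\<^esub> s')),
     one = loc_frac R S \<one>\<^bsub>R\<^esub> \<one>\<^bsub>R\<^esub>,
     zero = loc_frac R S \<zero>\<^bsub>R\<^esub> \<one>\<^bsub>R\<^esub>,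
     add = (\<lambda>X Y. \<Union>(r, s)\<in>X. \<Union>(r', s')\<in>Y.
       loc_frac R S (s' \<otimes>\<^bsub>R\<^esub> r \<oplus>\<^bsub>R\<^esub> s \<otimes>\<^bsub>R\<^esub> r') (s \<otimes>\<^bsub>R\<^esub> s'))\<rparr>"

definition local_at :: "('a, 'z) ring_scheme \<Rightarrow> 'a set \<Rightarrow> ('a \<times> 'a) set ring" where
  "local_at R \<pp> = localization R (carrier R - \<pp>)"

text \<open>Supremum of the lengths of chains of prime ideals; the zero ring gets the value \<open>0\<close>.\<close>

definition krull_dim :: "('a, 'z) ring_scheme \<Rightarrow> enat" where
  "krull_dim R = Sup {enat k | k. \<exists>\<pp> :: nat \<Rightarrow> 'a set.
     (\<forall>i\<le>k. primeideal (\<pp> i) R) \<and> (\<forall>i<k. \<pp> i \<subset> \<pp> (Suc i))}"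

definition local_ring :: "('a, 'z) ring_scheme \<Rightarrow> 'a set \<Rightarrow> bool" where
  "local_ring R \<mm> \<longleftrightarrow> cring R \<and> maximalideal \<mm> R \<and> (\<forall>J. maximalideal J R \<longrightarrow> J = \<mm>)"

definition regular_local_ring :: "('a, 'z) ring_scheme \<Rightarrow> bool" where
  "regular_local_ring R \<longleftrightarrow> noetherian_ring R \<and>
     (\<exists>\<mm>. local_ring R \<mm> \<and>
       enat (vectorspace.dim (R Quot \<mm>) (residue_cotangent R \<mm>)) = krull_dim R)"

section \<open>Fibers\<close>

text \<open>
  The indeterminates are \<open>a\<^sub>1, \<dots>, a\<^sub>m\<close> (indices \<open>i < m\<close>) followed by \<open>x\<^sub>1, \<dots>, x\<^bsub>n-m\<^esub>\<close>
  (indices \<open>m \<le> j < n\<close>).  Thus \<open>P\<close>, \<open>P\<^sub>0\<close> and \<open>K[X\<^sup>+]\<close> are \<^term>\<open>poly_alg {..<n}\<close>,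
  \<^term>\<open>poly_alg {..<m}\<close> and \<^term>\<open>poly_alg {m..<n}\<close>.
\<close>

definition fiber_map :: "nat \<Rightarrow> (nat \<Rightarrow> 'k::field) \<Rightarrow> 'k mpoly \<Rightarrow> 'k mpoly" where
  "fiber_map m c = poly_subst (\<lambda>i. if i < m then Const (c i) else Var i)"

definition fiber_ideal :: "nat \<Rightarrow> (nat \<Rightarrow> 'k::field) \<Rightarrow> 'k mpoly set \<Rightarrow> 'k mpoly set" where
  "fiber_ideal m c I = fiber_map m c ` I"

text \<open>The point \<open>(c\<^sub>1, \<dots>, c\<^sub>m, 0, \<dots>, 0)\<close>, whose ideal is \<open>\<MM>\<^sub>\<Gamma>\<close>.\<close>

definition fiber_point :: "nat \<Rightarrow> (nat \<Rightarrow> 'k::field) \<Rightarrow> nat \<Rightarrow> 'k" where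
  "fiber_point m c i = (if i < m then c i else 0)"

end

theory Submission
  imports Defs
begin

text \<open>
  Since \<open>I \<inter> P\<^sub>0 = 0\<close>, the homogeneous elements of \<open>I\<close> have positive degree: each is a
  \<open>K[a]\<close>-linear combination of the indeterminates of its own degree plus terms that are of second
  order in \<open>x\<close>.  So the linear parts of \<open>I\<close> at the point \<open>(c, 0)\<close> involve only the \<open>x\<^sub>j\<close> and survive
  in the fiber.  Gaussian elimination over \<open>K[a]\<close>, with pivots that do not vanish at \<open>c\<close>, produces
  \<open>f\<^sub>t = h x\<^sub>t + \<psi>\<^sub>t \<in> I\<close> for \<open>t \<in> T\<close>, with \<open>h(c) \<noteq> 0\<close>, whose linear parts span \<open>Lin(I)\<close>; here \<open>\<psi>\<^sub>t\<close>
  involves only the \<open>a\<^sub>i\<close>, the free \<open>x\<^sub>s\<close> with \<open>s \<notin> T\<close>, and indeterminates of smaller degree than \<open>x\<^sub>t\<close>.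
  The \<open>a\<^sub>i - c\<^sub>i\<close> and the free \<open>x\<^sub>s\<close> then form bases of the cotangent spaces.

  Up to powers of \<open>h\<close>, every polynomial is congruent modulo \<open>I\<close> to one in the subring
  \<open>B = K[a\<^sub>i, x\<^sub>s | s \<notin> T]\<close>.  A chain of primes containing \<open>I\<close> and avoiding \<open>h\<close> thus contracts to a strict
  chain in \<open>B\<close>, whose length is at most the number of indeterminates of \<open>B\<close>.  If it attains this number,
  as regularity demands, then \<open>I \<inter> B = 0\<close>, since otherwise the zero ideal could be prepended.
  For the fiber this already says that it is the polynomial ring in the free \<open>x\<^sub>s\<close>.  To pass from
  \<open>I \<inter> B = 0\<close> to the fiber, solve the triangular system \<open>f\<^sub>t(c, x) = 0\<close> for the \<open>x\<^sub>t\<close> in terms of the \<open>x\<^sub>s\<close>: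
  the elements of \<open>I\<close> killed by this solution form an ideal containing the \<open>f\<^sub>t\<close>, hence equal \<open>I\<close>.
\<close>

section \<open>Polynomial substitution\<close>

text \<open>Setting a = c does not commute with intersecting with B: from I \<inter> B = 0 alone one
  cannot read off that the fiber ideal contains no nonzero polynomial in the free x_s. This is why
  the triangular system has to be solved explicitly; the positive degrees of the x_j make it
  triangular. The solution also yields the lower bound for the dimension of the fiber: following it
  by the map that kills the first k free x_s gives a prime kernel for each k up to the number of
  free x_s. These primes all lie in the ideal of the origin, so the fiber and its local ring get the
  same dimension. The condition h(c) \<noteq> 0 acts in two ways: a prime inside the maximal ideal
  of the point cannot contain h, and in the fiber h becomes a nonzero constant, so that there every
  chain of primes can be contracted and not only the chains at the origin. Primes of quotients and
  of local rings are replaced throughout by primes of the polynomial ring, and cotangent vectors by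
  first order coefficients at the point.\<close>

abbreviation polys :: "nat set \<Rightarrow> 'k::field mpoly set" where
  "polys V \<equiv> carrier (poly_alg V)"

lemma polys_iff: "p \<in> polys V \<longleftrightarrow> (\<forall>t\<in>Poly_Mapping.keys p. Poly_Mapping.keys t \<subseteq> V)"
  by (simp add: poly_alg_def)

lemma poly_alg_sel [simp]:
  "mult (poly_alg V) = (*)" "one (poly_alg V) = 1" "zero (poly_alg V) = 0"
  "add (poly_alg V) = (+)" "smult (poly_alg V) c p = Const c * p"
  by (simp_all add: poly_alg_def)

lemma Const_arith:
  "Const 0 = 0" "Const 1 = 1" "Const (a + b) = Const a + Const b"
  "Const (a * b) = Const a * Const b" "Const (- a) = - Const a" "Const (a - b) = Const a - Const b"
  by (simp_all add: Const_def single_add mult_single single_uminus single_diff)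

lemma Const_inject [simp]: "Const a = Const b \<longleftrightarrow> a = b"
  by (simp add: Const_def) (metis lookup_single_eq)

lemma Const_eq_0_iff [simp]: "Const a = 0 \<longleftrightarrow> a = 0"
  using Const_inject[of a 0] by (simp add: Const_arith)

lemma Const_power: "Const (a ^ n) = Const a ^ n"
  by (induction n) (simp_all add: Const_arith)

lemma Const_sum: "Const (sum f A) = (\<Sum>x\<in>A. Const (f x))"
  by (induction A rule: infinite_finite_induct) (simp_all add: Const_arith)

lemma mpoly_sum_singles:
  fixes p :: "'a \<Rightarrow>\<^sub>0 'b::comm_monoid_add"
  shows "p = (\<Sum>t\<in>Poly_Mapping.keys p. Poly_Mapping.single t (Poly_Mapping.lookup p t))"
  by (rule poly_mapping_eqI)
    (auto simp: lookup_sum lookup_single when_def in_keys_iff sum.If_cases)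

lemma polys_single [simp]: "Poly_Mapping.single t c \<in> polys V \<longleftrightarrow> c = 0 \<or> Poly_Mapping.keys t \<subseteq> V"
  by (auto simp: polys_iff)

lemma polys_Const [simp, intro]: "Const c \<in> polys V"
  by (simp add: Const_def)

lemma polys_Var [simp]: "Var i \<in> polys V \<longleftrightarrow> i \<in> V"
  by (simp add: Var_def)

lemma polys_0 [simp, intro]: "0 \<in> polys V"
  by (simp add: polys_iff)

lemma polys_1 [simp, intro]: "1 \<in> polys V"
  using polys_Const[of 1] by (simp add: Const_arith)

lemma polys_add [intro]: "p \<in> polys V \<Longrightarrow> q \<in> polys V \<Longrightarrow> p + q \<in> polys V"
  unfolding polys_iff by (meson Poly_Mapping.keys_add UnE subsetD)

lemma keys_add_nat: "Poly_Mapping.keys (s + t :: 'a \<Rightarrow>\<^sub>0 nat) = Poly_Mapping.keys s \<union> Poly_Mapping.keys t"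
  by (auto simp: in_keys_iff lookup_add)

lemma polys_mult [intro]:
  assumes "p \<in> polys V" "q \<in> polys V" shows "p * q \<in> polys V"
  unfolding polys_iff
proof
  fix t assume "t \<in> Poly_Mapping.keys (p * q)"
  then obtain a b where "a \<in> Poly_Mapping.keys p" "b \<in> Poly_Mapping.keys q" "t = a + b"
    using keys_mult[of p q] by blast
  with assms show "Poly_Mapping.keys t \<subseteq> V" by (auto simp: polys_iff keys_add_nat)
qed

lemma polys_uminus [intro]: "p \<in> polys V \<Longrightarrow> - p \<in> polys V"
  by (simp add: polys_iff)

lemma polys_diff [intro]: "p \<in> polys V \<Longrightarrow> q \<in> polys V \<Longrightarrow> p - q \<in> polys V"
  using polys_add[of p V "- q"] by auto

lemma polys_power [intro]: "p \<in> polys V \<Longrightarrow> p ^ n \<in> polys V"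
  by (induction n) auto

lemma polys_sum [intro]: "(\<And>x. x \<in> A \<Longrightarrow> f x \<in> polys V) \<Longrightarrow> sum f A \<in> polys V"
  by (induction A rule: infinite_finite_induct) auto

lemma polys_prod [intro]: "(\<And>x. x \<in> A \<Longrightarrow> f x \<in> polys V) \<Longrightarrow> prod f A \<in> polys V"
  by (induction A rule: infinite_finite_induct) auto

lemma polys_mono: "p \<in> polys V \<Longrightarrow> V \<subseteq> V' \<Longrightarrow> p \<in> polys V'"
  by (auto simp: polys_iff)

definition power_prod :: "(nat \<Rightarrow> 'a::comm_semiring_1) \<Rightarrow> (nat \<Rightarrow>\<^sub>0 nat) \<Rightarrow> 'a" where
  "power_prod \<sigma> t = (\<Prod>i\<in>Poly_Mapping.keys t. \<sigma> i ^ Poly_Mapping.lookup t i)"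

lemma power_prod_superset:
  "finite A \<Longrightarrow> Poly_Mapping.keys t \<subseteq> A \<Longrightarrow> power_prod \<sigma> t = (\<Prod>i\<in>A. \<sigma> i ^ Poly_Mapping.lookup t i)"
  unfolding power_prod_def by (rule prod.mono_neutral_left) (auto simp: in_keys_iff)

lemma power_prod_add: "power_prod \<sigma> (s + t) = power_prod \<sigma> s * power_prod \<sigma> t"
proof -
  let ?A = "Poly_Mapping.keys s \<union> Poly_Mapping.keys t"
  show ?thesis
    by (simp add: power_prod_superset[of ?A] keys_add_nat lookup_add power_add prod.distrib)
qed

lemma power_prod_0 [simp]: "power_prod \<sigma> 0 = 1"
  by (simp add: power_prod_def)

lemma power_prod_single [simp]: "power_prod \<sigma> (Poly_Mapping.single i n) = \<sigma> i ^ n"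
  by (cases "n = 0") (simp_all add: power_prod_def)

lemma power_prod_Var: "power_prod Var t = Poly_Mapping.single t (1::'k::field)"
proof -
  have V: "Var i ^ n = Poly_Mapping.single (Poly_Mapping.single i n) (1::'k)" for i n
    by (induction n) (simp_all add: Var_def mult_single single_add[symmetric])
  have *: "(\<Prod>i\<in>A. Poly_Mapping.single (Poly_Mapping.single i (f i)) (1::'k))
      = Poly_Mapping.single (\<Sum>i\<in>A. Poly_Mapping.single i (f i)) 1" if "finite A" for A and f :: "nat \<Rightarrow> nat"
    using that by induction (simp_all add: mult_single)
  \<comment> \<open>Exponent vectors are finitely supported maps as well, so \<open>t\<close> itself
    is the sum of its singles.\<close>
  show ?thesis
    unfolding power_prod_def V using mpoly_sum_singles[of t] by (simp add: *)
qed

text \<open>Allows polynomials with different supports to be written as sums over one common index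
  set, which is what additivity requires.\<close>

lemma poly_subst_superset:
  "finite A \<Longrightarrow> Poly_Mapping.keys p \<subseteq> A \<Longrightarrow>
    poly_subst \<sigma> p = (\<Sum>t\<in>A. Const (Poly_Mapping.lookup p t) * power_prod \<sigma> t)"
  unfolding poly_subst_def power_prod_def[symmetric]
  by (rule sum.mono_neutral_left) (auto simp: in_keys_iff Const_arith)

lemma poly_subst_add: "poly_subst \<sigma> (p + q) = poly_subst \<sigma> p + poly_subst \<sigma> q"
proof -
  let ?A = "Poly_Mapping.keys p \<union> Poly_Mapping.keys q"
  have "Poly_Mapping.keys (p + q) \<subseteq> ?A" by (rule Poly_Mapping.keys_add)
  then show ?thesis
    by (simp add: poly_subst_superset[of ?A] lookup_add Const_arith distrib_right sum.distrib)
qed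

lemma poly_subst_0 [simp]: "poly_subst \<sigma> 0 = 0"
  by (simp add: poly_subst_def)

lemma poly_subst_sum: "poly_subst \<sigma> (sum f A) = (\<Sum>x\<in>A. poly_subst \<sigma> (f x))"
  by (induction A rule: infinite_finite_induct) (simp_all add: poly_subst_add)

lemma poly_subst_single: "poly_subst \<sigma> (Poly_Mapping.single t c) = Const c * power_prod \<sigma> t"
  by (subst poly_subst_superset[of "{t}"]) auto

lemma single_eq_Const_power_prod: "Poly_Mapping.single t c = Const c * power_prod Var t"
  by (simp add: power_prod_Var Const_def mult_single)

lemma mpoly_induct [case_names single add]:
  assumes "\<And>t c. P (Poly_Mapping.single t c)" "\<And>p q. P p \<Longrightarrow> P q \<Longrightarrow> P (p + q)"
  shows "P (p :: 'k::field mpoly)"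
proof -
  have P0: "P 0" using assms(1)[of 0 0] by simp
  have "P (\<Sum>t\<in>A. Poly_Mapping.single t (f t))" if "finite A" for A and f :: "_ \<Rightarrow> 'k"
    using that by (induction rule: finite_induct) (simp_all add: assms P0)
  from this[of "Poly_Mapping.keys p" "Poly_Mapping.lookup p"] show ?thesis
    using mpoly_sum_singles[of p] by simp
qed

lemma poly_subst_mult: "poly_subst \<sigma> (p * q) = poly_subst \<sigma> p * poly_subst \<sigma> q"
proof (induction p rule: mpoly_induct)
  case (single s a)
  show ?case
    by (induction q rule: mpoly_induct)
      (simp_all add: mult_single poly_subst_single power_prod_add Const_arith distrib_left poly_subst_add
        mult.assoc mult.left_commute)
qed (simp add: distrib_right poly_subst_add)

lemma poly_subst_Const [simp]: "poly_subst \<sigma> (Const c) = Const c"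
  by (simp add: Const_def poly_subst_single[unfolded Const_def])

lemma poly_subst_Var [simp]: "poly_subst \<sigma> (Var i) = \<sigma> i"
  using poly_subst_single[of \<sigma> "Poly_Mapping.single i 1" 1] by (simp add: Var_def Const_arith)

lemma poly_subst_1 [simp]: "poly_subst \<sigma> 1 = 1"
  using poly_subst_Const[of \<sigma> 1] by (simp add: Const_arith)

lemma poly_subst_uminus: "poly_subst \<sigma> (- p) = - poly_subst \<sigma> p"
  using poly_subst_add[of \<sigma> p "- p"] by (simp add: eq_neg_iff_add_eq_0 add.commute)

lemma poly_subst_diff: "poly_subst \<sigma> (p - q) = poly_subst \<sigma> p - poly_subst \<sigma> q"
  using poly_subst_add[of \<sigma> p "- q"] by (simp add: poly_subst_uminus)

lemma poly_subst_power: "poly_subst \<sigma> (p ^ n) = poly_subst \<sigma> p ^ n"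
  by (induction n) (simp_all add: poly_subst_mult)

lemmas poly_subst_hom = poly_subst_add poly_subst_mult poly_subst_uminus poly_subst_diff
  poly_subst_power poly_subst_sum

text \<open>The constants and the indeterminates generate the ring. Most identities between
  substitutions, values and first order coefficients below are checked on these generators
  only.\<close>

lemma polys_induct [consumes 1, case_names Const Var add mult]:
  assumes "p \<in> polys V"
    and Const: "\<And>c. P (Const c)" and Var: "\<And>i. i \<in> V \<Longrightarrow> P (Var i)"
    and add: "\<And>p q. p \<in> polys V \<Longrightarrow> q \<in> polys V \<Longrightarrow> P p \<Longrightarrow> P q \<Longrightarrow> P (p + q)"
    and mult: "\<And>p q. p \<in> polys V \<Longrightarrow> q \<in> polys V \<Longrightarrow> P p \<Longrightarrow> P q \<Longrightarrow> P (p * q)"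
  shows "P (p :: 'k::field mpoly)"
proof -
  have 1: "P 1" using Const[of 1] by (simp add: Const_arith)
  have pow: "P (Var i ^ n)" if "i \<in> V" for i n
    by (induction n) (use that in \<open>auto intro!: 1 mult Var\<close>)
  have prod: "P (\<Prod>i\<in>A. Var i ^ f i)" if "finite A" "A \<subseteq> V" for A and f :: "nat \<Rightarrow> nat"
    using that by induction (auto intro!: 1 mult pow polys_prod polys_power)
  have "P (\<Sum>t\<in>A. Poly_Mapping.single t (Poly_Mapping.lookup p t))"
    if "finite A" "A \<subseteq> Poly_Mapping.keys p" for A
    using that
  proof induction
    case empty show ?case using Const[of 0] by (simp add: Const_arith)
  next
    case (insert t A)
    have t: "Poly_Mapping.keys t \<subseteq> V" using insert.prems assms(1) by (auto simp: polys_iff)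
    have "P (Poly_Mapping.single t (Poly_Mapping.lookup p t))"
      unfolding single_eq_Const_power_prod power_prod_def
      using t by (intro mult Const prod) (auto intro!: polys_prod polys_power)
    moreover have "(\<Sum>t\<in>A. Poly_Mapping.single t (Poly_Mapping.lookup p t)) \<in> polys V"
      using insert.prems assms(1) by (intro polys_sum) (auto simp: polys_iff)
    ultimately show ?case using insert t by (auto intro!: add)
  qed
  from this[of "Poly_Mapping.keys p"] show ?thesis using mpoly_sum_singles[of p] by simp
qed

lemma poly_subst_closed:
  assumes "p \<in> polys V" "\<And>i. i \<in> V \<Longrightarrow> \<sigma> i \<in> polys V'"
  shows "poly_subst \<sigma> p \<in> polys V'"
  using assms(1) by (induction rule: polys_induct) (auto simp: poly_subst_hom assms(2))

lemma poly_subst_cong: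
  assumes "p \<in> polys V" "\<And>i. i \<in> V \<Longrightarrow> \<sigma> i = \<tau> i"
  shows "poly_subst \<sigma> p = poly_subst \<tau> p"
  using assms(1) by (induction rule: polys_induct) (auto simp: poly_subst_hom assms(2))

lemma polys_UNIV [simp]: "p \<in> polys UNIV" by (simp add: polys_iff)

lemma poly_subst_poly_subst:
  "poly_subst \<sigma> (poly_subst \<tau> p) = poly_subst (\<lambda>i. poly_subst \<sigma> (\<tau> i)) p"
proof -
  have "p \<in> polys UNIV" by simp
  then show ?thesis by (induction rule: polys_induct) (auto simp: poly_subst_hom)
qed

lemma poly_subst_id:
  assumes "p \<in> polys V" "\<And>i. i \<in> V \<Longrightarrow> \<sigma> i = Var i"
  shows "poly_subst \<sigma> p = p"
  using assms(1) by (induction rule: polys_induct) (auto simp: poly_subst_hom assms(2))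

lemma cring_poly_alg: "cring (poly_alg V :: ('k::field, 'k mpoly) module)"
proof (intro cringI abelian_groupI comm_monoidI)
  fix x :: "'k mpoly" assume "x \<in> polys V"
  then show "\<exists>y\<in>polys V. y \<oplus>\<^bsub>poly_alg V\<^esub> x = \<zero>\<^bsub>poly_alg V\<^esub>"
    by (intro bexI[of _ "- x"]) auto
qed (auto simp: algebra_simps)

section \<open>Evaluation and first order coefficients at a point\<close>

text \<open>The value at \<open>b\<close>, and after it the partial derivative at \<open>b\<close>,
  read off as coefficients once \<open>b\<close> has been moved to the origin. This is the same
  translation that occurs inside \<open>lin_part\<close>.\<close>

definition ev :: "(nat \<Rightarrow> 'k) \<Rightarrow> 'k::field mpoly \<Rightarrow> 'k" where
  "ev b p = Poly_Mapping.lookup (poly_subst (\<lambda>i. Var i + Const (b i)) p) 0"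

definition dcoef :: "(nat \<Rightarrow> 'k) \<Rightarrow> nat \<Rightarrow> 'k::field mpoly \<Rightarrow> 'k" where
  "dcoef b j p = Poly_Mapping.lookup (poly_subst (\<lambda>i. Var i + Const (b i)) p) (Poly_Mapping.single j (Suc 0))"

lemma add_eq_0_pm: "s + t = 0 \<longleftrightarrow> s = 0 \<and> t = (0 :: 'a \<Rightarrow>\<^sub>0 nat)"
  by (auto simp: poly_mapping_eq_iff fun_eq_iff lookup_add)

lemma add_eq_single_pm:
  "s + t = Poly_Mapping.single j (Suc 0) \<longleftrightarrow>
    s = 0 \<and> t = Poly_Mapping.single j (Suc 0) \<or> s = Poly_Mapping.single j (Suc 0) \<and> t = 0"
proof
  assume e: "s + t = Poly_Mapping.single j (Suc 0)"
  have k: "Poly_Mapping.lookup s i + Poly_Mapping.lookup t i = (if i = j then 1 else 0)" for i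
    using arg_cong[OF e, of "\<lambda>x. Poly_Mapping.lookup x i"] by (simp add: lookup_add lookup_single when_def)
  have "Poly_Mapping.lookup s j = 0 \<or> Poly_Mapping.lookup s j = 1" using k[of j] by auto
  then show "s = 0 \<and> t = Poly_Mapping.single j (Suc 0) \<or> s = Poly_Mapping.single j (Suc 0) \<and> t = 0"
  proof
    assume "Poly_Mapping.lookup s j = 0"
    then have "s = 0" using k by (intro poly_mapping_eqI) (metis add_is_0 lookup_zero)
    then show ?thesis using e by simp
  next
    assume "Poly_Mapping.lookup s j = 1"
    then have "t = 0" using k by (intro poly_mapping_eqI) (metis add_is_0 lookup_zero add_cancel_right_right)
    then show ?thesis using e by simp
  qed
qed auto

lemma single_nat_neq_0: "Poly_Mapping.single j (Suc 0) \<noteq> 0"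
  by (metis lookup_single_eq lookup_zero nat.distinct(1))

lemma lookup_mult_0: "Poly_Mapping.lookup (p * q :: 'k::field mpoly) 0 = Poly_Mapping.lookup p 0 * Poly_Mapping.lookup q 0"
proof (induction p rule: mpoly_induct)
  case (single s a)
  show ?case
    by (induction q rule: mpoly_induct)
      (auto simp: mult_single lookup_single when_def add_eq_0_pm distrib_left lookup_add)
qed (simp add: distrib_right lookup_add)

text \<open>An exponent vector of degree one splits only as 0 + t or t + 0; this is the source of
  the product rule for \<open>dcoef\<close>.\<close>

lemma lookup_mult_single1: "Poly_Mapping.lookup (p * q :: 'k::field mpoly) (Poly_Mapping.single j (Suc 0)) =
   Poly_Mapping.lookup p 0 * Poly_Mapping.lookup q (Poly_Mapping.single j (Suc 0)) +
   Poly_Mapping.lookup p (Poly_Mapping.single j (Suc 0)) * Poly_Mapping.lookup q 0"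
proof (induction p rule: mpoly_induct)
  case (single s a)
  show ?case
    by (induction q rule: mpoly_induct)
      (auto simp: mult_single lookup_single when_def add_eq_single_pm
        single_nat_neq_0 single_nat_neq_0[symmetric] distrib_left lookup_add)
qed (simp add: distrib_right lookup_add)

lemma ev_Const [simp]: "ev b (Const c) = c"
  by (simp add: ev_def) (simp add: Const_def)

lemma ev_0 [simp]: "ev b 0 = 0" and ev_1 [simp]: "ev b 1 = 1"
  using ev_Const[of b 0] ev_Const[of b 1] by (simp_all add: Const_arith)

lemma ev_Var [simp]: "ev b (Var i) = b i"
  by (simp add: ev_def lookup_add) (simp add: Var_def Const_def lookup_single when_def single_nat_neq_0)

lemma ev_add: "ev b (p + q) = ev b p + ev b q"
  by (simp add: ev_def poly_subst_hom lookup_add)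
lemma ev_mult: "ev b (p * q) = ev b p * ev b q"
  by (simp add: ev_def poly_subst_hom lookup_mult_0)
lemma ev_uminus: "ev b (- p) = - ev b p"
  by (simp add: ev_def poly_subst_hom)
lemma ev_diff: "ev b (p - q) = ev b p - ev b q"
  by (simp add: ev_def poly_subst_hom lookup_minus)
lemma ev_power: "ev b (p ^ n) = ev b p ^ n"
  by (induction n) (simp_all add: ev_mult)
lemma ev_sum: "ev b (sum f A) = (\<Sum>x\<in>A. ev b (f x))"
  by (induction A rule: infinite_finite_induct) (simp_all add: ev_add)
lemmas ev_hom = ev_add ev_mult ev_uminus ev_diff ev_power ev_sum

text \<open>Ensures later that kernels of substitutions fixing the origin stay inside the maximal
  ideal of the origin.\<close>

lemma ev_poly_subst_origin:
  assumes "\<And>i. ev (\<lambda>_. 0) (\<tau> i) = 0"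
  shows "ev (\<lambda>_. 0) (poly_subst \<tau> p) = ev (\<lambda>_. 0) p"
proof -
  have "p \<in> polys UNIV" by simp
  then show ?thesis by (induction rule: polys_induct) (auto simp: poly_subst_hom ev_hom assms)
qed

lemma dcoef_Const [simp]: "dcoef b j (Const c) = 0"
  by (simp add: dcoef_def) (simp add: Const_def lookup_single when_def single_nat_neq_0[symmetric])
lemma dcoef_0 [simp]: "dcoef b j 0 = 0" and dcoef_1 [simp]: "dcoef b j 1 = 0"
  using dcoef_Const[of b j 0] dcoef_Const[of b j 1] by (simp_all add: Const_arith)
lemma dcoef_Var [simp]: "dcoef b j (Var i) = (if i = j then 1 else 0)"
  by (simp add: dcoef_def lookup_add) (auto simp: Var_def Const_def lookup_single when_def single_nat_neq_0[symmetric]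
    poly_mapping_eq_iff fun_eq_iff split: if_splits)
lemma dcoef_add: "dcoef b j (p + q) = dcoef b j p + dcoef b j q"
  by (simp add: dcoef_def poly_subst_hom lookup_add)
lemma dcoef_mult: "dcoef b j (p * q) = ev b p * dcoef b j q + dcoef b j p * ev b q"
  by (simp add: dcoef_def ev_def poly_subst_hom lookup_mult_single1)
lemma dcoef_uminus: "dcoef b j (- p) = - dcoef b j p"
  by (simp add: dcoef_def poly_subst_hom)
lemma dcoef_diff: "dcoef b j (p - q) = dcoef b j p - dcoef b j q"
  by (simp add: dcoef_def poly_subst_hom lookup_minus)
lemma dcoef_sum: "dcoef b j (sum f A) = (\<Sum>x\<in>A. dcoef b j (f x))"
  by (induction A rule: infinite_finite_induct) (simp_all add: dcoef_add)
lemmas dcoef_hom = dcoef_add dcoef_mult dcoef_uminus dcoef_diff dcoef_sum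

lemma wdeg_one_iff: "wdeg (\<lambda>_. 1) t = 1 \<longleftrightarrow> (\<exists>j. t = Poly_Mapping.single j (Suc 0))"
proof
  assume "wdeg (\<lambda>_. 1) t = 1"
  then have s: "(\<Sum>i\<in>Poly_Mapping.keys t. Poly_Mapping.lookup t i) = 1"
    by (simp add: wdeg_def flip: of_nat_sum)
  then obtain j where j: "j \<in> Poly_Mapping.keys t" by (metis ex_in_conv sum.empty zero_neq_one)
  then have "Poly_Mapping.lookup t j + (\<Sum>i\<in>Poly_Mapping.keys t - {j}. Poly_Mapping.lookup t i) = 1"
    using s by (simp add: sum.remove)
  moreover have "Poly_Mapping.lookup t j \<noteq> 0" using j by (simp add: in_keys_iff)
  ultimately have l: "Poly_Mapping.lookup t j = 1" and z: "\<forall>i\<in>Poly_Mapping.keys t - {j}. Poly_Mapping.lookup t i = 0"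
    by (auto simp: add_is_1)
  have "t = Poly_Mapping.single j (Suc 0)"
  proof (rule poly_mapping_eqI)
    fix i show "Poly_Mapping.lookup t i = Poly_Mapping.lookup (Poly_Mapping.single j (Suc 0)) i"
      using l z by (cases "i = j") (simp_all add: lookup_single_not_eq, meson DiffI in_keys_iff singletonD)
  qed
  then show "\<exists>j. t = Poly_Mapping.single j (Suc 0)" ..
qed (auto simp: wdeg_def)

text \<open>Turns questions about linear parts into linear algebra with the scalars
  \<open>dcoef b j f\<close>.\<close>

lemma lin_part_eq:
  assumes "finite V" "f \<in> polys V"
  shows "lin_part b f = (\<Sum>j\<in>V. Const (dcoef b j f) * (Var j - Const (b j)))"
proof -
  define q where "q = poly_subst (\<lambda>i. Var i + Const (b i)) f"
  have q: "q \<in> polys V" unfolding q_def using assms by (intro poly_subst_closed) (auto intro!: polys_add)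
  let ?s = "\<lambda>j. Poly_Mapping.single j (Suc 0)"
  have "hom_comp (\<lambda>_. 1) 1 q = (\<Sum>t\<in>?s ` V. Poly_Mapping.single t (Poly_Mapping.lookup q t))"
    unfolding hom_comp_def
  proof (rule sum.mono_neutral_left)
    show "{t \<in> Poly_Mapping.keys q. wdeg (\<lambda>_. 1) t = 1} \<subseteq> ?s ` V"
      using q by (auto simp: wdeg_one_iff polys_iff)
  qed (use assms in \<open>auto simp: in_keys_iff wdeg_one_iff\<close>)
  also have "\<dots> = (\<Sum>j\<in>V. Const (dcoef b j f) * Var j)"
    by (subst sum.reindex) (auto simp: inj_on_def dcoef_def q_def Var_def Const_def mult_single
      poly_mapping_eq_iff fun_eq_iff lookup_single when_def split: if_splits)
  finally show ?thesis unfolding lin_part_def q_def by (simp add: poly_subst_hom)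
qed

section \<open>Prime ideals of polynomial rings and the dimension bound\<close>

text \<open>Ideals in terms of the type class operations, so that arithmetic in them needs no record
  structure; \<open>ideal_poly_alg_iff\<close> is the bridge.\<close>

definition poly_ideal :: "nat set \<Rightarrow> 'k::field mpoly set \<Rightarrow> bool" where
  "poly_ideal V J \<longleftrightarrow> J \<subseteq> polys V \<and> 0 \<in> J \<and> (\<forall>p\<in>J. \<forall>q\<in>J. p + q \<in> J) \<and>
     (\<forall>p\<in>polys V. \<forall>q\<in>J. p * q \<in> J)"

definition poly_prime :: "nat set \<Rightarrow> 'k::field mpoly set \<Rightarrow> bool" where
  "poly_prime V J \<longleftrightarrow> poly_ideal V J \<and> 1 \<notin> J \<and>
     (\<forall>p\<in>polys V. \<forall>q\<in>polys V. p * q \<in> J \<longrightarrow> p \<in> J \<or> q \<in> J)"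

lemma poly_idealD:
  assumes "poly_ideal V J"
  shows "J \<subseteq> polys V" "p \<in> J \<Longrightarrow> p \<in> polys V" "0 \<in> J" "p \<in> J \<Longrightarrow> q \<in> J \<Longrightarrow> p + q \<in> J"
    "p \<in> polys V \<Longrightarrow> q \<in> J \<Longrightarrow> p * q \<in> J" "p \<in> polys V \<Longrightarrow> q \<in> J \<Longrightarrow> q * p \<in> J"
  using assms by (auto simp: poly_ideal_def mult.commute[of q p])

lemma poly_ideal_uminus: "poly_ideal V J \<Longrightarrow> p \<in> J \<Longrightarrow> - p \<in> J"
  using poly_idealD(5)[of V J "- 1" p] by auto

lemma poly_ideal_diff: "poly_ideal V J \<Longrightarrow> p \<in> J \<Longrightarrow> q \<in> J \<Longrightarrow> p - q \<in> J"
  using poly_idealD(4)[of V J p "- q"] poly_ideal_uminus[of V J q] by auto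

lemma poly_ideal_sum: "poly_ideal V J \<Longrightarrow> (\<And>x. x \<in> A \<Longrightarrow> f x \<in> J) \<Longrightarrow> sum f A \<in> J"
  by (induction A rule: infinite_finite_induct) (auto simp: poly_idealD)

lemma a_inv_poly_alg [simp]:
  assumes "p \<in> polys V" shows "\<ominus>\<^bsub>poly_alg V\<^esub> p = - p"
proof -
  interpret cring "poly_alg V" by (rule cring_poly_alg)
  have "- p \<oplus>\<^bsub>poly_alg V\<^esub> p = \<zero>\<^bsub>poly_alg V\<^esub>" by simp
  with assms show ?thesis using minus_equality[of "- p" p] by auto
qed

lemma a_minus_poly_alg [simp]:
  "p \<in> polys V \<Longrightarrow> q \<in> polys V \<Longrightarrow> p \<ominus>\<^bsub>poly_alg V\<^esub> q = p - q"
  by (simp add: a_minus_def)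

lemma ideal_poly_alg_iff: "ideal J (poly_alg V) \<longleftrightarrow> poly_ideal V J"
proof
  assume "ideal J (poly_alg V)"
  then interpret ideal J "poly_alg V" .
  show "poly_ideal V J"
    unfolding poly_ideal_def
    using a_subset additive_subgroup.zero_closed[OF is_additive_subgroup]
      additive_subgroup.a_closed[OF is_additive_subgroup] I_l_closed
    by simp
next
  assume J: "poly_ideal V J"
  interpret cring "poly_alg V" by (rule cring_poly_alg)
  show "ideal J (poly_alg V)"
  proof (rule idealI)
    show "subgroup J (add_monoid (poly_alg V))"
    proof (rule add.subgroupI)
      fix p assume "p \<in> J"
      then show "\<ominus>\<^bsub>poly_alg V\<^esub> p \<in> J"
        using J poly_ideal_uminus[OF J] poly_idealD(2)[OF J] by simp
    qed (use J in \<open>auto simp: poly_ideal_def\<close>)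
  qed (use J in \<open>auto simp: poly_idealD ring_axioms\<close>)
qed

lemma lookup_single_mult_add:
  fixes p :: "'k::field mpoly"
  shows "Poly_Mapping.lookup (Poly_Mapping.single s c * p) (s + u) = c * Poly_Mapping.lookup p u"
  by (induction p rule: mpoly_induct)
    (auto simp: mult_single lookup_single when_def distrib_left lookup_add)

lemma polys_split_var:
  assumes "q \<in> polys V" "z \<in> V"
  shows "\<exists>q0\<in>polys (V - {z}). \<exists>q1\<in>polys V. q = q0 + Var z * q1"
  using assms(1)
proof (induction rule: polys_induct)
  case (Const c)
  show ?case by (intro bexI[of _ "Const c"] bexI[of _ 0]) auto
next
  case (Var i)
  show ?case
  proof (cases "i = z")
    case True
    then show ?thesis by (intro bexI[of _ 0] bexI[of _ 1]) auto
  next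
    case False
    with Var show ?thesis by (intro bexI[of _ "Var i"] bexI[of _ 0]) auto
  qed
next
  case (add p q)
  then obtain p0 p1 q0 q1 where "p0 \<in> polys (V - {z})" "p1 \<in> polys V" "p = p0 + Var z * p1"
    "q0 \<in> polys (V - {z})" "q1 \<in> polys V" "q = q0 + Var z * q1" by blast
  then show ?case
    by (intro bexI[of _ "p0 + q0"] bexI[of _ "p1 + q1"]) (auto simp: algebra_simps)
next
  case (mult p q)
  then obtain p0 p1 q0 q1 where pq: "p0 \<in> polys (V - {z})" "p1 \<in> polys V" "p = p0 + Var z * p1"
    "q0 \<in> polys (V - {z})" "q1 \<in> polys V" "q = q0 + Var z * q1" by blast
  then have "p0 \<in> polys V" "q0 \<in> polys V" by (auto intro: polys_mono)
  with pq show ?case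
    by (intro bexI[of _ "p0 * q0"] bexI[of _ "p0 * q1 + p1 * q0 + Var z * p1 * q1"])
      (auto simp: algebra_simps assms(2) intro!: polys_add polys_mult)
qed

lemma polys_lowest_term:
  assumes "q \<in> polys V" "q \<noteq> 0" "z \<in> V"
  shows "\<exists>m. \<exists>q0\<in>polys (V - {z}). \<exists>q1\<in>polys V. q0 \<noteq> 0 \<and> q = Var z ^ m * (q0 + Var z * q1)"
proof -
  \<comment> \<open>The induction is on a strict bound for the exponents of \<open>z\<close>; each
    division by \<open>z\<close> lowers it by one.\<close>
  have "\<exists>N. \<forall>t\<in>Poly_Mapping.keys q. Poly_Mapping.lookup t z < N"
    using finite_nat_set_iff_bounded[of "(\<lambda>t. Poly_Mapping.lookup t z) ` Poly_Mapping.keys q"] by auto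
  then obtain N where "\<forall>t\<in>Poly_Mapping.keys q. Poly_Mapping.lookup t z < N" ..
  then show ?thesis using assms(1,2)
  proof (induction N arbitrary: q)
    case 0
    then show ?case by auto
  next
    case (Suc N)
    obtain q0 q1 where q: "q0 \<in> polys (V - {z})" "q1 \<in> polys V" "q = q0 + Var z * q1"
      using polys_split_var[OF Suc.prems(2) assms(3)] by blast
    show ?case
    proof (cases "q0 = 0")
      case False
      with q show ?thesis
        by (intro exI[of _ 0] bexI[of _ q0] bexI[of _ q1]) auto
    next
      case True
      have "Poly_Mapping.lookup t z < N" if "t \<in> Poly_Mapping.keys q1" for t
      proof -
        have "Poly_Mapping.lookup q (Poly_Mapping.single z 1 + t) = Poly_Mapping.lookup q1 t"
          using q True lookup_single_mult_add[of "Poly_Mapping.single z 1" 1 q1 t] by (simp add: Var_def)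
        then have "Poly_Mapping.single z 1 + t \<in> Poly_Mapping.keys q" using that by (simp add: in_keys_iff)
        from Suc.prems(1)[rule_format, OF this] show ?thesis by (simp add: lookup_add)
      qed
      moreover have "q1 \<noteq> 0" using q True Suc.prems by auto
      ultimately obtain m r0 r1 where r: "r0 \<in> polys (V - {z})" "r1 \<in> polys V" "r0 \<noteq> 0"
        "q1 = Var z ^ m * (r0 + Var z * r1)" using Suc.IH[of q1] q(2) by blast
      then show ?thesis using q(3) True
        by (intro exI[of _ "Suc m"] bexI[of _ r0] bexI[of _ r1]) auto
    qed
  qed
qed

lemma poly_prime_powerD:
  assumes "poly_prime V J" "p \<in> polys V" "q \<in> polys V" "p ^ m * q \<in> J" "p \<notin> J"
  shows "q \<in> J"
  using assms(4)
proof (induction m)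
  case (Suc m)
  have "p * (p ^ m * q) \<in> J" using Suc.prems by (simp add: mult.assoc)
  moreover have "p ^ m * q \<in> polys V" using assms by (intro polys_mult polys_power)
  ultimately have "p ^ m * q \<in> J" using assms by (meson poly_prime_def)
  then show ?case by (rule Suc.IH)
qed simp

text \<open>Elements \<open>x\<^sub>i \<in> P\<^sub>i - P\<^bsub>i-1\<^esub>\<close> are algebraically independent: in a relation, divide by the
  largest power of the first indeterminate and pass to the next prime, which contains the rest.\<close>

lemma prime_chain_independent:
  fixes x :: "nat \<Rightarrow> 'k::field mpoly"
  assumes prime: "\<And>i. i \<le> k \<Longrightarrow> poly_prime V (P i)"
    and sub: "\<And>i. i < k \<Longrightarrow> P i \<subseteq> P (Suc i)"
    and x: "\<And>i. i < k \<Longrightarrow> x (Suc i) \<in> P (Suc i) - P i"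
    and "j \<le> k" "q \<in> polys {j<..k}" "poly_subst x q \<in> P j"
  shows "q = 0"
  using assms(4-6)
proof (induction "k - j" arbitrary: j q)
  case 0
  \<comment> \<open>No indeterminate is left here, so \<open>q\<close> is a constant, and a nonzero
    constant would put 1 into a prime.\<close>
  then have "q \<in> polys {}" by simp
  then have "q = Const (ev (\<lambda>_. 0) q)"
    by (induction rule: polys_induct) (auto simp: ev_hom Const_arith)
  then obtain c where q: "q = Const c" ..
  show ?case
  proof (rule ccontr)
    assume "q \<noteq> 0"
    then have "c \<noteq> 0" using q by auto
    have "Const (inverse c) * Const c \<in> P j"
      using prime[of j] 0 q by (intro poly_idealD(5)[of V]) (auto simp: poly_prime_def)
    then have "1 \<in> P j" using \<open>c \<noteq> 0\<close> by (simp flip: Const_arith)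
    then show False using prime[of j] 0 by (simp add: poly_prime_def)
  qed
next
  case (Suc d)
  then have j: "j < k" and d: "d = k - Suc j" by auto
  let ?z = "Suc j"
  have set: "{j<..k} - {?z} = {?z<..k}" by auto
  have xV: "x i \<in> polys V" if "i \<in> {j<..k}" for i
    using that x[of "i - 1"] prime[of i] by (cases i) (auto simp: poly_prime_def dest: poly_idealD)
  show ?case
  proof (rule ccontr)
    assume "q \<noteq> 0"
    then obtain m q0 q1 where q: "q0 \<in> polys {?z<..k}" "q1 \<in> polys {j<..k}" "q0 \<noteq> 0"
      "q = Var ?z ^ m * (q0 + Var ?z * q1)"
      using polys_lowest_term[of q "{j<..k}" ?z] Suc.prems j unfolding set by auto
    define r where "r = poly_subst x q0 + x ?z * poly_subst x q1"
    have q0V: "poly_subst x q0 \<in> polys V" using q(1) xV by (rule poly_subst_closed) auto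
    have q1V: "poly_subst x q1 \<in> polys V" using q(2) xV by (rule poly_subst_closed)
    have xz: "x ?z \<in> polys V" using xV[of ?z] j by auto
    have "x ?z ^ m * r \<in> P j" using Suc.prems(3) q(4) by (simp add: r_def poly_subst_hom)
    then have "r \<in> P j"
      using prime[of j] x[of j] j q0V q1V xz
      by (intro poly_prime_powerD[of V "P j" "x ?z" r m]) (auto simp: r_def)
    then have "r \<in> P ?z" using sub j by auto
    moreover have id: "poly_ideal V (P ?z)" using prime[of ?z] j by (simp add: poly_prime_def)
    moreover have "x ?z * poly_subst x q1 \<in> P ?z"
      using x[of j] j q1V by (intro poly_idealD(6)[OF id]) auto
    ultimately have "r - x ?z * poly_subst x q1 \<in> P ?z" by (blast intro: poly_ideal_diff)
    then have "poly_subst x q0 \<in> P ?z" by (simp add: r_def)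
    then have "q0 = 0" using Suc.hyps(1)[OF d, of q0] q(1) j by auto
    then show False using q(3) by simp
  qed
qed

section \<open>Counting power products: algebraically independent families and chains of
  primes\<close>

definition exponent_box :: "nat set \<Rightarrow> nat \<Rightarrow> (nat \<Rightarrow>\<^sub>0 nat) set" where
  "exponent_box V N = {t. Poly_Mapping.keys t \<subseteq> V \<and> (\<forall>i. Poly_Mapping.lookup t i < N)}"

lemma card_exponent_box:
  assumes "finite V" "N > 0"
  shows "finite (exponent_box V N)" "card (exponent_box V N) = N ^ card V"
proof -
  let ?f = "\<lambda>t. restrict (Poly_Mapping.lookup t) V"
  have bij: "bij_betw ?f (exponent_box V N) (V \<rightarrow>\<^sub>E {..<N})"
  proof (rule bij_betwI')
    fix s t assume st: "s \<in> exponent_box V N" "t \<in> exponent_box V N"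
    show "(?f s = ?f t) = (s = t)"
    proof
      assume e: "?f s = ?f t"
      show "s = t"
      proof (rule poly_mapping_eqI)
        fix i show "Poly_Mapping.lookup s i = Poly_Mapping.lookup t i"
        proof (cases "i \<in> V")
          case True then show ?thesis using fun_cong[OF e, of i] by simp
        next
          case False
          then have "i \<notin> Poly_Mapping.keys s" "i \<notin> Poly_Mapping.keys t" using st by (auto simp: exponent_box_def)
          then show ?thesis by (simp add: in_keys_iff)
        qed
      qed
    qed simp
  next
    fix t assume "t \<in> exponent_box V N"
    then show "?f t \<in> V \<rightarrow>\<^sub>E {..<N}" by (auto simp: exponent_box_def)
  next
    fix g assume g: "g \<in> V \<rightarrow>\<^sub>E {..<N}"
    let ?t = "Abs_poly_mapping (\<lambda>i. if i \<in> V then g i else 0)"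
    have l: "Poly_Mapping.lookup ?t = (\<lambda>i. if i \<in> V then g i else 0)"
      by (rule lookup_Abs_poly_mapping) (rule finite_subset[OF _ assms(1)], auto)
    have "?t \<in> exponent_box V N" using g assms
      by (auto simp: exponent_box_def l in_keys_iff split: if_splits)
    moreover have "g = ?f ?t" using g by (auto simp: l fun_eq_iff PiE_def extensional_def)
    ultimately show "\<exists>t\<in>exponent_box V N. g = ?f t" by blast
  qed
  show "finite (exponent_box V N)"
    using bij_betw_finite[OF bij] assms by (simp add: finite_PiE)
  show "card (exponent_box V N) = N ^ card V"
    using bij_betw_same_card[OF bij] assms by (simp add: card_PiE)
qed

text \<open>Bounds each exponent separately rather than the total degree, because this is the
  condition for lying in an \<open>exponent_box\<close>.\<close>

definition deg_le :: "nat \<Rightarrow> 'k::field mpoly \<Rightarrow> bool" where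
  "deg_le D p \<longleftrightarrow> (\<forall>t\<in>Poly_Mapping.keys p. \<forall>i. Poly_Mapping.lookup t i \<le> D)"

lemma deg_le_mult: "deg_le D p \<Longrightarrow> deg_le E q \<Longrightarrow> deg_le (D + E) (p * q)"
  unfolding deg_le_def using keys_mult[of p q] by (fastforce simp: lookup_add intro: add_mono)

lemma deg_le_1: "deg_le 0 1"
  by (simp add: deg_le_def)

lemma deg_le_power: "deg_le D p \<Longrightarrow> deg_le (n * D) (p ^ n)"
  by (induction n) (simp_all add: deg_le_1 deg_le_mult)

lemma deg_le_mono: "deg_le D p \<Longrightarrow> D \<le> E \<Longrightarrow> deg_le E p"
  unfolding deg_le_def by (meson le_trans)

lemma deg_le_prod: "(\<And>i. i \<in> A \<Longrightarrow> deg_le D (f i)) \<Longrightarrow> deg_le (card A * D) (prod f A)"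
  by (induction A rule: infinite_finite_induct) (simp_all add: deg_le_1 deg_le_mult)

lemma deg_le_exists: "\<exists>D. deg_le D p"
proof -
  let ?A = "(\<lambda>(t, i). Poly_Mapping.lookup t i) ` (SIGMA t:Poly_Mapping.keys p. Poly_Mapping.keys t)"
  have "finite ?A" by simp
  then obtain D where D: "\<forall>d\<in>?A. d \<le> D" by (meson finite_nat_set_iff_bounded_le)
  have "Poly_Mapping.lookup t i \<le> D" if "t \<in> Poly_Mapping.keys p" for t i
    using D that by (cases "i \<in> Poly_Mapping.keys t") (force simp: in_keys_iff)+
  then show ?thesis unfolding deg_le_def by blast
qed

interpretation mpoly_vs: vector_space "\<lambda>(c::'k::field) p. Const c * p :: 'k mpoly"
  by unfold_locales (simp_all add: algebra_simps Const_arith)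

text \<open>The \<open>N\<^bsup>|U|\<^esup>\<close> power products with exponents below \<open>N\<close> are linearly independent polynomials of
  degree \<open>O(N)\<close> in \<open>|V|\<close> indeterminates; there is no room for them for large \<open>N\<close> if \<open>|U| > |V|\<close>.\<close>

lemma algebraically_independent_card_le:
  fixes x :: "nat \<Rightarrow> 'k::field mpoly"
  assumes fin: "finite U" "finite V" and x: "\<And>i. i \<in> U \<Longrightarrow> x i \<in> polys V"
    and indep: "\<And>q. q \<in> polys U \<Longrightarrow> poly_subst x q = 0 \<Longrightarrow> q = 0"
  shows "card U \<le> card V"
proof (rule ccontr)
  assume less: "\<not> card U \<le> card V"
  have "\<forall>i. \<exists>D. deg_le D (x i)" using deg_le_exists by blast
  then obtain Df where Df: "\<And>i. deg_le (Df i) (x i)" by metis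
  define D where "D = (\<Sum>i\<in>U. Df i)"
  have D: "deg_le D (x i)" if "i \<in> U" for i
    using Df[of i] that fin unfolding D_def by (intro deg_le_mono[OF Df] member_le_sum) auto
  \<comment> \<open>Exponents in \<open>power_prod x e\<close> are at most
    \<open>card U * (N * D)\<close>, hence below \<open>M\<close>, and \<open>M\<close> is at most
    \<open>N * C\<close>. The choice of \<open>N\<close> makes \<open>C ^ card V\<close> smaller
    than \<open>N\<close>, so the box for \<open>V\<close> has fewer than
    \<open>N ^ (card V + 1)\<close> elements.\<close>
  define C where "C = card U * D + 1"
  define N where "N = C ^ card V + 1"
  define M where "M = card U * (N * D) + 1"
  let ?E = "exponent_box U N" and ?B = "power_prod Var ` exponent_box V M :: 'k mpoly set"
  have N: "N > 0" by (simp add: N_def)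
  have M: "M > 0" by (simp add: M_def)
  have inj: "inj_on (power_prod x) ?E"
  proof (rule inj_onI)
    fix s t assume st: "s \<in> ?E" "t \<in> ?E" "power_prod x s = power_prod x t"
    let ?q = "Poly_Mapping.single s 1 - Poly_Mapping.single t (1::'k)"
    have "?q \<in> polys U" using st by (intro polys_diff) (auto simp: exponent_box_def)
    moreover have "poly_subst x ?q = 0" using st by (simp add: poly_subst_hom poly_subst_single)
    ultimately have "?q = 0" by (rule indep)
    then show "s = t" by (metis eq_iff_diff_eq_0 lookup_single_eq lookup_single_not_eq zero_neq_one)
  qed
  have "mpoly_vs.independent (power_prod x ` ?E)"
  proof (rule mpoly_vs.independent_if_scalars_zero)
    show "finite (power_prod x ` ?E)" using card_exponent_box[OF fin(1) N] by simp
    fix u v assume 0: "(\<Sum>y\<in>power_prod x ` ?E. Const (u y) * y) = 0" and "v \<in> power_prod x ` ?E"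
    then obtain e where e: "e \<in> ?E" "v = power_prod x e" by auto
    let ?q = "\<Sum>t\<in>?E. Poly_Mapping.single t (u (power_prod x t))"
    have "?q \<in> polys U" by (rule polys_sum) (auto simp: exponent_box_def)
    moreover have "poly_subst x ?q = 0"
      using 0 by (simp add: poly_subst_hom poly_subst_single sum.reindex[OF inj])
    ultimately have "?q = 0" by (rule indep)
    moreover have "Poly_Mapping.lookup ?q e = u (power_prod x e)"
      using e(1) card_exponent_box[OF fin(1) N] by (simp add: lookup_sum lookup_single when_def)
    ultimately show "u v = 0" using e by simp
  qed
  moreover have "power_prod x ` ?E \<subseteq> mpoly_vs.span ?B"
  proof clarify
    fix e assume e: "e \<in> ?E"
    have ek: "Poly_Mapping.keys e \<subseteq> U" using e by (simp add: exponent_box_def)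
    have "deg_le (card (Poly_Mapping.keys e) * (N * D)) (power_prod x e)"
      unfolding power_prod_def
    proof (rule deg_le_prod)
      fix i assume "i \<in> Poly_Mapping.keys e"
      then have "deg_le (Poly_Mapping.lookup e i * D) (x i ^ Poly_Mapping.lookup e i)"
        using ek by (intro deg_le_power D) auto
      then show "deg_le (N * D) (x i ^ Poly_Mapping.lookup e i)"
        by (rule deg_le_mono) (use e in \<open>auto simp: exponent_box_def intro!: less_imp_le\<close>)
    qed
    moreover have "card (Poly_Mapping.keys e) \<le> card U" using ek fin by (intro card_mono)
    ultimately have "deg_le (card U * (N * D)) (power_prod x e)"
      by (elim deg_le_mono) auto
    moreover have "power_prod x e \<in> polys V"
      unfolding power_prod_def using ek x by (intro polys_prod polys_power) auto
    ultimately have keys: "Poly_Mapping.keys (power_prod x e) \<subseteq> exponent_box V M"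
      by (auto simp: deg_le_def polys_iff exponent_box_def M_def less_Suc_eq_le)
    have "(\<Sum>t\<in>Poly_Mapping.keys (power_prod x e). Const (Poly_Mapping.lookup (power_prod x e) t) * power_prod Var t) \<in> mpoly_vs.span ?B"
      using keys by (intro mpoly_vs.span_sum mpoly_vs.span_scale mpoly_vs.span_base) auto
    then show "power_prod x e \<in> mpoly_vs.span ?B"
      using mpoly_sum_singles[of "power_prod x e"] by (simp add: single_eq_Const_power_prod[symmetric])
  qed
  ultimately have "card (power_prod x ` ?E) \<le> card ?B"
    using card_exponent_box[OF fin(2) M] by (intro conjunct2[OF mpoly_vs.independent_span_bound]) auto
  also have "\<dots> \<le> M ^ card V" using card_exponent_box[OF fin(2) M] by (metis card_image_le)
  also have "\<dots> \<le> (N * C) ^ card V"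
    by (rule power_mono) (auto simp: M_def C_def N_def algebra_simps)
  also have "\<dots> = N ^ card V * C ^ card V" by (simp add: power_mult_distrib)
  also have "\<dots> < N ^ card V * N" using N by (simp add: N_def)
  also have "\<dots> = N ^ (card V + 1)" by simp
  also have "\<dots> \<le> N ^ card U" using less N by (intro power_increasing) auto
  also have "\<dots> = card (power_prod x ` ?E)"
    using card_exponent_box[OF fin(1) N] by (simp add: card_image[OF inj])
  finally show False by simp
qed

text \<open>One element taken from each gap of the chain gives \<open>k\<close> algebraically
  independent polynomials, and there are at most \<open>card V\<close> of these.\<close>

lemma prime_chain_length_le:
  fixes P :: "nat \<Rightarrow> 'k::field mpoly set"
  assumes "finite V" and prime: "\<And>i. i \<le> k \<Longrightarrow> poly_prime V (P i)"
    and sub: "\<And>i. i < k \<Longrightarrow> P i \<subset> P (Suc i)"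
  shows "k \<le> card V"
proof -
  have "\<exists>y. y \<in> P (Suc i) - P i" if "i < k" for i using sub[OF that] by auto
  then obtain y where y: "\<And>i. i < k \<Longrightarrow> y i \<in> P (Suc i) - P i" by metis
  \<comment> \<open>The shift makes \<open>x i\<close> lie in \<open>P i\<close> but not in
    \<open>P (i - 1)\<close>, as \<open>prime_chain_independent\<close> expects; only indices from 1
    to \<open>k\<close> are used.\<close>
  define x where "x = (\<lambda>i. y (i - 1))"
  have x: "x (Suc i) \<in> P (Suc i) - P i" if "i < k" for i using y[OF that] by (simp add: x_def)
  have id: "poly_ideal V (P i)" if "i \<le> k" for i using prime[OF that] by (simp add: poly_prime_def)
  have "card {0<..k} \<le> card V"
  proof (rule algebraically_independent_card_le[of _ _ x])
    fix i assume "i \<in> {0<..k}"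
    then show "x i \<in> polys V" using x[of "i - 1"] id[of i] by (cases i) (auto dest: poly_idealD)
  next
    fix q assume "q \<in> polys {0<..k}" "poly_subst x q = 0"
    then show "q = 0"
      using prime_chain_independent[of k V P x 0 q] prime sub x poly_idealD(3)[OF id[of 0]] by auto
  qed (use assms in auto)
  then show ?thesis by simp
qed

section \<open>Homogeneous ideals and their linear parts along a fiber\<close>

lemma wdeg_add: "wdeg W (s + t) = wdeg W s + wdeg W t"
proof -
  have *: "wdeg W u = (\<Sum>i\<in>A. W i * int (Poly_Mapping.lookup u i))"
    if "Poly_Mapping.keys u \<subseteq> A" "finite A" for u A
    unfolding wdeg_def using that by (intro sum.mono_neutral_left) (auto simp: in_keys_iff)
  let ?A = "Poly_Mapping.keys s \<union> Poly_Mapping.keys t"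
  show ?thesis
    by (simp add: *[of _ ?A] keys_add_nat lookup_add sum.distrib distrib_left)
qed

lemma wdeg_single [simp]: "wdeg W (Poly_Mapping.single j n) = W j * int n"
  by (cases "n = 0") (simp_all add: wdeg_def)

lemma keys_split:
  assumes "j \<in> Poly_Mapping.keys (t :: 'a \<Rightarrow>\<^sub>0 nat)"
  obtains u where "t = Poly_Mapping.single j 1 + u"
proof
  show "t = Poly_Mapping.single j 1 + (t - Poly_Mapping.single j 1)"
    using assms by (intro poly_mapping_eqI) (auto simp: lookup_add lookup_minus lookup_single when_def in_keys_iff)
qed

lemma single_add_eq_mult_Var:
  "Poly_Mapping.single (Poly_Mapping.single j 1 + u) c = Var j * Poly_Mapping.single u c"
  by (simp add: Var_def mult_single)

lemma sum_hom_comp: "p = (\<Sum>d\<in>wdeg W ` Poly_Mapping.keys p. hom_comp W d p)"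
proof -
  have "(\<Sum>d\<in>wdeg W ` Poly_Mapping.keys p. hom_comp W d p)
      = (\<Sum>t\<in>Poly_Mapping.keys p. Poly_Mapping.single t (Poly_Mapping.lookup p t))"
    unfolding hom_comp_def by (rule sum.group) auto
  then show ?thesis using mpoly_sum_singles[of p] by simp
qed

text \<open>The point (c, 0) is called \<open>b\<close>. Its last coordinates vanish, so it is the
  origin of the fiber over c.\<close>

locale graded_fiber =
  fixes m n :: nat and W :: "nat \<Rightarrow> int" and b :: "nat \<Rightarrow> 'k::field" and I :: "'k mpoly set"
  assumes m_le_n: "m \<le> n"
    and W0: "\<And>i. i < m \<Longrightarrow> W i = 0"
    and Wpos: "\<And>j. j \<in> {m..<n} \<Longrightarrow> W j > 0"
    and hom: "homogeneous_ideal {..<n} W I"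
    and deg0: "I \<inter> polys {..<m} = {0}"
    and b0: "\<And>j. j \<ge> m \<Longrightarrow> b j = 0"
begin

definition X_deg :: "int \<Rightarrow> nat set" where
  "X_deg d = {j \<in> {m..<n}. W j = d}"

text \<open>Remainders in degree \<open>d\<close>. The restriction to indeterminates of smaller
  degree makes the later system triangular; the vanishing at \<open>b\<close> to second order makes
  the remainders invisible in linear parts.\<close>

definition higher :: "int \<Rightarrow> 'k mpoly set" where
  "higher d = {r \<in> polys ({..<m} \<union> {j \<in> {m..<n}. W j < d}). ev b r = 0 \<and> (\<forall>k. dcoef b k r = 0)}"

lemma finite_X_deg [simp]: "finite (X_deg d)"
  by (simp add: X_deg_def)

lemma b_X_deg [simp]: "j \<in> X_deg d \<Longrightarrow> b j = 0"
  by (simp add: X_deg_def b0)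

lemma ideal_I: "poly_ideal {..<n} I"
  using hom by (simp add: homogeneous_ideal_def ideal_poly_alg_iff)

lemma I_subset: "p \<in> I \<Longrightarrow> p \<in> polys {..<n}"
  using poly_idealD(2)[OF ideal_I] .

lemma hom_comp_I: "p \<in> I \<Longrightarrow> hom_comp W d p \<in> I"
  using hom by (simp add: homogeneous_ideal_def)

lemma higher_0 [simp]: "0 \<in> higher d"
  by (simp add: higher_def)

lemma higher_add: "r \<in> higher d \<Longrightarrow> s \<in> higher d \<Longrightarrow> r + s \<in> higher d"
  by (auto simp: higher_def ev_hom dcoef_hom)

lemma higher_mult: "g \<in> polys {..<m} \<Longrightarrow> r \<in> higher d \<Longrightarrow> g * r \<in> higher d"
  by (auto simp: higher_def ev_hom dcoef_hom intro!: polys_mult elim: polys_mono)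

lemma higher_diff: "r \<in> higher d \<Longrightarrow> s \<in> higher d \<Longrightarrow> r - s \<in> higher d"
  by (auto simp: higher_def ev_hom dcoef_hom)

lemma higher_sum: "(\<And>x. x \<in> A \<Longrightarrow> f x \<in> higher d) \<Longrightarrow> sum f A \<in> higher d"
  by (induction A rule: infinite_finite_induct) (auto intro: higher_add)

lemma wdeg_nonneg: "Poly_Mapping.keys t \<subseteq> {..<n} \<Longrightarrow> wdeg W t \<ge> 0"
  unfolding wdeg_def
proof (rule sum_nonneg)
  fix i assume "Poly_Mapping.keys t \<subseteq> {..<n}" "i \<in> Poly_Mapping.keys t"
  then show "W i * int (Poly_Mapping.lookup t i) \<ge> 0"
    using W0[of i] Wpos[of i] by (cases "i < m") auto
qed

lemma wdeg_0_iff: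
  assumes "Poly_Mapping.keys t \<subseteq> {..<n}"
  shows "wdeg W t = 0 \<longleftrightarrow> Poly_Mapping.keys t \<subseteq> {..<m}"
proof
  assume "wdeg W t = 0"
  show "Poly_Mapping.keys t \<subseteq> {..<m}"
  proof
    fix j assume j: "j \<in> Poly_Mapping.keys t"
    then obtain u where u: "t = Poly_Mapping.single j 1 + u" by (rule keys_split)
    then have "wdeg W u \<ge> 0" using assms by (intro wdeg_nonneg) (auto simp: keys_add_nat)
    then have "W j \<le> 0" using \<open>wdeg W t = 0\<close> u by (simp add: wdeg_add)
    then show "j \<in> {..<m}" using Wpos[of j] j assms by force
  qed
next
  assume "Poly_Mapping.keys t \<subseteq> {..<m}"
  then show "wdeg W t = 0" unfolding wdeg_def by (intro sum.neutral) (auto simp: W0)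
qed

text \<open>Such a monomial contains some x_j. If x_j has the full degree \<open>d\<close>, the
  cofactor has degree 0 and lies in K[a]. Otherwise a second x divides the cofactor, so the monomial
  vanishes to second order at \<open>b\<close>.\<close>

lemma monomial_form:
  assumes t: "Poly_Mapping.keys t \<subseteq> {..<n}" and d: "wdeg W t = d" "d > 0"
  shows "\<exists>g r. (\<forall>j. g j \<in> polys {..<m}) \<and> r \<in> higher d \<and>
    Poly_Mapping.single t c = (\<Sum>j\<in>X_deg d. g j * Var j) + r"
proof -
  have pos: "\<exists>j u. s = Poly_Mapping.single j 1 + u \<and> j \<in> {m..<n} \<and> Poly_Mapping.keys u \<subseteq> {..<n}"
    if s: "wdeg W s > 0" "Poly_Mapping.keys s \<subseteq> {..<n}" for s
  proof -
    obtain j where j: "j \<in> Poly_Mapping.keys s" "j \<notin> {..<m}" using s wdeg_0_iff[OF s(2)] by auto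
    obtain u where "s = Poly_Mapping.single j 1 + u" using keys_split j(1) .
    with j s show ?thesis by (intro exI[of _ j] exI[of _ u]) (auto simp: keys_add_nat)
  qed
  obtain j u where u: "t = Poly_Mapping.single j 1 + u" "j \<in> {m..<n}" "Poly_Mapping.keys u \<subseteq> {..<n}"
    using pos[of t] d t by auto
  have wu: "wdeg W u \<ge> 0" "W j + wdeg W u = d"
    using u d wdeg_nonneg by (auto simp: wdeg_add)
  show ?thesis
  proof (cases "W j = d")
    case True
    then have "Poly_Mapping.keys u \<subseteq> {..<m}" using wu wdeg_0_iff[OF u(3)] by simp
    moreover have "j \<in> X_deg d" using True u by (simp add: X_deg_def)
    ultimately show ?thesis
      by (intro exI[of _ "\<lambda>i. if i = j then Poly_Mapping.single u c else 0"] exI[of _ 0])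
        (auto simp: u(1) single_add_eq_mult_Var[unfolded One_nat_def] mult.commute[of _ "Var j"]
            if_distrib[of "\<lambda>x. x * _"] sum.delta cong: if_cong)
  next
    case False
    then have "W j < d" "wdeg W u > 0" using wu Wpos[OF u(2)] wdeg_0_iff[OF u(3)] by auto
    then obtain j' u' where u': "u = Poly_Mapping.single j' 1 + u'" "j' \<in> {m..<n}" "Poly_Mapping.keys u' \<subseteq> {..<n}"
      using pos[of u] u by auto
    \<comment> \<open>If some x_k in \<open>t\<close> had the full degree \<open>d\<close>, its
      cofactor would contain only the a_i, and then x_j would have to be x_k, although its degree is
      smaller.\<close>
    have "k \<in> {..<m} \<union> {j \<in> {m..<n}. W j < d}" if k: "k \<in> Poly_Mapping.keys t" for k
    proof (cases "k < m")
      case False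
      then have kX: "k \<in> {m..<n}" using k t by auto
      obtain s where s: "t = Poly_Mapping.single k 1 + s" using keys_split k .
      have s': "Poly_Mapping.keys s \<subseteq> {..<n}" using t s by (auto simp: keys_add_nat)
      have "W k + wdeg W s = d" using s d by (simp add: wdeg_add)
      moreover have "W k \<noteq> d"
      proof
        assume "W k = d"
        then have "Poly_Mapping.keys s \<subseteq> {..<m}" using \<open>W k + wdeg W s = d\<close> wdeg_0_iff[OF s'] by simp
        moreover have "j \<in> Poly_Mapping.keys t" using u by (simp add: keys_add_nat)
        ultimately have "j = k" using s u by (auto simp: keys_add_nat split: if_splits)
        then show False using \<open>W k = d\<close> \<open>W j < d\<close> by simp
      qed
      ultimately show ?thesis using wdeg_nonneg[OF s'] kX by auto
    qed simp
    then have "Poly_Mapping.single t c \<in> polys ({..<m} \<union> {j \<in> {m..<n}. W j < d})" by auto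
    moreover have e: "Poly_Mapping.single t c = Var j * (Var j' * Poly_Mapping.single u' c)"
      unfolding u(1) u'(1) single_add_eq_mult_Var ..
    have "ev b (Poly_Mapping.single t c) = 0" "\<forall>k. dcoef b k (Poly_Mapping.single t c) = 0"
      unfolding e using u u' by (simp_all add: ev_hom dcoef_hom b0)
    ultimately have "Poly_Mapping.single t c \<in> higher d" unfolding higher_def by (intro CollectI conjI)
    then show ?thesis
      by (intro exI[of _ "\<lambda>_. 0"] exI[of _ "Poly_Mapping.single t c"]) auto
  qed
qed

lemma hom_comp_form:
  assumes "p \<in> polys {..<n}" "d > 0"
  shows "\<exists>g r. (\<forall>j. g j \<in> polys {..<m}) \<and> r \<in> higher d \<and>
    hom_comp W d p = (\<Sum>j\<in>X_deg d. g j * Var j) + r"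
proof -
  have "\<exists>g r. (\<forall>j. g j \<in> polys {..<m}) \<and> r \<in> higher d \<and>
      (\<Sum>t\<in>A. Poly_Mapping.single t (Poly_Mapping.lookup p t)) = (\<Sum>j\<in>X_deg d. g j * Var j) + r"
    if "finite A" "A \<subseteq> {t \<in> Poly_Mapping.keys p. wdeg W t = d}" for A
    using that
  proof (induction rule: finite_induct)
    case empty
    show ?case by (intro exI[of _ "\<lambda>_. 0"] exI[of _ 0]) auto
  next
    case (insert t A)
    then obtain g r where 1: "\<forall>j. g j \<in> polys {..<m}" "r \<in> higher d"
      "(\<Sum>t\<in>A. Poly_Mapping.single t (Poly_Mapping.lookup p t)) = (\<Sum>j\<in>X_deg d. g j * Var j) + r" by auto
    have "Poly_Mapping.keys t \<subseteq> {..<n}" using insert assms by (auto simp: polys_iff)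
    then obtain g' r' where 2: "\<forall>j. g' j \<in> polys {..<m}" "r' \<in> higher d"
      "Poly_Mapping.single t (Poly_Mapping.lookup p t) = (\<Sum>j\<in>X_deg d. g' j * Var j) + r'"
      using monomial_form[of t d "Poly_Mapping.lookup p t"] insert assms by auto
    show ?case using 1 2 insert
      by (intro exI[of _ "\<lambda>j. g j + g' j"] exI[of _ "r + r'"])
        (auto simp: distrib_right sum.distrib add_ac intro!: higher_add)
  qed
  then show ?thesis unfolding hom_comp_def by simp
qed

text \<open>The component of degree 0 lies in I \<inter> P_0 and therefore vanishes; this is the
  point where that hypothesis enters.\<close>

lemma I_sum_hom_comp:
  assumes "p \<in> I"
  shows "p = (\<Sum>d\<in>wdeg W ` Poly_Mapping.keys p - {0}. hom_comp W d p)"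
    "d \<in> wdeg W ` Poly_Mapping.keys p - {0} \<Longrightarrow> d > 0"
proof -
  have "hom_comp W 0 p \<in> polys {..<m}"
    unfolding hom_comp_def using I_subset[OF assms] by (intro polys_sum) (auto simp: polys_iff wdeg_0_iff)
  then have "hom_comp W 0 p = 0" using deg0 hom_comp_I[OF assms, of 0] by blast
  then have "(\<Sum>d\<in>wdeg W ` Poly_Mapping.keys p - {0}. hom_comp W d p) = (\<Sum>d\<in>wdeg W ` Poly_Mapping.keys p. hom_comp W d p)"
    by (intro sum.mono_neutral_left) auto
  then show "p = (\<Sum>d\<in>wdeg W ` Poly_Mapping.keys p - {0}. hom_comp W d p)"
    using sum_hom_comp[of p W] by simp
  assume "d \<in> wdeg W ` Poly_Mapping.keys p - {0}"
  then show "d > 0" using wdeg_nonneg I_subset[OF assms] by (force simp: polys_iff)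
qed

text \<open>At \<open>b\<close> all x_j vanish, so only the values g_j(c) survive. The subset
  \<open>A\<close> is there for elements from which the columns in \<open>T\<close> have been
  eliminated.\<close>

lemma form_ev:
  assumes "\<forall>j. g j \<in> polys {..<m}" "r \<in> higher d" "A \<subseteq> X_deg d"
  shows "ev b ((\<Sum>j\<in>A. g j * Var j) + r) = 0"
    "dcoef b k ((\<Sum>j\<in>A. g j * Var j) + r) = (if k \<in> A then ev b (g k) else 0)"
proof -
  have A: "finite A" using assms(3) by (rule finite_subset) simp
  have bA: "b j = 0" if "j \<in> A" for j using that assms(3) b_X_deg by blast
  show "ev b ((\<Sum>j\<in>A. g j * Var j) + r) = 0" using assms bA
    by (auto simp: ev_hom higher_def intro!: sum.neutral)
  have "(\<Sum>j\<in>A. dcoef b k (g j * Var j)) = (\<Sum>j\<in>A. if j = k then ev b (g k) else 0)"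
    by (rule sum.cong) (auto simp: dcoef_hom bA)
  then show "dcoef b k ((\<Sum>j\<in>A. g j * Var j) + r) = (if k \<in> A then ev b (g k) else 0)"
    using assms A by (simp add: dcoef_hom(1,5) higher_def sum.delta)
qed

text \<open>Places the ideal inside the maximal ideal of the point, so that P/I has a local ring
  there.\<close>

lemma I_ev:
  assumes "p \<in> I" shows "ev b p = 0"
proof -
  have "ev b (hom_comp W d p) = 0" if "d > 0" for d
    using hom_comp_form[OF I_subset[OF assms] that] form_ev(1)[of _ _ d "X_deg d"] by auto
  then have "ev b (\<Sum>d\<in>wdeg W ` Poly_Mapping.keys p - {0}. hom_comp W d p) = 0"
    using I_sum_hom_comp(2)[OF assms] by (simp add: ev_sum)
  then show ?thesis using I_sum_hom_comp(1)[OF assms] by simp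
qed

text \<open>A system in reduced echelon form, with common pivot \<open>h\<close>.\<close>

definition row :: "nat set \<Rightarrow> 'k mpoly \<Rightarrow> nat \<Rightarrow> 'k mpoly \<Rightarrow> bool" where
  "row T h t f \<longleftrightarrow> f \<in> I \<and> (\<exists>g r. (\<forall>j. g j \<in> polys {..<m}) \<and> r \<in> higher (W t) \<and>
     f = h * Var t + (\<Sum>j\<in>X_deg (W t) - T. g j * Var j) + r)"

definition echelon :: "nat set \<Rightarrow> 'k mpoly \<Rightarrow> (nat \<Rightarrow> 'k mpoly) \<Rightarrow> bool" where
  "echelon T h f \<longleftrightarrow> T \<subseteq> {m..<n} \<and> h \<in> polys {..<m} \<and> ev b h \<noteq> 0 \<and> (\<forall>t\<in>T. row T h t (f t))"

text \<open>The empty system exists and the number of rows is bounded. Taking a largest system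
  replaces running the elimination until it stops.\<close>

lemma echelon_maximal:
  obtains T h f where "echelon T h f" "\<And>T' h' f'. echelon T' h' f' \<Longrightarrow> card T' \<le> card T"
proof -
  have e: "\<exists>h f. echelon {} h f" by (intro exI[of _ 1] exI) (auto simp: echelon_def)
  have "card T \<le> n" if "echelon T h f" for T h f
    using that card_mono[of "{m..<n}" T] by (auto simp: echelon_def)
  then have "\<exists>T. (\<exists>h f. echelon T h f) \<and> (\<forall>T'. (\<exists>h f. echelon T' h f) \<longrightarrow> card T' \<le> card T)"
    by (intro ex_has_greatest_nat[where k = "{}" and b = "Suc n"]) (use e in \<open>auto simp: less_Suc_eq_le\<close>)
  then obtain T h f where "echelon T h f" and "\<forall>T'. (\<exists>h f. echelon T' h f) \<longrightarrow> card T' \<le> card T"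
    by (elim exE conjE)
  then show ?thesis by (intro that[of T h f]) auto
qed

lemma I_mult: "p \<in> polys {..<m} \<Longrightarrow> q \<in> I \<Longrightarrow> p * q \<in> I"
  using poly_idealD(5)[OF ideal_I, of p q] polys_mono[of p "{..<m}" "{..<n}"] m_le_n by auto

text \<open>Subtracting rows from \<open>h * p\<close> clears the columns in \<open>T\<close>. Any
  remaining coefficient that does not vanish at c could serve as one more pivot, contrary to
  maximality; hence the linear part of the remainder is 0.\<close>

lemma echelon_reduce:
  assumes ech: "echelon T h f" and max: "\<And>T' h' f'. echelon T' h' f' \<Longrightarrow> card T' \<le> card T"
    and p: "p \<in> I" "d > 0" "p = (\<Sum>j\<in>X_deg d. G j * Var j) + R" "\<forall>j. G j \<in> polys {..<m}" "R \<in> higher d"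
  shows "dcoef b k (h * p - (\<Sum>t\<in>T \<inter> X_deg d. G t * f t)) = 0"
proof -
  have T: "T \<subseteq> {m..<n}" "finite T" and h: "h \<in> polys {..<m}" "ev b h \<noteq> 0" and row: "\<And>t. t \<in> T \<Longrightarrow> row T h t (f t)"
    using ech finite_subset[of T "{m..<n}"] by (auto simp: echelon_def)
  obtain g r where gr: "\<And>t j. t \<in> T \<Longrightarrow> g t j \<in> polys {..<m}" "\<And>t. t \<in> T \<Longrightarrow> r t \<in> higher (W t)"
    "\<And>t. t \<in> T \<Longrightarrow> f t = h * Var t + (\<Sum>j\<in>X_deg (W t) - T. g t j * Var j) + r t"
  proof -
    have "\<exists>gr. (\<forall>j. fst gr j \<in> polys {..<m}) \<and> snd gr \<in> higher (W t) \<and>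
        f t = h * Var t + (\<Sum>j\<in>X_deg (W t) - T. fst gr j * Var j) + snd gr" if "t \<in> T" for t
      using row[OF that] unfolding row_def by auto
    then have "\<forall>t\<in>T. \<exists>gr. (\<forall>j. fst gr j \<in> polys {..<m}) \<and> snd gr \<in> higher (W t) \<and>
        f t = h * Var t + (\<Sum>j\<in>X_deg (W t) - T. fst gr j * Var j) + snd gr" by blast
    from bchoice[OF this] obtain gr where "\<forall>t\<in>T. (\<forall>j. fst (gr t) j \<in> polys {..<m}) \<and> snd (gr t) \<in> higher (W t) \<and>
        f t = h * Var t + (\<Sum>j\<in>X_deg (W t) - T. fst (gr t) j * Var j) + snd (gr t)" by (elim exE)
    then show ?thesis by (intro that[of "\<lambda>t. fst (gr t)" "\<lambda>t. snd (gr t)"]) auto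
  qed
  have fI: "f t \<in> I" if "t \<in> T" for t using row[OF that] by (simp add: row_def)
  define A where "A = T \<inter> X_deg d"
  have A: "t \<in> T" "W t = d" if "t \<in> A" for t using that by (auto simp: A_def X_deg_def)
  define p' where "p' = h * p - (\<Sum>t\<in>A. G t * f t)"
  define G' where "G' j = h * G j - (\<Sum>t\<in>A. if t \<in> T then G t * g t j else 0)" for j
  define R' where "R' = h * R - (\<Sum>t\<in>A. G t * r t)"
  have G': "G' j \<in> polys {..<m}" for j
    unfolding G'_def using h p gr A by (intro polys_diff polys_mult polys_sum) auto
  have rA: "r t \<in> higher d" if "t \<in> A" for t using gr(2)[of t] A[OF that] by simp
  have R': "R' \<in> higher d"
    unfolding R'_def using h p rA by (intro higher_diff higher_mult higher_sum) auto
  have p'I: "p' \<in> I"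
    unfolding p'_def using h p fI A by (intro poly_ideal_diff[OF ideal_I] I_mult poly_ideal_sum[OF ideal_I]) auto
  \<comment> \<open>The columns in \<open>T\<close> cancel because all rows share the pivot
    \<open>h\<close> and no row has an entry in another column of \<open>T\<close> of its
    degree.\<close>
  have p'_eq: "p' = (\<Sum>j\<in>X_deg d - T. G' j * Var j) + R'"
  proof -
    have X: "X_deg d = (X_deg d - T) \<union> A" "(X_deg d - T) \<inter> A = {}" by (auto simp: A_def)
    have "(\<Sum>j\<in>X_deg d. G j * Var j) = (\<Sum>j\<in>X_deg d - T. G j * Var j) + (\<Sum>t\<in>A. G t * Var t)"
      by (subst X(1), rule sum.union_disjoint) (auto simp: A_def)
    then have 1: "h * p = (\<Sum>j\<in>X_deg d - T. h * G j * Var j) + (\<Sum>t\<in>A. h * G t * Var t) + h * R"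
      by (simp add: p(3) distrib_left sum_distrib_left mult.assoc)
    have "(\<Sum>t\<in>A. G t * f t) = (\<Sum>t\<in>A. h * G t * Var t + (\<Sum>j\<in>X_deg d - T. G t * g t j * Var j) + G t * r t)"
      using A by (intro sum.cong) (auto simp: gr(3) distrib_left sum_distrib_left mult_ac)
    also have "\<dots> = (\<Sum>t\<in>A. h * G t * Var t) + (\<Sum>j\<in>X_deg d - T. \<Sum>t\<in>A. G t * g t j * Var j) + (\<Sum>t\<in>A. G t * r t)"
      by (simp add: sum.distrib) (rule sum.swap)
    finally have 2: "(\<Sum>t\<in>A. G t * f t) = \<dots>" .
    have "(\<Sum>j\<in>X_deg d - T. G' j * Var j) = (\<Sum>j\<in>X_deg d - T. h * G j * Var j) - (\<Sum>j\<in>X_deg d - T. \<Sum>t\<in>A. G t * g t j * Var j)"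
      unfolding G'_def sum_subtractf[symmetric]
      by (rule sum.cong) (auto simp: left_diff_distrib sum_distrib_right A intro!: sum.cong)
    then show ?thesis unfolding p'_def R'_def 1 2 by simp
  qed
  have "ev b (G' j0) = 0" if j0: "j0 \<in> X_deg d - T" for j0
  proof (rule ccontr)
    assume ne: "ev b (G' j0) \<noteq> 0"
    \<comment> \<open>The new row is \<open>p'\<close>, scaled by \<open>h\<close> to reach the new
      common pivot \<open>h * G' j0\<close>. An old row of degree \<open>d\<close> is scaled by
      \<open>G' j0\<close> and its entry in column \<open>j0\<close> is cleared with
      \<open>p'\<close>; rows of other degrees have no such column and are only scaled.\<close>
    define T' where "T' = insert j0 T"
    define h' where "h' = h * G' j0"
    define f' where "f' t = (if t = j0 then h * p' else if W t = d then G' j0 * f t - g t j0 * p' else G' j0 * f t)" for t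
    have split: "(\<Sum>j\<in>X_deg d - T. q j * Var j) = q j0 * Var j0 + (\<Sum>j\<in>X_deg d - T'. q j * Var j)" for q
    proof -
      have "X_deg d - T - {j0} = X_deg d - T'" by (auto simp: T'_def)
      then show ?thesis using sum.remove[of "X_deg d - T" j0 "\<lambda>j. q j * Var j"] j0 by simp
    qed
    have "row T' h' t (f' t)" if t: "t \<in> T'" for t
    proof -
      consider "t = j0" | "t \<noteq> j0" "t \<in> T" "W t = d" | "t \<noteq> j0" "t \<in> T" "W t \<noteq> d"
        using t by (auto simp: T'_def)
      then show ?thesis
      proof cases
        case 1
        have "f' t = h' * Var t + (\<Sum>j\<in>X_deg (W t) - T'. (h * G' j) * Var j) + h * R'"
          using 1 j0 unfolding f'_def h'_def p'_eq split
          by (simp add: X_deg_def algebra_simps sum_distrib_left)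
        moreover have "W t = d" using 1 j0 by (simp add: X_deg_def)
        moreover have "f' t \<in> I" using 1 h p'I by (auto simp: f'_def intro!: I_mult)
        moreover have "\<forall>j. h * G' j \<in> polys {..<m}" "h * R' \<in> higher d"
          using h G' R' by (auto intro!: polys_mult higher_mult)
        ultimately show ?thesis unfolding row_def \<open>W t = d\<close>
          by (intro conjI exI[of _ "\<lambda>j. h * G' j"] exI[of _ "h * R'"])
      next
        case 2
        define q where "q j = G' j0 * g t j - g t j0 * G' j" for j
        have q: "q j \<in> polys {..<m}" for j unfolding q_def using G' gr 2 by (intro polys_diff polys_mult)
        have "f' t = h' * Var t + (\<Sum>j\<in>X_deg d - T. q j * Var j) + (G' j0 * r t - g t j0 * R')"
          using 2 unfolding f'_def h'_def p'_eq q_def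
          by (simp add: gr(3) algebra_simps sum_distrib_left sum_subtractf)
        then have "f' t = h' * Var t + (\<Sum>j\<in>X_deg (W t) - T'. q j * Var j) + (G' j0 * r t - g t j0 * R')"
          unfolding split using 2 by (simp add: q_def)
        moreover have "f' t \<in> I" using 2 G' gr fI p'I
          by (auto simp: f'_def intro!: I_mult poly_ideal_diff[OF ideal_I])
        moreover have "G' j0 * r t - g t j0 * R' \<in> higher (W t)"
          using 2 G' gr R' by (intro higher_diff higher_mult) auto
        ultimately show ?thesis unfolding row_def using q by blast
      next
        case 3
        have "X_deg (W t) - T' = X_deg (W t) - T" using 3 j0 by (auto simp: T'_def X_deg_def)
        then have "f' t = h' * Var t + (\<Sum>j\<in>X_deg (W t) - T'. (G' j0 * g t j) * Var j) + G' j0 * r t"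
          using 3 by (simp add: f'_def h'_def gr(3) algebra_simps sum_distrib_left)
        moreover have "f' t \<in> I" using 3 G' fI by (auto simp: f'_def intro!: I_mult)
        ultimately show ?thesis unfolding row_def using G' gr 3
          by (intro conjI exI[of _ "\<lambda>j. G' j0 * g t j"] exI[of _ "G' j0 * r t"])
            (auto intro!: polys_mult higher_mult)
      qed
    qed
    moreover have "T' \<subseteq> {m..<n}" using T j0 by (auto simp: T'_def X_deg_def)
    ultimately have "echelon T' h' f'" using ne h G' by (auto simp: echelon_def h'_def ev_hom intro!: polys_mult)
    from max[OF this] show False using j0 T by (simp add: T'_def)
  qed
  then have "dcoef b k p' = 0"
    unfolding p'_eq using G' R' form_ev(2)[of G' R' d "X_deg d - T" k] by auto
  then show ?thesis by (simp add: p'_def A_def)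
qed

text \<open>What the later arguments use of a row: the triangular shape drives the elimination of
  \<open>Var t\<close>, and the diagonal first order coefficients make the linear parts of the rows
  independent.\<close>

lemma echelon_row:
  assumes "echelon T h f" "t \<in> T"
  shows "f t \<in> I" "\<exists>\<psi>\<in>polys ({..<m} \<union> ({m..<n} - T) \<union> {j \<in> {m..<n}. W j < W t}). f t = h * Var t + \<psi>"
    "t' \<in> T \<Longrightarrow> dcoef b t' (f t) = (if t' = t then ev b h else 0)"
proof -
  from assms have T: "T \<subseteq> {m..<n}" and h: "h \<in> polys {..<m}" and row: "row T h t (f t)"
    by (auto simp: echelon_def)
  show "f t \<in> I" using row by (simp add: row_def)
  obtain g r where g: "\<forall>j. g j \<in> polys {..<m}" and r: "r \<in> higher (W t)"
    and f: "f t = h * Var t + (\<Sum>j\<in>X_deg (W t) - T. g j * Var j) + r"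
    using row by (auto simp: row_def)
  show "\<exists>\<psi>\<in>polys ({..<m} \<union> ({m..<n} - T) \<union> {j \<in> {m..<n}. W j < W t}). f t = h * Var t + \<psi>"
  proof (intro bexI)
    show "f t = h * Var t + ((\<Sum>j\<in>X_deg (W t) - T. g j * Var j) + r)" using f by (simp add: add.assoc)
    show "(\<Sum>j\<in>X_deg (W t) - T. g j * Var j) + r \<in> polys ({..<m} \<union> ({m..<n} - T) \<union> {j \<in> {m..<n}. W j < W t})"
    proof (intro polys_add polys_sum polys_mult)
      fix j assume "j \<in> X_deg (W t) - T"
      then show "Var j \<in> polys ({..<m} \<union> ({m..<n} - T) \<union> {j \<in> {m..<n}. W j < W t})"
        by (auto simp: X_deg_def)
      show "g j \<in> polys ({..<m} \<union> ({m..<n} - T) \<union> {j \<in> {m..<n}. W j < W t})"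
        using g by (auto intro: polys_mono)
    next
      show "r \<in> polys ({..<m} \<union> ({m..<n} - T) \<union> {j \<in> {m..<n}. W j < W t})"
        using r by (auto simp: higher_def intro: polys_mono)
    qed
  qed
  assume t': "t' \<in> T"
  have bt: "b t = 0" using T assms(2) b0 by auto
  have "dcoef b t' ((\<Sum>j\<in>X_deg (W t) - T. g j * Var j) + r) = 0"
    using form_ev(2)[OF g r, of "X_deg (W t) - T" t'] t' by auto
  then show "dcoef b t' (f t) = (if t' = t then ev b h else 0)"
    unfolding f add.assoc dcoef_add[of b t' "h * Var t"] using bt by (simp add: dcoef_mult)
qed

text \<open>Says that the linear parts of the rows span Lin(I). In each degree
  \<open>echelon_reduce\<close> applies, and the value of the coefficient \<open>G t\<close> at the
  point is the \<open>t\<close>-th first order coefficient of the component.\<close>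

lemma echelon_spans:
  assumes ech: "echelon T h f" and max: "\<And>T' h' f'. echelon T' h' f' \<Longrightarrow> card T' \<le> card T"
    and p: "p \<in> I"
  shows "ev b h * dcoef b k p = (\<Sum>t\<in>T. dcoef b t p * dcoef b k (f t))"
proof -
  have T: "T \<subseteq> {m..<n}" "finite T"
    using ech finite_subset[of T "{m..<n}"] by (auto simp: echelon_def)
  have *: "ev b h * dcoef b k (hom_comp W d p) = (\<Sum>t\<in>T. dcoef b t (hom_comp W d p) * dcoef b k (f t))"
    if d: "d > 0" for d
  proof -
    let ?p = "hom_comp W d p"
    have pI: "?p \<in> I" by (rule hom_comp_I[OF p])
    obtain G R where G: "\<forall>j. G j \<in> polys {..<m}" and R: "R \<in> higher d"
      and e: "?p = (\<Sum>j\<in>X_deg d. G j * Var j) + R"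
      using hom_comp_form[OF I_subset[OF p] d] by auto
    have dt: "dcoef b t ?p = (if t \<in> X_deg d then ev b (G t) else 0)" for t
      unfolding e using form_ev(2)[OF G R subset_refl] by simp
    have "0 = dcoef b k (h * ?p - (\<Sum>t\<in>T \<inter> X_deg d. G t * f t))"
      by (rule echelon_reduce[OF ech max pI d e G R, symmetric])
    also have "\<dots> = ev b h * dcoef b k ?p - (\<Sum>t\<in>T \<inter> X_deg d. ev b (G t) * dcoef b k (f t))"
    proof -
      \<comment> \<open>As the rows and \<open>p\<close> vanish at \<open>b\<close>, the product
        rule keeps only the terms in which the other factor is evaluated.\<close>
      have "ev b (f t) = 0" if "t \<in> T" for t using I_ev echelon_row(1)[OF ech that] by simp
      then have "(\<Sum>t\<in>T \<inter> X_deg d. dcoef b k (G t * f t)) = (\<Sum>t\<in>T \<inter> X_deg d. ev b (G t) * dcoef b k (f t))"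
        by (intro sum.cong) (auto simp: dcoef_hom)
      then show ?thesis using I_ev[OF pI] by (simp add: dcoef_hom)
    qed
    also have "(\<Sum>t\<in>T \<inter> X_deg d. ev b (G t) * dcoef b k (f t)) = (\<Sum>t\<in>T. dcoef b t ?p * dcoef b k (f t))"
      using T by (auto simp: dt intro!: sum.mono_neutral_cong_left split: if_splits)
    finally show ?thesis by simp
  qed
  let ?D = "wdeg W ` Poly_Mapping.keys p - {0}"
  have e: "dcoef b j p = (\<Sum>d\<in>?D. dcoef b j (hom_comp W d p))" for j
    using arg_cong[OF I_sum_hom_comp(1)[OF p], of "dcoef b j"] by (simp add: dcoef_sum)
  have "ev b h * dcoef b k p = (\<Sum>d\<in>?D. \<Sum>t\<in>T. dcoef b t (hom_comp W d p) * dcoef b k (f t))"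
    unfolding e[of k] sum_distrib_left using I_sum_hom_comp(2)[OF p] by (intro sum.cong) (auto simp: *)
  also have "\<dots> = (\<Sum>t\<in>T. \<Sum>d\<in>?D. dcoef b t (hom_comp W d p) * dcoef b k (f t))" by (rule sum.swap)
  also have "\<dots> = (\<Sum>t\<in>T. dcoef b t p * dcoef b k (f t))"
    by (simp add: e[of t for t] sum_distrib_right)
  finally show ?thesis .
qed

end

section \<open>Quotients, dimensions and Noetherian rings\<close>

lemma (in ideal) rcos_eq_iff:
  "x \<in> carrier R \<Longrightarrow> y \<in> carrier R \<Longrightarrow> I +> x = I +> y \<longleftrightarrow> x \<ominus> y \<in> I"
  using quotient_eq_iff_same_a_r_cos[OF ideal_axioms] by simp

lemma (in ideal) rcos_eq_self_iff:
  assumes "x \<in> carrier R" shows "I +> x = I \<longleftrightarrow> x \<in> I"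
proof -
  have "I +> \<zero> = I" using a_coset_add_zero a_subset by simp
  moreover have "x \<ominus> \<zero> = x" using assms by algebra
  ultimately show ?thesis using rcos_eq_iff[OF assms zero_closed] by simp
qed

lemma (in ideal) in_rcosE:
  assumes "z \<in> I +> x" "x \<in> carrier R"
  obtains i where "i \<in> I" "z = i \<oplus> x" "z \<in> carrier R" "I +> z = I +> x"
proof -
  from assms(1) obtain i where i: "i \<in> I" "z = i \<oplus> x" by (auto simp: a_r_coset_def')
  have ic: "i \<in> carrier R" using i Icarr by simp
  have "z \<ominus> x = i" unfolding i(2) using ic assms(2) by algebra
  then have "I +> z = I +> x" using rcos_eq_iff[of z x] i ic assms(2) by simp
  then show ?thesis using that i ic assms(2) by blast
qed

text \<open>Operations on classes are defined as unions over all representatives; independence of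
  the representative collapses the union.\<close>

lemma UN_const:
  assumes "A \<noteq> {}" "\<And>x. x \<in> A \<Longrightarrow> f x = c" shows "(\<Union>x\<in>A. f x) = c"
  using assms by auto

text \<open>The ring laws are transported along a surjection that respects the operations, before
  the target is known to be a ring.\<close>

lemma cringI_image:
  assumes R: "cring R" and carr: "carrier S = \<pi> ` carrier R"
    and ops: "\<one>\<^bsub>S\<^esub> = \<pi> \<one>\<^bsub>R\<^esub>" "\<zero>\<^bsub>S\<^esub> = \<pi> \<zero>\<^bsub>R\<^esub>"
      "\<And>x y. x \<in> carrier R \<Longrightarrow> y \<in> carrier R \<Longrightarrow> \<pi> x \<otimes>\<^bsub>S\<^esub> \<pi> y = \<pi> (x \<otimes>\<^bsub>R\<^esub> y)"
      "\<And>x y. x \<in> carrier R \<Longrightarrow> y \<in> carrier R \<Longrightarrow> \<pi> x \<oplus>\<^bsub>S\<^esub> \<pi> y = \<pi> (x \<oplus>\<^bsub>R\<^esub> y)"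
  shows "cring S"
proof -
  interpret R: cring R by (rule R)
  show ?thesis
  proof (intro cringI abelian_groupI comm_monoidI)
    fix x assume "x \<in> carrier S"
    then obtain r where r: "r \<in> carrier R" "x = \<pi> r" using carr by auto
    then show "\<exists>y\<in>carrier S. y \<oplus>\<^bsub>S\<^esub> x = \<zero>\<^bsub>S\<^esub>"
      by (intro bexI[of _ "\<pi> (\<ominus>\<^bsub>R\<^esub> r)"]) (auto simp: ops carr R.l_neg)
  qed (auto simp: carr ops R.a_ac R.m_ac R.l_distr R.r_distr)
qed

subsection \<open>Dimension of a vector space with coordinate functions\<close>

text \<open>The \<open>v k\<close> form a basis: duality gives independence, and a vector minus the
  combination built from its coordinates has all coordinates 0. The map \<open>\<kappa>\<close>
  names the scalars, since \<open>K\<close> may be a residue field consisting of cosets.\<close>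

lemma dim_by_coordinates:
  fixes D :: "'v \<Rightarrow> nat \<Rightarrow> 'k::field"
  assumes V: "vectorspace K V" and Y: "finite Y"
    and \<kappa>: "carrier K = range \<kappa>" "\<kappa> 0 = \<zero>\<^bsub>K\<^esub>"
    and add: "\<And>x y k. x \<in> carrier V \<Longrightarrow> y \<in> carrier V \<Longrightarrow> D (x \<oplus>\<^bsub>V\<^esub> y) k = D x k + D y k"
    and smult: "\<And>c x k. x \<in> carrier V \<Longrightarrow> D (\<kappa> c \<odot>\<^bsub>V\<^esub> x) k = c * D x k"
    and v: "\<And>k. k \<in> Y \<Longrightarrow> v k \<in> carrier V"
    and dual: "\<And>j k. j \<in> Y \<Longrightarrow> k \<in> Y \<Longrightarrow> D (v j) k = (if j = k then 1 else 0)"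
    and ker: "\<And>x. x \<in> carrier V \<Longrightarrow> (\<And>k. k \<in> Y \<Longrightarrow> D x k = 0) \<Longrightarrow> x = \<zero>\<^bsub>V\<^esub>"
  shows "vectorspace.dim K V = card Y"
proof -
  interpret vectorspace K V by (rule V)
  have D0: "D \<zero>\<^bsub>V\<^esub> k = 0" for k
  proof -
    have "D \<zero>\<^bsub>V\<^esub> k = D \<zero>\<^bsub>V\<^esub> k + D \<zero>\<^bsub>V\<^esub> k" using add[of "\<zero>\<^bsub>V\<^esub>" "\<zero>\<^bsub>V\<^esub>" k] by (metis M.zero_closed M.l_zero)
    then show ?thesis by (simp only: add_cancel_right_right)
  qed
  have D_fin: "D (\<Oplus>\<^bsub>V\<^esub>x\<in>A. f x) k = (\<Sum>x\<in>A. D (f x) k)"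
    if "finite A" "f \<in> A \<rightarrow> carrier V" for A k and f :: "'v \<Rightarrow> 'v"
    using that
    by (induction rule: finite_induct) (auto simp: D0 add M.finsum_closed)
  have inj: "inj_on v Y"
  proof (rule inj_onI)
    fix j k assume "j \<in> Y" "k \<in> Y" "v j = v k"
    then show "j = k" using dual[of j k] dual[of k k] by (auto split: if_splits)
  qed
  have vY: "v ` Y \<subseteq> carrier V" "finite (v ` Y)" using v Y by auto
  have D_lincomb: "D (lincomb a (v ` Y)) k = c k"
    if "\<And>j. j \<in> Y \<Longrightarrow> a (v j) = \<kappa> (c j)" "k \<in> Y" for a c k
  proof -
    have "a \<in> v ` Y \<rightarrow> carrier K" using that \<kappa> by auto
    then have "D (lincomb a (v ` Y)) k = (\<Sum>x\<in>v ` Y. D (a x \<odot>\<^bsub>V\<^esub> x) k)"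
      unfolding lincomb_def using vY by (intro D_fin) auto
    also have "\<dots> = (\<Sum>j\<in>Y. D (a (v j) \<odot>\<^bsub>V\<^esub> v j) k)" by (simp add: sum.reindex[OF inj])
    also have "\<dots> = (\<Sum>j\<in>Y. if j = k then c k else 0)"
      using that v by (intro sum.cong) (auto simp: smult dual)
    finally show ?thesis using that Y by simp
  qed
  have "basis (v ` Y)"
    unfolding basis_def
  proof (intro conjI)
    show "lin_indpt (v ` Y)"
    proof (rule finite_lin_indpt2[OF vY(2) vY(1)])
      fix a assume a: "a \<in> v ` Y \<rightarrow> carrier K" "lincomb a (v ` Y) = \<zero>\<^bsub>V\<^esub>"
      then have "\<forall>j\<in>Y. \<exists>c. a (v j) = \<kappa> c" using \<kappa> by auto
      then obtain c where c: "\<And>j. j \<in> Y \<Longrightarrow> a (v j) = \<kappa> (c j)" by metis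
      then show "\<forall>w\<in>v ` Y. a w = \<zero>\<^bsub>K\<^esub>"
        using D_lincomb[of a c] a(2) D0 \<kappa>(2) by auto
    qed
    show "span (v ` Y) = carrier V"
    proof
      show "carrier V \<subseteq> span (v ` Y)"
      proof
        fix x assume x: "x \<in> carrier V"
        \<comment> \<open>The coefficient of a basis vector is the coordinate of \<open>x\<close> at
          the index of that vector.\<close>
        define a where "a w = \<kappa> (D x (the_inv_into Y v w))" for w
        have a: "a \<in> v ` Y \<rightarrow> carrier K" using \<kappa> by (auto simp: a_def)
        define y where "y = lincomb a (v ` Y)"
        have y: "y \<in> carrier V" unfolding y_def using vY a by auto
        have Dy: "D y k = D x k" if "k \<in> Y" for k
          unfolding y_def using that by (intro D_lincomb) (simp_all add: a_def the_inv_into_f_f[OF inj])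
        have neg: "D (\<ominus>\<^bsub>V\<^esub> y) k = - D y k" for k
          using add[of "\<ominus>\<^bsub>V\<^esub> y" y k] y D0[of k] by (simp add: M.l_neg eq_neg_iff_add_eq_0)
        have "x \<oplus>\<^bsub>V\<^esub> \<ominus>\<^bsub>V\<^esub> y = \<zero>\<^bsub>V\<^esub>"
          using x y by (intro ker) (auto simp: add neg Dy)
        then have "x = y" using x y by (metis M.minus_equality M.minus_minus M.a_comm M.a_inv_closed)
        then show "x \<in> span (v ` Y)"
          unfolding y_def span_def using a vY by blast
      qed
    qed (use span_is_subset2[OF vY(1)] in auto)
  qed (use vY in auto)
  then have "dim = card (v ` Y)" using vY by (intro dim_basis) auto
  then show ?thesis by (simp add: card_image[OF inj])
qed

lemma carrier_quot: "carrier (R Quot I) = (\<lambda>x. I +>\<^bsub>R\<^esub> x) ` carrier R"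
  by (auto simp: FactRing_def A_RCOSETS_def')

text \<open>The scalars are named by a set \<open>C\<close> of ring elements through \<open>sc\<close>, so that the lemma applies
  both to the residue field \<open>R/N\<close> and to a coefficient field contained in \<open>R\<close>.\<close>

lemma dim_square_quotient:
  fixes D :: "'a \<Rightarrow> nat \<Rightarrow> 'k::field" and V :: "('s, 'a set, 'z) module_scheme"
  assumes R: "cring R" and N: "ideal N R" and K: "field K" and Y: "finite Y"
    and carr: "carrier V = (\<lambda>x. (N \<cdot>\<^bsub>R\<^esub> N) +>\<^bsub>R\<^esub> x) ` N"
    and ops: "add V = set_add R" "zero V = N \<cdot>\<^bsub>R\<^esub> N"
    and sc: "\<one>\<^bsub>K\<^esub> = sc \<one>\<^bsub>R\<^esub>"
      "\<And>r s. r \<in> C \<Longrightarrow> s \<in> C \<Longrightarrow> sc r \<otimes>\<^bsub>K\<^esub> sc s = sc (r \<otimes>\<^bsub>R\<^esub> s)"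
      "\<And>r s. r \<in> C \<Longrightarrow> s \<in> C \<Longrightarrow> sc r \<oplus>\<^bsub>K\<^esub> sc s = sc (r \<oplus>\<^bsub>R\<^esub> s)"
    and C: "C \<subseteq> carrier R" "sc ` C = carrier K" "\<one>\<^bsub>R\<^esub> \<in> C"
      "\<And>r s. r \<in> C \<Longrightarrow> s \<in> C \<Longrightarrow> r \<otimes>\<^bsub>R\<^esub> s \<in> C" "\<And>r s. r \<in> C \<Longrightarrow> s \<in> C \<Longrightarrow> r \<oplus>\<^bsub>R\<^esub> s \<in> C"
    and smult: "\<And>r x. r \<in> C \<Longrightarrow> x \<in> N \<Longrightarrow>
      sc r \<odot>\<^bsub>V\<^esub> ((N \<cdot>\<^bsub>R\<^esub> N) +>\<^bsub>R\<^esub> x) = (N \<cdot>\<^bsub>R\<^esub> N) +>\<^bsub>R\<^esub> (r \<otimes>\<^bsub>R\<^esub> x)"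
    and \<kappa>: "range \<kappa> \<subseteq> C" "carrier K = range (\<lambda>c. sc (\<kappa> c))" "sc (\<kappa> 0) = \<zero>\<^bsub>K\<^esub>"
    and add: "\<And>x y k. x \<in> N \<Longrightarrow> y \<in> N \<Longrightarrow> D (x \<oplus>\<^bsub>R\<^esub> y) k = D x k + D y k"
    and prod: "\<And>x y k. x \<in> N \<Longrightarrow> y \<in> N \<Longrightarrow> D (x \<otimes>\<^bsub>R\<^esub> y) k = 0"
    and scal: "\<And>c x k. x \<in> N \<Longrightarrow> D (\<kappa> c \<otimes>\<^bsub>R\<^esub> x) k = c * D x k"
    and v: "\<And>k. k \<in> Y \<Longrightarrow> v k \<in> N"
    and dual: "\<And>j k. j \<in> Y \<Longrightarrow> k \<in> Y \<Longrightarrow> D (v j) k = (if j = k then 1 else 0)"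
    and ker: "\<And>x. x \<in> N \<Longrightarrow> (\<And>k. k \<in> Y \<Longrightarrow> D x k = 0) \<Longrightarrow> x \<in> N \<cdot>\<^bsub>R\<^esub> N"
  shows "vectorspace.dim K V = card Y"
proof -
  interpret R: cring R by (rule R)
  interpret N: ideal N R by (rule N)
  let ?S = "N \<cdot>\<^bsub>R\<^esub> N"
  interpret S: ideal ?S R by (rule R.ideal_prod_is_ideal[OF N N])
  have SN: "?S \<subseteq> N" using R.ideal_prod_inter[OF N N] by simp
  define q where "q x = ?S +>\<^bsub>R\<^esub> x" for x
  have q: "carrier V = q ` N" using carr by (simp add: q_def)
  have qadd: "q x \<oplus>\<^bsub>V\<^esub> q y = q (x \<oplus>\<^bsub>R\<^esub> y)" if "x \<in> N" "y \<in> N" for x y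
    using that unfolding q_def ops by (intro S.a_rcos_sum) auto
  have q0: "q x = \<zero>\<^bsub>V\<^esub> \<longleftrightarrow> x \<in> ?S" if "x \<in> N" for x
    using that S.rcos_eq_self_iff by (simp add: q_def ops)
  have N0: "\<zero>\<^bsub>R\<^esub> \<in> N" by (rule additive_subgroup.zero_closed[OF N.is_additive_subgroup])
  have zero: "\<zero>\<^bsub>V\<^esub> = q \<zero>\<^bsub>R\<^esub>" using q0[OF N0] additive_subgroup.zero_closed[OF S.is_additive_subgroup] by simp
  have Nadd: "x \<oplus>\<^bsub>R\<^esub> y \<in> N" if "x \<in> N" "y \<in> N" for x y
    using that by (rule additive_subgroup.a_closed[OF N.is_additive_subgroup])
  have Ninv: "\<ominus>\<^bsub>R\<^esub> x \<in> N" if "x \<in> N" for x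
    using that by (rule additive_subgroup.a_inv_closed[OF N.is_additive_subgroup])
  have qsm: "sc r \<odot>\<^bsub>V\<^esub> q x = q (r \<otimes>\<^bsub>R\<^esub> x)" if "r \<in> C" "x \<in> N" for r x
    using smult that by (simp add: q_def)
  have Nm: "r \<otimes>\<^bsub>R\<^esub> x \<in> N" if "r \<in> C" "x \<in> N" for r x
    using that C(1) by (intro N.I_l_closed) auto
  interpret K: field K by (rule K)
  have V: "vectorspace K V"
  proof (rule vs_criteria[OF K])
    show "\<zero>\<^bsub>V\<^esub> \<in> carrier V" using zero q N0 by auto
    show "\<forall>v w. v \<in> carrier V \<and> w \<in> carrier V \<longrightarrow> v \<oplus>\<^bsub>V\<^esub> w \<in> carrier V"
      unfolding q by (auto simp: qadd Nadd)
    show "\<forall>v\<in>carrier V. \<exists>neg_v\<in>carrier V. v \<oplus>\<^bsub>V\<^esub> neg_v = \<zero>\<^bsub>V\<^esub>"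
      unfolding q zero by (auto simp: qadd Ninv R.r_neg intro!: bexI[of _ "\<ominus>\<^bsub>R\<^esub> _"])
    show "\<forall>c v. c \<in> carrier K \<and> v \<in> carrier V \<longrightarrow> c \<odot>\<^bsub>V\<^esub> v \<in> carrier V"
      unfolding q C(2)[symmetric] by (auto simp: qsm Nm)
    show "\<forall>v w. v \<in> carrier V \<and> w \<in> carrier V \<longrightarrow> v \<oplus>\<^bsub>V\<^esub> w = w \<oplus>\<^bsub>V\<^esub> v"
      unfolding q by (auto simp: qadd R.a_comm)
    show "\<forall>v w x. v \<in> carrier V \<and> w \<in> carrier V \<and> x \<in> carrier V \<longrightarrow> v \<oplus>\<^bsub>V\<^esub> w \<oplus>\<^bsub>V\<^esub> x = v \<oplus>\<^bsub>V\<^esub> (w \<oplus>\<^bsub>V\<^esub> x)"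
      unfolding q by (auto simp: qadd Nadd R.a_assoc)
    show "\<forall>v\<in>carrier V. v \<oplus>\<^bsub>V\<^esub> \<zero>\<^bsub>V\<^esub> = v"
      unfolding q zero by (auto simp: qadd N0)
    show "\<forall>a v w. a \<in> carrier K \<and> v \<in> carrier V \<and> w \<in> carrier V \<longrightarrow> a \<odot>\<^bsub>V\<^esub> (v \<oplus>\<^bsub>V\<^esub> w) = a \<odot>\<^bsub>V\<^esub> v \<oplus>\<^bsub>V\<^esub> a \<odot>\<^bsub>V\<^esub> w"
      unfolding q C(2)[symmetric] using C(1) by (auto simp: qsm qadd Nadd Nm R.r_distr subset_iff)
    show "\<forall>a b v. a \<in> carrier K \<and> b \<in> carrier K \<and> v \<in> carrier V \<longrightarrow> (a \<oplus>\<^bsub>K\<^esub> b) \<odot>\<^bsub>V\<^esub> v = a \<odot>\<^bsub>V\<^esub> v \<oplus>\<^bsub>V\<^esub> b \<odot>\<^bsub>V\<^esub> v"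
      unfolding q C(2)[symmetric] using C(1) by (auto simp: qsm qadd Nadd Nm sc C(1,3-5) R.l_distr subset_iff)
    show "\<forall>a b v. a \<in> carrier K \<and> b \<in> carrier K \<and> v \<in> carrier V \<longrightarrow> (a \<otimes>\<^bsub>K\<^esub> b) \<odot>\<^bsub>V\<^esub> v = a \<odot>\<^bsub>V\<^esub> (b \<odot>\<^bsub>V\<^esub> v)"
      unfolding q C(2)[symmetric] using C(1) by (auto simp: qsm qadd Nadd Nm sc C(1,3-5) R.m_assoc subset_iff)
    show "\<forall>v\<in>carrier V. \<one>\<^bsub>K\<^esub> \<odot>\<^bsub>V\<^esub> v = v"
      unfolding q sc(1) by (auto simp: qsm C(3))
  qed
  have D_S: "D x k = 0" if "x \<in> ?S" for x k
    using that
  proof (induction rule: ideal_prod.induct)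
    case (sum x y) then show ?case using SN by (simp add: add subset_iff)
  qed (rule prod)
  \<comment> \<open>\<open>D\<close> vanishes on products, so it descends to the quotient by the
    square; \<open>E\<close> is the descended map, evaluated on a chosen representative.\<close>
  define E where "E X = D (SOME x. x \<in> N \<and> q x = X)" for X
  have E: "E (q x) k = D x k" if x: "x \<in> N" for x k
  proof -
    define y where "y = (SOME y. y \<in> N \<and> q y = q x)"
    have y: "y \<in> N" "q y = q x" using someI[of "\<lambda>y. y \<in> N \<and> q y = q x" x] x unfolding y_def by auto
    then have s: "y \<ominus>\<^bsub>R\<^esub> x \<in> ?S" using x S.rcos_eq_iff[of y x] by (simp add: q_def)
    have "y = (y \<ominus>\<^bsub>R\<^esub> x) \<oplus>\<^bsub>R\<^esub> x" using x y by (simp add: a_minus_def R.a_assoc R.l_neg)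
    then have "D y k = D x k" using add[of "y \<ominus>\<^bsub>R\<^esub> x" x k] s SN x D_S[OF s] by auto
    then show ?thesis by (simp add: E_def y_def)
  qed
  show ?thesis
  proof (rule dim_by_coordinates[OF V Y, of "\<lambda>c. sc (\<kappa> c)" E "\<lambda>k. q (v k)"])
    fix x y k assume "x \<in> carrier V" "y \<in> carrier V"
    then show "E (x \<oplus>\<^bsub>V\<^esub> y) k = E x k + E y k" unfolding q by (auto simp: qadd E Nadd add)
  next
    fix c x k assume "x \<in> carrier V"
    then show "E (sc (\<kappa> c) \<odot>\<^bsub>V\<^esub> x) k = c * E x k"
      unfolding q using \<kappa>(1) by (auto simp: qsm E Nm scal subset_iff)
  next
    fix x assume "x \<in> carrier V" and "\<And>k. k \<in> Y \<Longrightarrow> E x k = 0"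
    then obtain y where y: "y \<in> N" "x = q y" "\<And>k. k \<in> Y \<Longrightarrow> D y k = 0" unfolding q by (auto simp: E)
    then show "x = \<zero>\<^bsub>V\<^esub>" using ker[of y] q0[of y] by simp
  qed (use \<kappa> v in \<open>auto simp: q E dual\<close>)
qed

text \<open>Data that compute the dimension of N/N^2: functionals on N that kill products, are dual
  to finitely many elements of N, and have no common zeros outside N^2.\<close>

locale coordinates =
  fixes R :: "('a, 'z) ring_scheme" and N :: "'a set" and D :: "'a \<Rightarrow> nat \<Rightarrow> 'k::field"
    and \<kappa> :: "'k \<Rightarrow> 'a" and v :: "nat \<Rightarrow> 'a" and Y :: "nat set"
  assumes R: "cring R" and N: "ideal N R" and one_N: "\<one>\<^bsub>R\<^esub> \<notin> N" and Y: "finite Y"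
    and \<kappa>: "\<And>c. \<kappa> c \<in> carrier R" "\<kappa> 0 = \<zero>\<^bsub>R\<^esub>" "\<kappa> 1 = \<one>\<^bsub>R\<^esub>"
      "\<And>c d. \<kappa> (c + d) = \<kappa> c \<oplus>\<^bsub>R\<^esub> \<kappa> d" "\<And>c d. \<kappa> (c * d) = \<kappa> c \<otimes>\<^bsub>R\<^esub> \<kappa> d"
    and D_add: "\<And>x y k. x \<in> N \<Longrightarrow> y \<in> N \<Longrightarrow> D (x \<oplus>\<^bsub>R\<^esub> y) k = D x k + D y k"
    and D_prod: "\<And>x y k. x \<in> N \<Longrightarrow> y \<in> N \<Longrightarrow> D (x \<otimes>\<^bsub>R\<^esub> y) k = 0"
    and D_scal: "\<And>c x k. x \<in> N \<Longrightarrow> D (\<kappa> c \<otimes>\<^bsub>R\<^esub> x) k = c * D x k"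
    and v: "\<And>k. k \<in> Y \<Longrightarrow> v k \<in> N"
    and dual: "\<And>j k. j \<in> Y \<Longrightarrow> k \<in> Y \<Longrightarrow> D (v j) k = (if j = k then 1 else 0)"
    and ker: "\<And>x. x \<in> N \<Longrightarrow> (\<And>k. k \<in> Y \<Longrightarrow> D x k = 0) \<Longrightarrow> x \<in> N \<cdot>\<^bsub>R\<^esub> N"
begin

text \<open>The condition \<open>gen\<close> identifies the residue field with the image of K, so
  that scalars from R/N act through \<open>\<kappa>\<close>.\<close>

lemma dim_residue_cotangent:
  assumes max: "maximalideal N R" and gen: "\<And>r. r \<in> carrier R \<Longrightarrow> \<exists>c. r \<ominus>\<^bsub>R\<^esub> \<kappa> c \<in> N"
  shows "vectorspace.dim (R Quot N) (residue_cotangent R N) = card Y"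
proof -
  interpret R: cring R by (rule R)
  interpret N: ideal N R by (rule N)
  interpret S: ideal "N \<cdot>\<^bsub>R\<^esub> N" R by (rule R.ideal_prod_is_ideal[OF N N])
  have quot: "N +>\<^bsub>R\<^esub> r \<in> range (\<lambda>c. N +>\<^bsub>R\<^esub> \<kappa> c)" if r: "r \<in> carrier R" for r
    using gen[OF r] N.rcos_eq_iff[OF r \<kappa>(1)] by auto
  show ?thesis
  proof (rule dim_square_quotient[OF R N maximalideal.quotient_is_field[OF max R] Y,
        where sc = "\<lambda>r. N +>\<^bsub>R\<^esub> r" and C = "carrier R" and \<kappa> = \<kappa> and D = D and v = v])
    fix r x assume r: "r \<in> carrier R" and x: "x \<in> N"
    show "(N +>\<^bsub>R\<^esub> r) \<odot>\<^bsub>residue_cotangent R N\<^esub> (N \<cdot>\<^bsub>R\<^esub> N +>\<^bsub>R\<^esub> x) = N \<cdot>\<^bsub>R\<^esub> N +>\<^bsub>R\<^esub> r \<otimes>\<^bsub>R\<^esub> x"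
    proof -
      have "N \<cdot>\<^bsub>R\<^esub> N +>\<^bsub>R\<^esub> (a \<otimes>\<^bsub>R\<^esub> y) = N \<cdot>\<^bsub>R\<^esub> N +>\<^bsub>R\<^esub> (r \<otimes>\<^bsub>R\<^esub> x)"
        if a: "a \<in> N +>\<^bsub>R\<^esub> r" and y: "y \<in> N \<cdot>\<^bsub>R\<^esub> N +>\<^bsub>R\<^esub> x" for a y
      proof -
        obtain i where i: "i \<in> N" "a = i \<oplus>\<^bsub>R\<^esub> r" using N.in_rcosE[OF a r] .
        obtain j where j: "j \<in> N \<cdot>\<^bsub>R\<^esub> N" "y = j \<oplus>\<^bsub>R\<^esub> x" using S.in_rcosE[OF y] x N.Icarr by blast
        have c: "i \<in> carrier R" "j \<in> carrier R" "x \<in> carrier R"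
          using i j x N.Icarr S.Icarr by auto
        have "a \<otimes>\<^bsub>R\<^esub> y \<ominus>\<^bsub>R\<^esub> r \<otimes>\<^bsub>R\<^esub> x = (i \<oplus>\<^bsub>R\<^esub> r) \<otimes>\<^bsub>R\<^esub> j \<oplus>\<^bsub>R\<^esub> i \<otimes>\<^bsub>R\<^esub> x"
          unfolding i(2) j(2) using c r by algebra
        also have "\<dots> \<in> N \<cdot>\<^bsub>R\<^esub> N"
          using c r i j x by (intro ideal_prod.sum S.I_l_closed ideal_prod.prod) auto
        finally show ?thesis using S.rcos_eq_iff[of "a \<otimes>\<^bsub>R\<^esub> y" "r \<otimes>\<^bsub>R\<^esub> x"] c r i j by simp
      qed
      moreover have "N +>\<^bsub>R\<^esub> r \<noteq> {}" "N \<cdot>\<^bsub>R\<^esub> N +>\<^bsub>R\<^esub> x \<noteq> {}"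
        using N.a_rcos_self[OF r] S.a_rcos_self[of x] x N.Icarr by auto
      ultimately have "(\<Union>a\<in>N +>\<^bsub>R\<^esub> r. \<Union>y\<in>N \<cdot>\<^bsub>R\<^esub> N +>\<^bsub>R\<^esub> x. N \<cdot>\<^bsub>R\<^esub> N +>\<^bsub>R\<^esub> (a \<otimes>\<^bsub>R\<^esub> y)) = N \<cdot>\<^bsub>R\<^esub> N +>\<^bsub>R\<^esub> r \<otimes>\<^bsub>R\<^esub> x"
        by (intro UN_const)
      then show ?thesis by (simp add: residue_cotangent_def Let_def rcoset_mult_def)
    qed
  next
    show "carrier (R Quot N) = range (\<lambda>c. N +>\<^bsub>R\<^esub> \<kappa> c)"
      using quot \<kappa>(1) by (auto simp: carrier_quot)
    show "N +>\<^bsub>R\<^esub> \<kappa> 0 = \<zero>\<^bsub>R Quot N\<^esub>"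
      using N.rcos_eq_self_iff[of "\<zero>\<^bsub>R\<^esub>"] additive_subgroup.zero_closed[OF N.is_additive_subgroup]
      by (simp add: \<kappa> FactRing_def)
    fix r s assume "r \<in> carrier R" "s \<in> carrier R"
    then show "(N +>\<^bsub>R\<^esub> r) \<otimes>\<^bsub>R Quot N\<^esub> (N +>\<^bsub>R\<^esub> s) = N +>\<^bsub>R\<^esub> r \<otimes>\<^bsub>R\<^esub> s"
      "(N +>\<^bsub>R\<^esub> r) \<oplus>\<^bsub>R Quot N\<^esub> (N +>\<^bsub>R\<^esub> s) = N +>\<^bsub>R\<^esub> r \<oplus>\<^bsub>R\<^esub> s"
      by (simp_all add: FactRing_def N.rcoset_mult_add N.a_rcos_sum)
  qed (auto simp: residue_cotangent_def Let_def quot_ideal_def FactRing_def \<kappa> D_add D_prod D_scal v dual ker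
        carrier_quot[unfolded FactRing_def, simplified])
qed

end

lemma dim_cotangent:
  fixes A :: "('k::field, 'a, 'z) module_scheme"
  assumes "coordinates A N D \<kappa> v Y" and smult: "\<And>c x. x \<in> carrier A \<Longrightarrow> c \<odot>\<^bsub>A\<^esub> x = \<kappa> c \<otimes>\<^bsub>A\<^esub> x"
  shows "vectorspace.dim class_ring (cotangent A N) = card Y"
proof -
  interpret coordinates A N D \<kappa> v Y by fact
  interpret R: cring A by (rule R)
  interpret N: ideal N A by (rule N)
  interpret S: ideal "N \<cdot>\<^bsub>A\<^esub> N" A by (rule R.ideal_prod_is_ideal[OF N N])
  \<comment> \<open>If two different scalars had the same image, an invertible scalar would go to 0,
    forcing 1 = 0 in the ring and hence 1 into N.\<close>
  have inj: "inj \<kappa>"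
  proof (rule injI)
    fix c d assume e: "\<kappa> c = \<kappa> d"
    show "c = d"
    proof (rule ccontr)
      assume "c \<noteq> d"
      have "\<kappa> (c - d) \<oplus>\<^bsub>A\<^esub> \<kappa> d = \<zero>\<^bsub>A\<^esub> \<oplus>\<^bsub>A\<^esub> \<kappa> d" using e \<kappa>(4)[of "c - d" d] \<kappa>(1) by simp
      then have "\<kappa> (c - d) = \<zero>\<^bsub>A\<^esub>" using \<kappa>(1) R.add.r_cancel by blast
      then have "\<kappa> (inverse (c - d) * (c - d)) = \<zero>\<^bsub>A\<^esub>" using \<kappa>(1) by (simp only: \<kappa>(5) R.r_null)
      then have "\<one>\<^bsub>A\<^esub> = \<zero>\<^bsub>A\<^esub>" using \<open>c \<noteq> d\<close> \<kappa>(3) by simp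
      then show False using one_N additive_subgroup.zero_closed[OF N.is_additive_subgroup] by simp
    qed
  qed
  \<comment> \<open>The ring element \<open>\<kappa> c\<close> names the scalar \<open>c\<close>;
    its inverse map recovers the scalar, as \<open>dim_square_quotient\<close> requires.\<close>
  let ?sc = "inv_into UNIV \<kappa>"
  have sc: "?sc (\<kappa> c) = c" for c using inj by simp
  show ?thesis
  proof (rule dim_square_quotient[OF R N _ Y, where sc = ?sc and C = "range \<kappa>" and \<kappa> = \<kappa> and D = D and v = v])
    show "field (class_ring :: 'k ring)" by (rule class_field.field_axioms)
    fix r x assume "r \<in> range \<kappa>" and x: "x \<in> N"
    then obtain c where c: "r = \<kappa> c" by auto
    have "N \<cdot>\<^bsub>A\<^esub> N +>\<^bsub>A\<^esub> c \<odot>\<^bsub>A\<^esub> y = N \<cdot>\<^bsub>A\<^esub> N +>\<^bsub>A\<^esub> r \<otimes>\<^bsub>A\<^esub> x"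
      if y: "y \<in> N \<cdot>\<^bsub>A\<^esub> N +>\<^bsub>A\<^esub> x" for y
    proof -
      have xc: "x \<in> carrier A" using x by (rule N.Icarr)
      obtain j where j: "j \<in> N \<cdot>\<^bsub>A\<^esub> N" "y = j \<oplus>\<^bsub>A\<^esub> x" "y \<in> carrier A" using S.in_rcosE[OF y xc] .
      have jc: "j \<in> carrier A" "r \<in> carrier A" using S.Icarr j c \<kappa> by auto
      have "c \<odot>\<^bsub>A\<^esub> y = r \<otimes>\<^bsub>A\<^esub> y" using smult j c by simp
      moreover have "r \<otimes>\<^bsub>A\<^esub> y \<ominus>\<^bsub>A\<^esub> r \<otimes>\<^bsub>A\<^esub> x = r \<otimes>\<^bsub>A\<^esub> j"
        unfolding j(2) using jc xc by algebra
      moreover have "r \<otimes>\<^bsub>A\<^esub> j \<in> N \<cdot>\<^bsub>A\<^esub> N" using j jc by (intro S.I_l_closed)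
      ultimately show ?thesis using S.rcos_eq_iff[of "r \<otimes>\<^bsub>A\<^esub> y" "r \<otimes>\<^bsub>A\<^esub> x"] jc xc j(3) by simp
    qed
    moreover have "N \<cdot>\<^bsub>A\<^esub> N +>\<^bsub>A\<^esub> x \<noteq> {}" using S.a_rcos_self[of x] x N.Icarr by auto
    ultimately have "(\<Union>y\<in>N \<cdot>\<^bsub>A\<^esub> N +>\<^bsub>A\<^esub> x. N \<cdot>\<^bsub>A\<^esub> N +>\<^bsub>A\<^esub> c \<odot>\<^bsub>A\<^esub> y) = N \<cdot>\<^bsub>A\<^esub> N +>\<^bsub>A\<^esub> r \<otimes>\<^bsub>A\<^esub> x"
      by (intro UN_const)
    then show "?sc r \<odot>\<^bsub>cotangent A N\<^esub> (N \<cdot>\<^bsub>A\<^esub> N +>\<^bsub>A\<^esub> x) = N \<cdot>\<^bsub>A\<^esub> N +>\<^bsub>A\<^esub> r \<otimes>\<^bsub>A\<^esub> x"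
      by (simp add: cotangent_def quot_alg_def c sc)
  qed (auto simp: cotangent_def quot_alg_def quot_ideal_def FactRing_def sc \<kappa>(1) D_add D_prod D_scal v dual ker
        \<kappa>(3,4,5)[symmetric] image_image intro: range_eqI[of _ _ 1]
        inv_into_f_eq[OF inj UNIV_I])
qed

text \<open>An ideal is pulled back, its finitely many generators are taken there, and these are
  mapped forward.\<close>

lemma noetherian_ring_image:
  assumes "noetherian_ring R" "ring S" "\<phi> \<in> Ring.ring_hom R S" "\<phi> ` carrier R = carrier S"
  shows "noetherian_ring S"
proof -
  interpret R: noetherian_ring R by fact
  interpret S: ring S by fact
  interpret \<phi>: ring_hom_ring R S \<phi> by (intro ring_hom_ringI2 assms(3) R.ring_axioms S.ring_axioms)
  show ?thesis
  proof (rule S.noetherian_ringI)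
    fix J assume J: "ideal J S"
    interpret J: ideal J S by (rule J)
    obtain A where A: "A \<subseteq> carrier R" "finite A" "{r \<in> carrier R. \<phi> r \<in> J} = Idl\<^bsub>R\<^esub> A"
      using R.finetely_gen[OF \<phi>.ideal_vimage[OF J]] by auto
    have AJ: "\<phi> ` A \<subseteq> J" using A(3) R.genideal_self[OF A(1)] by auto
    have AS: "\<phi> ` A \<subseteq> carrier S" using A(1) by auto
    have "J = Idl\<^bsub>S\<^esub> (\<phi> ` A)"
    proof
      show "Idl\<^bsub>S\<^esub> (\<phi> ` A) \<subseteq> J" by (rule S.genideal_minimal[OF J AJ])
      have "Idl\<^bsub>R\<^esub> A \<subseteq> {r \<in> carrier R. \<phi> r \<in> Idl\<^bsub>S\<^esub> (\<phi> ` A)}"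
        using A(1) S.genideal_self[OF AS]
        by (intro R.genideal_minimal \<phi>.ideal_vimage S.genideal_ideal AS) auto
      then have sub: "{r \<in> carrier R. \<phi> r \<in> J} \<subseteq> {r \<in> carrier R. \<phi> r \<in> Idl\<^bsub>S\<^esub> (\<phi> ` A)}"
        unfolding A(3) .
      show "J \<subseteq> Idl\<^bsub>S\<^esub> (\<phi> ` A)"
      proof
        fix y assume y: "y \<in> J"
        then obtain r where r: "r \<in> carrier R" "\<phi> r = y" using J.Icarr[OF y] unfolding assms(4)[symmetric] by auto
        then have "r \<in> {r \<in> carrier R. \<phi> r \<in> J}" using y by simp
        then show "y \<in> Idl\<^bsub>S\<^esub> (\<phi> ` A)" using sub r(2) by blast
      qed
    qed
    then show "\<exists>A\<subseteq>carrier S. finite A \<and> J = Idl\<^bsub>S\<^esub> A" using A(2) AS by blast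
  qed
qed

text \<open>\<open>krull_dim\<close> with the primes replaced by a given family. The families used
  later consist of primes of a polynomial ring.\<close>

definition prime_dim :: "'a set set \<Rightarrow> enat" where
  "prime_dim Q = Sup {enat k | k. \<exists>P. (\<forall>i\<le>k. P i \<in> Q) \<and> (\<forall>i<k. P i \<subset> P (Suc i))}"

text \<open>Strictly monotone maps in both directions carry chains to chains of the same
  length.\<close>

lemma krull_dim_eq_prime_dim:
  assumes f: "\<And>\<pp>. primeideal \<pp> R \<Longrightarrow> f \<pp> \<in> Q"
      "\<And>\<pp> \<qq>. primeideal \<pp> R \<Longrightarrow> primeideal \<qq> R \<Longrightarrow> \<pp> \<subset> \<qq> \<Longrightarrow> f \<pp> \<subset> f \<qq>"
    and g: "\<And>P. P \<in> Q \<Longrightarrow> primeideal (g P) R"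
      "\<And>P P'. P \<in> Q \<Longrightarrow> P' \<in> Q \<Longrightarrow> P \<subset> P' \<Longrightarrow> g P \<subset> g P'"
  shows "krull_dim R = prime_dim Q"
proof -
  have "(\<exists>\<pp>. (\<forall>i\<le>k. primeideal (\<pp> i) R) \<and> (\<forall>i<k. \<pp> i \<subset> \<pp> (Suc i))) \<longleftrightarrow>
      (\<exists>P. (\<forall>i\<le>k. P i \<in> Q) \<and> (\<forall>i<k. P i \<subset> P (Suc i)))" for k :: nat
  proof
    assume "\<exists>\<pp>. (\<forall>i\<le>k. primeideal (\<pp> i) R) \<and> (\<forall>i<k. \<pp> i \<subset> \<pp> (Suc i))"
    then obtain \<pp> where "\<forall>i\<le>k. primeideal (\<pp> i) R" "\<forall>i<k. \<pp> i \<subset> \<pp> (Suc i)" by blast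
    then show "\<exists>P. (\<forall>i\<le>k. P i \<in> Q) \<and> (\<forall>i<k. P i \<subset> P (Suc i))"
      by (intro exI[of _ "\<lambda>i. f (\<pp> i)"]) (simp add: f)
  next
    assume "\<exists>P. (\<forall>i\<le>k. P i \<in> Q) \<and> (\<forall>i<k. P i \<subset> P (Suc i))"
    then obtain P where "\<forall>i\<le>k. P i \<in> Q" "\<forall>i<k. P i \<subset> P (Suc i)" by blast
    then show "\<exists>\<pp>. (\<forall>i\<le>k. primeideal (\<pp> i) R) \<and> (\<forall>i<k. \<pp> i \<subset> \<pp> (Suc i))"
      by (intro exI[of _ "\<lambda>i. g (P i)"]) (simp add: g)
  qed
  then show ?thesis unfolding krull_dim_def prime_dim_def by simp
qed

text \<open>A finite supremum in \<open>enat\<close> of a nonempty set is attained. A member of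
  \<open>Q\<close> provides a chain of length 0, so that the value 0 cannot stem from an empty set
  of lengths.\<close>

lemma prime_dim_eqD:
  assumes "prime_dim Q = enat k" "Q \<noteq> {}"
  obtains P where "\<And>i. i \<le> k \<Longrightarrow> P i \<in> Q" "\<And>i. i < k \<Longrightarrow> P i \<subset> P (Suc i)"
proof -
  let ?A = "{enat k | k. \<exists>P. (\<forall>i\<le>k. P i \<in> Q) \<and> (\<forall>i<k. P i \<subset> P (Suc i))}"
  have A: "prime_dim Q = Sup ?A" unfolding prime_dim_def ..
  obtain q where "q \<in> Q" using assms(2) by auto
  then have "enat 0 \<in> ?A" by (auto intro!: exI[of _ "\<lambda>_. q"])
  then have "?A \<noteq> {}" by blast
  have "enat k \<in> ?A"
  proof (cases "finite ?A")
    case True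
    have "Sup ?A = Max ?A" unfolding Sup_enat_def if_not_P[OF \<open>?A \<noteq> {}\<close>] if_P[OF True] ..
    then have "enat k = Max ?A" using assms(1) A by metis
    then show ?thesis using Max_in[OF True \<open>?A \<noteq> {}\<close>] by metis
  next
    case False
    have "Sup ?A = \<infinity>" unfolding Sup_enat_def if_not_P[OF \<open>?A \<noteq> {}\<close>] if_not_P[OF False] ..
    then have "enat k = \<infinity>" using assms(1) A by metis
    then show ?thesis by simp
  qed
  then show ?thesis using that by blast
qed

lemma prime_dim_eqI:
  assumes "\<And>i. i \<le> k \<Longrightarrow> P i \<in> Q" "\<And>i. i < k \<Longrightarrow> P i \<subset> P (Suc i)"
    and "\<And>l P'. (\<And>i. i \<le> l \<Longrightarrow> P' i \<in> Q) \<Longrightarrow> (\<And>i. i < l \<Longrightarrow> P' i \<subset> P' (Suc i)) \<Longrightarrow> l \<le> k"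
  shows "prime_dim Q = enat k"
  unfolding prime_dim_def
proof (rule antisym)
  show "Sup {enat k | k. \<exists>P. (\<forall>i\<le>k. P i \<in> Q) \<and> (\<forall>i<k. P i \<subset> P (Suc i))} \<le> enat k"
  proof (rule Sup_least)
    fix x assume "x \<in> {enat k | k. \<exists>P. (\<forall>i\<le>k. P i \<in> Q) \<and> (\<forall>i<k. P i \<subset> P (Suc i))}"
    then obtain l P' where l: "x = enat l" "\<forall>i\<le>l. P' i \<in> Q" "\<forall>i<l. P' i \<subset> P' (Suc i)" by blast
    then have "l \<le> k" by (intro assms(3)[of l P']) auto
    then show "x \<le> enat k" using l by simp
  qed
  show "enat k \<le> Sup {enat k | k. \<exists>P. (\<forall>i\<le>k. P i \<in> Q) \<and> (\<forall>i<k. P i \<subset> P (Suc i))}"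
    using assms(1,2) by (intro Sup_upper) blast
qed

section \<open>Coordinate rings and their localizations at a rational point\<close>

lemma poly_ideal_translate:
  assumes "poly_ideal V Z" "\<And>i. i \<in> V \<Longrightarrow> Var i - Const (b i) \<in> Z" "p \<in> polys V"
  shows "p - Const (ev b p) \<in> Z"
  using assms(3)
proof (induction rule: polys_induct)
  case (add p q)
  have e: "p + q - Const (ev b (p + q)) = (p - Const (ev b p)) + (q - Const (ev b q))"
    by (simp add: ev_hom Const_arith)
  show ?case unfolding e by (rule poly_idealD(4)[OF assms(1)]) (use add in auto)
next
  case (mult p q)
  have e: "p * q - Const (ev b (p * q)) = p * (q - Const (ev b q)) + (p - Const (ev b p)) * Const (ev b q)"
    by (simp add: ev_hom Const_arith algebra_simps)
  show ?case unfolding e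
    by (rule poly_idealD(4)[OF assms(1) poly_idealD(5)[OF assms(1)] poly_idealD(6)[OF assms(1)]]) (use mult in auto)
qed (simp_all add: assms(2) poly_idealD(3)[OF assms(1)])

lemma poly_ideal_ev_kernel: "poly_ideal V {p \<in> polys V. ev b p = 0}"
  by (auto simp: poly_ideal_def ev_hom)

text \<open>The generators vanish at \<open>b\<close>, and modulo them every polynomial is congruent
  to its value at \<open>b\<close>.\<close>

lemma point_ideal_eq: "point_ideal V b = {p \<in> polys V. ev b p = 0}"
proof
  interpret cring "poly_alg V :: ('a, 'a mpoly) module" by (rule cring_poly_alg)
  let ?g = "(\<lambda>i. Var i - Const (b i)) ` V"
  have g: "?g \<subseteq> polys V" by (auto intro!: polys_diff)
  show "point_ideal V b \<subseteq> {p \<in> polys V. ev b p = 0}"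
    unfolding point_ideal_def
    by (rule genideal_minimal)
      (use poly_ideal_ev_kernel in \<open>auto simp: ideal_poly_alg_iff ev_hom intro!: polys_diff\<close>)
  have id: "poly_ideal V (point_ideal V b)"
    unfolding point_ideal_def ideal_poly_alg_iff[symmetric] by (rule genideal_ideal[OF g])
  have "Var i - Const (b i) \<in> point_ideal V b" if "i \<in> V" for i
    using genideal_self[OF g] that unfolding point_ideal_def by auto
  then have "p - Const (ev b p) \<in> point_ideal V b" if "p \<in> polys V" for p
    using poly_ideal_translate[OF id _ that] by blast
  then show "{p \<in> polys V. ev b p = 0} \<subseteq> point_ideal V b" by (force simp: Const_arith)
qed

text \<open>A rational point on the zero set of an ideal. The locale is used twice, for P/I at (c,
  0) and for the fiber at its origin.\<close>

locale point_quotient =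
  fixes V :: "nat set" and b :: "nat \<Rightarrow> 'k::field" and J :: "'k mpoly set"
  assumes finite_V: "finite V" and ideal_J: "poly_ideal V J" and ev_J: "\<And>p. p \<in> J \<Longrightarrow> ev b p = 0"
begin

definition "A = quot_alg (poly_alg V) J"
definition "cls p = J +>\<^bsub>poly_alg V\<^esub> p"
definition "M = {p \<in> polys V. ev b p = 0}"
definition "mA = quot_ideal (poly_alg V) (point_ideal V b) J"
definition "den s \<longleftrightarrow> s \<in> polys V \<and> ev b s \<noteq> 0"
definition "L = local_at A mA"
text \<open>Fractions are written with polynomials in both places, which keeps cosets of pairs of
  cosets out of the computations.\<close>

definition "fr p s = loc_frac A (carrier A - mA) (cls p) (cls s)"
definition "mL = {fr p s |p s. p \<in> M \<and> den s}"

sublocale P: cring "poly_alg V :: ('k, 'k mpoly) module" by (rule cring_poly_alg)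
sublocale JI: ideal J "poly_alg V" using ideal_J by (simp add: ideal_poly_alg_iff)

lemma J_sub: "p \<in> J \<Longrightarrow> p \<in> polys V" by (rule poly_idealD(2)[OF ideal_J])

lemma cls_eq_iff: "p \<in> polys V \<Longrightarrow> q \<in> polys V \<Longrightarrow> cls p = cls q \<longleftrightarrow> p - q \<in> J"
  using JI.rcos_eq_iff[of p q] by (simp add: cls_def)

lemma carrier_A: "carrier A = cls ` polys V"
  by (simp add: A_def quot_alg_def carrier_quot cls_def)

lemma cls_0: "cls 0 = J"
  using JI.rcos_eq_self_iff[of 0] poly_idealD(3)[OF ideal_J] by (simp add: cls_def)

lemma A_ops:
  "p \<in> polys V \<Longrightarrow> q \<in> polys V \<Longrightarrow> cls p \<otimes>\<^bsub>A\<^esub> cls q = cls (p * q)"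
  "p \<in> polys V \<Longrightarrow> q \<in> polys V \<Longrightarrow> cls p \<oplus>\<^bsub>A\<^esub> cls q = cls (p + q)"
  "\<one>\<^bsub>A\<^esub> = cls 1" "\<zero>\<^bsub>A\<^esub> = cls 0"
  using JI.rcoset_mult_add[of p q] JI.a_rcos_sum[of p q] cls_0
  by (simp_all add: A_def quot_alg_def FactRing_def) (simp_all add: cls_def)

lemma cring_A: "cring A"
  by (rule cringI_image[OF cring_poly_alg[of V], of _ cls]) (simp_all add: A_ops carrier_A)

sublocale A: cring A by (rule cring_A)

lemma A_minus: "p \<in> polys V \<Longrightarrow> q \<in> polys V \<Longrightarrow> cls p \<ominus>\<^bsub>A\<^esub> cls q = cls (p - q)"
proof -
  assume pq: "p \<in> polys V" "q \<in> polys V"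
  have "\<ominus>\<^bsub>A\<^esub> cls q = cls (- q)"
    using pq by (intro A.minus_equality) (auto simp: A_ops carrier_A polys_uminus)
  then show ?thesis using pq by (simp add: a_minus_def A_ops polys_uminus)
qed

lemma A_smult:
  assumes "p \<in> polys V" shows "c \<odot>\<^bsub>A\<^esub> cls p = cls (Const c * p)"
proof -
  have "J +>\<^bsub>poly_alg V\<^esub> (c \<odot>\<^bsub>poly_alg V\<^esub> x) = cls (Const c * p)" if x: "x \<in> cls p" for x
  proof -
    obtain i where i: "i \<in> J" "x = i + p" "x \<in> polys V"
      using JI.in_rcosE[of x p] x assms by (auto simp: cls_def)
    have "Const c * x - Const c * p = Const c * i" by (simp add: i algebra_simps)
    then have "cls (Const c * x) = cls (Const c * p)"
      using i assms poly_idealD(5)[OF ideal_J] by (subst cls_eq_iff) auto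
    then show ?thesis by (simp add: cls_def)
  qed
  moreover have "cls p \<noteq> {}" using JI.a_rcos_self[of p] assms by (auto simp: cls_def)
  ultimately have "(\<Union>x\<in>cls p. J +>\<^bsub>poly_alg V\<^esub> (c \<odot>\<^bsub>poly_alg V\<^esub> x)) = cls (Const c * p)" by (intro UN_const)
  then show ?thesis by (simp add: A_def quot_alg_def)
qed

lemma mA_eq: "mA = cls ` M"
  by (simp add: mA_def quot_ideal_def cls_def M_def point_ideal_eq)

lemma M_sub: "p \<in> M \<Longrightarrow> p \<in> polys V" by (simp add: M_def)

lemma cls_in_mA: "p \<in> polys V \<Longrightarrow> cls p \<in> mA \<longleftrightarrow> ev b p = 0"
proof
  assume p: "p \<in> polys V" and "cls p \<in> mA"
  then obtain q where q: "q \<in> M" "cls p = cls q" by (auto simp: mA_eq)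
  then have "p - q \<in> J" using p cls_eq_iff by (auto simp: M_def)
  then show "ev b p = 0" using ev_J[of "p - q"] q by (auto simp: ev_hom M_def)
next
  show "cls p \<in> mA" if "p \<in> polys V" "ev b p = 0" using that by (simp add: mA_eq M_def)
qed

lemma den_closed [intro]:
  "den s \<Longrightarrow> den t \<Longrightarrow> den (s * t)" "den 1" "den s \<Longrightarrow> s \<in> polys V"
  by (auto simp: den_def ev_hom)

lemma den_cls: "s \<in> polys V \<Longrightarrow> cls s \<in> carrier A - mA \<longleftrightarrow> den s"
  by (auto simp: den_def cls_in_mA carrier_A)

lemma denominators: "carrier A - mA = cls ` {s. den s}"
  using den_cls by (auto simp: carrier_A den_def)

text \<open>Expresses equality in the localization of the quotient by membership of polynomials in
  \<open>J\<close>; the arithmetic of fractions rests on it.\<close>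

lemma frac_rel_iff:
  assumes "p \<in> polys V" "den s" "p' \<in> polys V" "den s'"
  shows "((cls p, cls s), (cls p', cls s')) \<in> frac_rel A (carrier A - mA) \<longleftrightarrow>
    (\<exists>u. den u \<and> u * (s' * p - s * p') \<in> J)"
proof -
  have "s \<in> polys V" "s' \<in> polys V" using assms by auto
  then have *: "cls u \<otimes>\<^bsub>A\<^esub> (cls s' \<otimes>\<^bsub>A\<^esub> cls p \<ominus>\<^bsub>A\<^esub> cls s \<otimes>\<^bsub>A\<^esub> cls p') = \<zero>\<^bsub>A\<^esub> \<longleftrightarrow>
      u * (s' * p - s * p') \<in> J" if "den u" for u
    using that assms cls_eq_iff[of "u * (s' * p - s * p')" 0]
    by (simp add: A_ops A_minus polys_mult polys_diff den_def)
  show ?thesis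
    unfolding frac_rel_def denominators using assms * by (auto simp: carrier_A den_def)
qed

lemma frac_rel_trans:
  assumes "u * (s' * p - s * p') \<in> J" "v * (s'' * p' - s' * p'') \<in> J" "den u" "den v"
    "den s" "den s'" "den s''"
  shows "\<exists>w. den w \<and> w * (s'' * p - s * p'') \<in> J"
proof (intro exI conjI)
  have "(v * s'') * (u * (s' * p - s * p')) + (u * s) * (v * (s'' * p' - s' * p'')) \<in> J"
    using assms by (intro poly_idealD(4)[OF ideal_J poly_idealD(5)[OF ideal_J] poly_idealD(5)[OF ideal_J]])
      (auto intro!: polys_mult)
  moreover have "(v * s'') * (u * (s' * p - s * p')) + (u * s) * (v * (s'' * p' - s' * p''))
      = (u * v * s') * (s'' * p - s * p'')" by (simp add: algebra_simps)
  ultimately show "(u * v * s') * (s'' * p - s * p'') \<in> J" by simp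
  show "den (u * v * s')" using assms by auto
qed

lemma frac_rel_sym:
  assumes "u * (s' * p - s * p') \<in> J" shows "u * (s * p' - s' * p) \<in> J"
  using poly_ideal_uminus[OF ideal_J assms] by (simp add: algebra_simps)

lemma mem_frac:
  assumes "p \<in> polys V" "den s"
  shows "x \<in> fr p s \<longleftrightarrow> (\<exists>p' s'. p' \<in> polys V \<and> den s' \<and> x = (cls p', cls s') \<and> (\<exists>u. den u \<and> u * (s' * p - s * p') \<in> J))"
proof
  assume "x \<in> fr p s"
  then have x: "((cls p, cls s), x) \<in> frac_rel A (carrier A - mA)" by (simp add: fr_def loc_frac_def)
  then obtain p' s' where "x = (cls p', cls s')" "p' \<in> polys V" "den s'"
    unfolding frac_rel_def denominators by (auto simp: carrier_A)
  then show "\<exists>p' s'. p' \<in> polys V \<and> den s' \<and> x = (cls p', cls s') \<and> (\<exists>u. den u \<and> u * (s' * p - s * p') \<in> J)"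
    using x frac_rel_iff[OF assms] by blast
qed (use frac_rel_iff[OF assms] in \<open>auto simp: fr_def loc_frac_def\<close>)

lemma frac_eq_iff:
  assumes "p \<in> polys V" "den s" "p' \<in> polys V" "den s'"
  shows "fr p s = fr p' s' \<longleftrightarrow> (\<exists>u. den u \<and> u * (s' * p - s * p') \<in> J)"
proof
  assume e: "fr p s = fr p' s'"
  have "(cls p', cls s') \<in> fr p' s'"
    unfolding mem_frac[OF assms(3,4)] using assms poly_idealD(3)[OF ideal_J]
    by (intro exI[of _ p'] exI[of _ s'] conjI exI[of _ 1]) auto
  then have "((cls p, cls s), (cls p', cls s')) \<in> frac_rel A (carrier A - mA)"
    unfolding e[symmetric] by (simp add: fr_def loc_frac_def)
  then show "\<exists>u. den u \<and> u * (s' * p - s * p') \<in> J" using frac_rel_iff[OF assms] by simp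
next
  assume "\<exists>u. den u \<and> u * (s' * p - s * p') \<in> J"
  then obtain u where u: "den u" "u * (s' * p - s * p') \<in> J" by blast
  show "fr p s = fr p' s'"
  proof (rule Set.set_eqI)
    fix x
    have "(\<exists>w. den w \<and> w * (t * p - s * q) \<in> J) \<longleftrightarrow> (\<exists>w. den w \<and> w * (t * p' - s' * q) \<in> J)"
      if "den t" for t q
      using frac_rel_trans[OF u(2)] frac_rel_trans[OF frac_rel_sym[OF u(2)]] u(1) that assms by meson
    then show "x \<in> fr p s \<longleftrightarrow> x \<in> fr p' s'"
      unfolding mem_frac[OF assms(1,2)] mem_frac[OF assms(3,4)] by blast
  qed
qed

lemma frac_eqI:
  assumes "p \<in> polys V" "den s" "p' \<in> polys V" "den s'" "s' * p = s * p'"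
  shows "fr p s = fr p' s'"
  unfolding frac_eq_iff[OF assms(1-4)] using assms(5) poly_idealD(3)[OF ideal_J]
  by (intro exI[of _ 1]) auto

section \<open>The localization as a local ring with maximal ideal \<open>mL\<close>\<close>

lemma carrier_L: "carrier L = {fr p s |p s. p \<in> polys V \<and> den s}"
proof -
  have "carrier A \<times> (carrier A - mA) = {(cls p, cls s) |p s. p \<in> polys V \<and> den s}"
    unfolding denominators unfolding carrier_A by auto
  then show ?thesis
    by (auto simp: L_def local_at_def localization_def quotient_def fr_def loc_frac_def)
qed

lemma L_carrE:
  assumes "x \<in> carrier L" obtains p s where "p \<in> polys V" "den s" "x = fr p s"
  using assms unfolding carrier_L by blast

lemma frac_carr [simp]: "p \<in> polys V \<Longrightarrow> den s \<Longrightarrow> fr p s \<in> carrier L"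
  unfolding carrier_L by blast

lemma frac_nonempty: "p \<in> polys V \<Longrightarrow> den s \<Longrightarrow> fr p s \<noteq> {}"
  using mem_frac[of p s "(cls p, cls s)"] poly_idealD(3)[OF ideal_J]
  by (metis den_closed(2) empty_iff mult.commute mult_zero_right right_minus_eq)

lemma L_ops:
  "\<one>\<^bsub>L\<^esub> = fr 1 1" "\<zero>\<^bsub>L\<^esub> = fr 0 1"
  by (simp_all add: L_def local_at_def localization_def fr_def A_ops)

lemma L_mult:
  assumes p: "p \<in> polys V" and s: "den s" and q: "q \<in> polys V" and t: "den t"
  shows "fr p s \<otimes>\<^bsub>L\<^esub> fr q t = fr (p * q) (s * t)"
proof -
  have "loc_frac A (carrier A - mA) (fst x \<otimes>\<^bsub>A\<^esub> fst y) (snd x \<otimes>\<^bsub>A\<^esub> snd y) = fr (p * q) (s * t)"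
    if x: "x \<in> fr p s" and y: "y \<in> fr q t" for x y
  proof -
    obtain p1 s1 u where x1: "p1 \<in> polys V" "den s1" "x = (cls p1, cls s1)" "den u" "u * (s1 * p - s * p1) \<in> J"
      using x unfolding mem_frac[OF p s] by blast
    obtain q1 t1 v where y1: "q1 \<in> polys V" "den t1" "y = (cls q1, cls t1)" "den v" "v * (t1 * q - t * q1) \<in> J"
      using y unfolding mem_frac[OF q t] by blast
    have "(v * t1 * q) * (u * (s1 * p - s * p1)) + (u * s * p1) * (v * (t1 * q - t * q1)) \<in> J"
      using x1 y1 p q s t by (intro poly_idealD(4)[OF ideal_J poly_idealD(5)[OF ideal_J] poly_idealD(5)[OF ideal_J]])
        (auto intro!: polys_mult)
    then have "(u * v) * ((s1 * t1) * (p * q) - (s * t) * (p1 * q1)) \<in> J" by (simp add: algebra_simps)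
    then have "fr (p * q) (s * t) = fr (p1 * q1) (s1 * t1)"
      using x1 y1 p q s t by (subst frac_eq_iff) (auto intro!: polys_mult)
    then show ?thesis using x1 y1 by (simp add: A_ops fr_def den_closed(3))
  qed
  then have "(\<Union>x\<in>fr p s. \<Union>y\<in>fr q t. loc_frac A (carrier A - mA) (fst x \<otimes>\<^bsub>A\<^esub> fst y) (snd x \<otimes>\<^bsub>A\<^esub> snd y)) = fr (p * q) (s * t)"
    using frac_nonempty p s q t by (intro UN_const)
  then show ?thesis by (simp add: L_def local_at_def localization_def case_prod_beta)
qed

lemma L_add:
  assumes p: "p \<in> polys V" and s: "den s" and q: "q \<in> polys V" and t: "den t"
  shows "fr p s \<oplus>\<^bsub>L\<^esub> fr q t = fr (t * p + s * q) (s * t)"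
proof -
  have "loc_frac A (carrier A - mA) (snd y \<otimes>\<^bsub>A\<^esub> fst x \<oplus>\<^bsub>A\<^esub> snd x \<otimes>\<^bsub>A\<^esub> fst y) (snd x \<otimes>\<^bsub>A\<^esub> snd y) = fr (t * p + s * q) (s * t)"
    if x: "x \<in> fr p s" and y: "y \<in> fr q t" for x y
  proof -
    obtain p1 s1 u where x1: "p1 \<in> polys V" "den s1" "x = (cls p1, cls s1)" "den u" "u * (s1 * p - s * p1) \<in> J"
      using x unfolding mem_frac[OF p s] by blast
    obtain q1 t1 v where y1: "q1 \<in> polys V" "den t1" "y = (cls q1, cls t1)" "den v" "v * (t1 * q - t * q1) \<in> J"
      using y unfolding mem_frac[OF q t] by blast
    have "(v * t * t1) * (u * (s1 * p - s * p1)) + (u * s * s1) * (v * (t1 * q - t * q1)) \<in> J"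
      using x1 y1 p q s t by (intro poly_idealD(4)[OF ideal_J poly_idealD(5)[OF ideal_J] poly_idealD(5)[OF ideal_J]])
        (auto intro!: polys_mult)
    then have "(u * v) * ((s1 * t1) * (t * p + s * q) - (s * t) * (t1 * p1 + s1 * q1)) \<in> J" by (simp add: algebra_simps)
    then have "fr (t * p + s * q) (s * t) = fr (t1 * p1 + s1 * q1) (s1 * t1)"
      using x1 y1 p q s t by (subst frac_eq_iff) (auto intro!: polys_mult polys_add)
    then show ?thesis using x1 y1 by (simp add: A_ops fr_def den_closed(3) polys_mult)
  qed
  then have "(\<Union>x\<in>fr p s. \<Union>y\<in>fr q t. loc_frac A (carrier A - mA) (snd y \<otimes>\<^bsub>A\<^esub> fst x \<oplus>\<^bsub>A\<^esub> snd x \<otimes>\<^bsub>A\<^esub> fst y) (snd x \<otimes>\<^bsub>A\<^esub> snd y)) = fr (t * p + s * q) (s * t)"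
    using frac_nonempty p s q t by (intro UN_const)
  then show ?thesis by (simp add: L_def local_at_def localization_def case_prod_beta)
qed

lemma polys_den_arith:
  "p \<in> polys V \<Longrightarrow> q \<in> polys V \<Longrightarrow> den s \<Longrightarrow> den t \<Longrightarrow> t * p + s * q \<in> polys V"
  "p \<in> polys V \<Longrightarrow> q \<in> polys V \<Longrightarrow> p * q \<in> polys V"
  "p \<in> polys V \<Longrightarrow> - p \<in> polys V"
  "den s \<Longrightarrow> den t \<Longrightarrow> den (s * t)"
  by (auto intro!: polys_add polys_mult)

lemma cring_L: "cring L"
proof (intro cringI abelian_groupI comm_monoidI)
  fix x assume "x \<in> carrier L"
  then obtain p s where "p \<in> polys V" "den s" "x = fr p s" by (rule L_carrE)
  then show "\<exists>y\<in>carrier L. y \<oplus>\<^bsub>L\<^esub> x = \<zero>\<^bsub>L\<^esub>"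
    by (intro bexI[of _ "fr (- p) s"]) (auto simp: L_add L_ops polys_uminus polys_den_arith den_closed intro!: frac_eqI del: equalityI)
qed (auto elim!: L_carrE simp: L_mult L_add L_ops polys_den_arith den_closed(2,3)
    intro!: frac_carr frac_eqI del: equalityI, auto simp: algebra_simps)

sublocale L: cring L by (rule cring_L)

lemma frac_in_mL: "p \<in> polys V \<Longrightarrow> den s \<Longrightarrow> fr p s \<in> mL \<longleftrightarrow> ev b p = 0"
proof
  assume p: "p \<in> polys V" and s: "den s" and "fr p s \<in> mL"
  then obtain q t where q: "q \<in> M" "den t" "fr p s = fr q t" by (auto simp: mL_def)
  then obtain u where "den u" "u * (t * p - s * q) \<in> J" using p s by (auto simp: frac_eq_iff M_def)
  then show "ev b p = 0" using ev_J[of "u * (t * p - s * q)"] q by (auto simp: ev_hom M_def den_def)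
qed (auto simp: mL_def M_def)

lemma L_minus:
  assumes "p \<in> polys V" "den s" "q \<in> polys V" "den t"
  shows "fr p s \<ominus>\<^bsub>L\<^esub> fr q t = fr (t * p - s * q) (s * t)"
proof -
  have "\<ominus>\<^bsub>L\<^esub> fr q t = fr (- q) t"
    using assms by (intro L.minus_equality)
      (auto simp: L_add L_ops polys_uminus polys_den_arith den_closed intro!: frac_eqI del: equalityI)
  then show ?thesis using assms by (simp add: a_minus_def L_add polys_uminus)
qed

text \<open>The extension of an ideal to the localization, used for \<open>mL\<close> and for the
  primes.\<close>

lemma ideal_fracs:
  assumes Q: "poly_ideal V Q" shows "ideal {fr p s |p s. p \<in> Q \<and> den s} L"
proof (rule idealI[OF L.ring_axioms])
  let ?g = "{fr p s |p s. p \<in> Q \<and> den s}"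
  have QV: "p \<in> polys V" if "p \<in> Q" for p using that poly_idealD(2)[OF Q] by simp
  have gI: "fr p s \<in> ?g" if "p \<in> Q" "den s" for p s using that by blast
  have sub: "?g \<subseteq> carrier L" using QV by auto
  show "subgroup ?g (add_monoid L)"
  proof (rule L.add.subgroupI)
    show "?g \<noteq> {}" using gI[OF poly_idealD(3)[OF Q] den_closed(2)] by blast
    fix x y assume "x \<in> ?g" "y \<in> ?g"
    then obtain p s q t where *: "x = fr p s" "p \<in> Q" "den s" "y = fr q t" "q \<in> Q" "den t" by blast
    then have "t * p + s * q \<in> Q" using poly_idealD(4,5)[OF Q] by (simp add: den_closed(3))
    from gI[OF this, of "s * t"] show "x \<oplus>\<^bsub>L\<^esub> y \<in> ?g" using * QV by (simp add: L_add den_closed(1))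
  next
    fix x assume x: "x \<in> ?g"
    then obtain p s where p: "x = fr p s" "p \<in> Q" "den s" by blast
    have "\<ominus>\<^bsub>L\<^esub> x = \<zero>\<^bsub>L\<^esub> \<ominus>\<^bsub>L\<^esub> x" using subsetD[OF sub x] by (simp add: a_minus_def)
    also have "\<dots> = fr (- p) s" using p QV by (simp add: L_ops L_minus den_closed)
    finally show "\<ominus>\<^bsub>L\<^esub> x \<in> ?g" using gI[OF poly_ideal_uminus[OF Q p(2)] p(3)] by simp
  qed (rule sub)
  fix a x assume "a \<in> ?g" "x \<in> carrier L"
  then obtain p s q t where *: "a = fr p s" "p \<in> Q" "den s" "x = fr q t" "q \<in> polys V" "den t"
    by (auto elim: L_carrE)
  then show "x \<otimes>\<^bsub>L\<^esub> a \<in> ?g" "a \<otimes>\<^bsub>L\<^esub> x \<in> ?g"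
    using QV gI[OF poly_idealD(5)[OF Q, of q p], of "t * s"] gI[OF poly_idealD(6)[OF Q, of q p], of "s * t"]
    by (simp_all add: L_mult den_closed(1))
qed

lemma ideal_mL: "ideal mL L"
  unfolding mL_def by (rule ideal_fracs) (simp add: M_def poly_ideal_ev_kernel)

text \<open>A fraction outside \<open>mL\<close> has a numerator that is an admissible denominator,
  so it is a unit.\<close>

lemma proper_ideal_sub_mL:
  assumes "ideal I L" "I \<noteq> carrier L" shows "I \<subseteq> mL"
proof (rule ccontr)
  interpret I: ideal I L by fact
  assume "\<not> I \<subseteq> mL"
  then obtain x where x: "x \<in> I" "x \<notin> mL" by blast
  obtain p s where p: "p \<in> polys V" "den s" "x = fr p s" using L_carrE[OF I.Icarr[OF x(1)]] .
  then have "den p" using x frac_in_mL by (auto simp: den_def)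
  then have "fr s p \<otimes>\<^bsub>L\<^esub> x = \<one>\<^bsub>L\<^esub>"
    using p by (auto simp: L_mult L_ops den_closed polys_den_arith mult.commute intro!: frac_eqI del: equalityI)
  moreover have "fr s p \<otimes>\<^bsub>L\<^esub> x \<in> I" using x p \<open>den p\<close> by (intro I.I_l_closed) (auto simp: den_closed)
  ultimately show False using I.one_imp_carrier assms(2) by simp
qed

lemma mL_proper: "mL \<noteq> carrier L"
  using frac_in_mL[OF polys_1 den_closed(2)] frac_carr[OF polys_1 den_closed(2)] by (metis ev_1 zero_neq_one)

lemma maximal_mL: "maximalideal mL L"
proof (rule maximalidealI[OF ideal_mL])
  show "carrier L \<noteq> mL" using mL_proper by simp
  fix I assume "ideal I L" "mL \<subseteq> I" "I \<subseteq> carrier L"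
  then show "I = mL \<or> I = carrier L" using proper_ideal_sub_mL by blast
qed

lemma local_L: "local_ring L N \<longleftrightarrow> N = mL"
proof -
  have "I = mL" if "maximalideal I L" for I
  proof -
    interpret I: maximalideal I L by fact
    have "I \<subseteq> mL" using proper_ideal_sub_mL[OF I.ideal_axioms] I.I_notcarr by auto
    then show ?thesis using I.I_maximal[OF ideal_mL] mL_proper ideal.Icarr[OF ideal_mL] by blast
  qed
  then show ?thesis unfolding local_ring_def using cring_L maximal_mL by blast
qed

lemma regular_L_iff:
  "regular_local_ring L \<longleftrightarrow> noetherian_ring L \<and>
    enat (vectorspace.dim (L Quot mL) (residue_cotangent L mL)) = krull_dim L"
  unfolding regular_local_ring_def local_L by simp

subsection \<open>Prime ideals\<close>

text \<open>The primes of A and of L, seen in the polynomial ring; those of L are the ones that stay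
  inside the ideal \<open>M\<close> of the point.\<close>

definition "primes_A = {Q. poly_prime V Q \<and> J \<subseteq> Q}"
definition "primes_L = {Q. poly_prime V Q \<and> J \<subseteq> Q \<and> Q \<subseteq> M}"

text \<open>The target is left open so that the same argument serves the quotient and its
  localization.\<close>

lemma pullback_prime:
  assumes R: "primeideal Q R" and hom: "\<pi> \<in> Ring.ring_hom (poly_alg V) R" and J: "\<And>p. p \<in> J \<Longrightarrow> \<pi> p = \<zero>\<^bsub>R\<^esub>"
  shows "{p \<in> polys V. \<pi> p \<in> Q} \<in> primes_A"
proof -
  interpret Q: primeideal Q R by fact
  note h = ring_hom_closed[OF hom] ring_hom_mult[OF hom] ring_hom_add[OF hom] ring_hom_one[OF hom]
  have 0: "\<zero>\<^bsub>R\<^esub> \<in> Q" by (rule additive_subgroup.zero_closed[OF Q.is_additive_subgroup])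
  have "\<pi> 0 = \<zero>\<^bsub>R\<^esub>" by (rule J) (rule poly_idealD(3)[OF ideal_J])
  moreover have "\<one>\<^bsub>R\<^esub> \<notin> Q" using Q.one_imp_carrier Q.I_notcarr by auto
  ultimately show ?thesis
    using h 0 J J_sub additive_subgroup.a_closed[OF Q.is_additive_subgroup] Q.I_l_closed Q.I_prime
    by (simp add: primes_A_def poly_prime_def poly_ideal_def subset_iff polys_add polys_mult)
qed

lemma ideal_cls_image:
  assumes id: "poly_ideal V Q" shows "ideal (cls ` Q) A"
proof (rule idealI[OF A.ring_axioms])
  show "subgroup (cls ` Q) (add_monoid A)"
  proof (rule A.add.subgroupI)
    show "cls ` Q \<subseteq> carrier A" using poly_idealD(2)[OF id] by (auto simp: carrier_A)
    show "cls ` Q \<noteq> {}" using poly_idealD(3)[OF id] by auto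
    fix x y assume "x \<in> cls ` Q" "y \<in> cls ` Q"
    then show "x \<oplus>\<^bsub>A\<^esub> y \<in> cls ` Q" using poly_idealD(2,4)[OF id] by (auto simp: A_ops)
  next
    fix x assume "x \<in> cls ` Q"
    then obtain p where p: "p \<in> Q" "x = cls p" by auto
    then have "\<ominus>\<^bsub>A\<^esub> x = cls (- p)" using poly_idealD(2)[OF id]
      by (intro A.minus_equality) (auto simp: A_ops carrier_A polys_uminus)
    then show "\<ominus>\<^bsub>A\<^esub> x \<in> cls ` Q" using p poly_ideal_uminus[OF id] by auto
  qed
qed (use poly_idealD[OF id] in \<open>auto simp: carrier_A A_ops\<close>)

lemma cls_hom: "cls \<in> Ring.ring_hom (poly_alg V) A"
  by (rule ring_hom_memI) (auto simp: A_ops carrier_A)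

lemma cls_J: "p \<in> J \<Longrightarrow> cls p = \<zero>\<^bsub>A\<^esub>"
  using J_sub cls_eq_iff[of p 0] by (simp add: A_ops)

lemma fr_hom: "(\<lambda>p. fr p 1) \<in> Ring.ring_hom (poly_alg V) L"
  by (rule ring_hom_memI) (auto simp: L_ops L_mult L_add den_closed)

lemma fr_J: "p \<in> J \<Longrightarrow> fr p 1 = \<zero>\<^bsub>L\<^esub>"
  unfolding L_ops using J_sub by (subst frac_eq_iff) (auto intro!: exI[of _ 1] del: equalityI)

lemma krull_dim_A: "krull_dim A = prime_dim primes_A"
proof (rule krull_dim_eq_prime_dim)
  show "{p \<in> polys V. cls p \<in> Q} \<in> primes_A" if "primeideal Q A" for Q
    using pullback_prime[OF that cls_hom cls_J] .
  show "{p \<in> polys V. cls p \<in> Q} \<subset> {p \<in> polys V. cls p \<in> Q'}" if "primeideal Q A" "primeideal Q' A" "Q \<subset> Q'" for Q Q'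
    using that ideal.Icarr[OF primeideal.axioms(1)[OF that(2)]] by (auto simp: carrier_A)
  fix Q assume Q: "Q \<in> primes_A"
  then have id: "poly_ideal V Q" "J \<subseteq> Q" by (auto simp: primes_A_def poly_prime_def)
  have mem: "cls p \<in> cls ` Q \<longleftrightarrow> p \<in> Q" if "p \<in> polys V" for p
  proof
    assume "cls p \<in> cls ` Q"
    then obtain q where q: "q \<in> Q" "cls p = cls q" by auto
    then have "p - q \<in> Q" using id that poly_idealD(2)[OF id(1)] cls_eq_iff[of p q] by auto
    then have "(p - q) + q \<in> Q" using q id poly_idealD(4) by blast
    then show "p \<in> Q" by simp
  qed auto
  have carr: "x \<in> cls ` Q \<Longrightarrow> \<exists>p\<in>Q. p \<in> polys V \<and> x = cls p" for x using poly_idealD(2)[OF id(1)] by auto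
  show "primeideal (cls ` Q) A"
  proof (rule primeidealI[OF _ cring_A])
    show "ideal (cls ` Q) A" using id(1) by (rule ideal_cls_image)
    have "cls 1 \<notin> cls ` Q" using mem[of 1] Q by (auto simp: primes_A_def poly_prime_def)
    moreover have "cls 1 \<in> carrier A" by (auto simp: carrier_A)
    ultimately show "carrier A \<noteq> cls ` Q" by metis
    fix x y assume "x \<in> carrier A" "y \<in> carrier A" "x \<otimes>\<^bsub>A\<^esub> y \<in> cls ` Q"
    then obtain p q where pq: "p \<in> polys V" "x = cls p" "q \<in> polys V" "y = cls q" "cls (p * q) \<in> cls ` Q"
      by (auto simp: carrier_A A_ops simp del: image_iff)
    then have "p * q \<in> Q" using mem[of "p * q"] by (simp add: polys_mult)
    then have "p \<in> Q \<or> q \<in> Q" using Q pq unfolding primes_A_def poly_prime_def by blast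
    then show "x \<in> cls ` Q \<or> y \<in> cls ` Q" using pq by auto
  qed
  fix Q' assume Q': "Q' \<in> primes_A" "Q \<subset> Q'"
  then obtain p where p: "p \<in> Q'" "p \<notin> Q" by auto
  then have "p \<in> polys V" using Q' poly_idealD(2) by (auto simp: primes_A_def poly_prime_def)
  then have "cls p \<notin> cls ` Q" using mem p by simp
  then show "cls ` Q \<subset> cls ` Q'" using p Q' by blast
qed

lemma krull_dim_L: "krull_dim L = prime_dim primes_L"
proof (rule krull_dim_eq_prime_dim)
  \<comment> \<open>Denominators are units, so an ideal of L is determined by the polynomials p with
    p/1 in it.\<close>
  have unit: "fr p s \<in> Q \<longleftrightarrow> fr p 1 \<in> Q" if "ideal Q L" "p \<in> polys V" "den s" for Q p s
  proof -
    interpret Q: ideal Q L by fact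
    have "fr p 1 = fr s 1 \<otimes>\<^bsub>L\<^esub> fr p s" "fr p s = fr 1 s \<otimes>\<^bsub>L\<^esub> fr p 1"
      using that by (auto simp: L_mult den_closed polys_den_arith intro!: frac_eqI del: equalityI)
    then show ?thesis using Q.I_l_closed[of "fr p s" "fr s 1"] Q.I_l_closed[of "fr p 1" "fr 1 s"] that
      by (metis den_closed(2,3) frac_carr polys_1)
  qed
  show "{p \<in> polys V. fr p 1 \<in> Q} \<in> primes_L" if "primeideal Q L" for Q
  proof -
    interpret Q: primeideal Q L by fact
    have "Q \<subseteq> mL" using proper_ideal_sub_mL[OF Q.ideal_axioms] Q.I_notcarr by auto
    then show ?thesis using pullback_prime[OF that fr_hom fr_J] frac_in_mL[of _ 1]
      by (auto simp: primes_A_def primes_L_def M_def den_closed)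
  qed
  show "{p \<in> polys V. fr p 1 \<in> Q} \<subset> {p \<in> polys V. fr p 1 \<in> Q'}" if Q: "primeideal Q L" "primeideal Q' L" "Q \<subset> Q'" for Q Q'
  proof -
    have id: "ideal Q L" "ideal Q' L" using Q primeideal.axioms(1) by auto
    obtain x where x: "x \<in> Q'" "x \<notin> Q" using Q(3) by blast
    obtain p s where "p \<in> polys V" "den s" "x = fr p s" using L_carrE[OF ideal.Icarr[OF id(2) x(1)]] .
    then have "p \<in> polys V" "fr p 1 \<in> Q'" "fr p 1 \<notin> Q" using x unit id by auto
    then show ?thesis using Q(3) by blast
  qed
  fix Q assume Q: "Q \<in> primes_L"
  then have id: "poly_ideal V Q" "J \<subseteq> Q" "Q \<subseteq> M" and pr: "poly_prime V Q" by (auto simp: primes_L_def poly_prime_def)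
  define g where "g Q = {fr p s |p s. p \<in> Q \<and> den s}" for Q
  have mem: "fr p s \<in> g Q \<longleftrightarrow> p \<in> Q" if p: "p \<in> polys V" and s: "den s" for p s
  proof
    assume "fr p s \<in> g Q"
    then obtain q t where q: "q \<in> Q" "den t" "fr p s = fr q t" by (auto simp: g_def)
    then have qV: "q \<in> polys V" using poly_idealD(2)[OF id(1)] by simp
    obtain u where u: "den u" "u * (t * p - s * q) \<in> J" using q p s qV by (auto simp: frac_eq_iff)
    have "u * (t * p - s * q) + u * s * q \<in> Q"
      using u q s by (intro poly_idealD(4)[OF id(1) subsetD[OF id(2)] poly_idealD(5)[OF id(1)]]) (auto intro!: polys_mult)
    then have "(u * t) * p \<in> Q" by (simp add: algebra_simps)
    \<comment> \<open>Denominators do not vanish at \<open>b\<close>, whereas \<open>Q\<close> lies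
      in \<open>M\<close>; primeness therefore allows them to be cancelled.\<close>
    moreover have "u * t \<notin> Q" using id(3) u q by (auto simp: M_def den_def ev_hom)
    moreover have "u * t \<in> polys V" using u q by (auto intro!: polys_mult)
    ultimately show "p \<in> Q" using pr p by (auto simp: poly_prime_def)
  qed (use s in \<open>auto simp: g_def\<close>)
  show "primeideal (g Q) L"
  proof (rule primeidealI[OF _ cring_L])
    show "ideal (g Q) L" unfolding g_def using id(1) by (rule ideal_fracs)
    have "fr 1 1 \<notin> g Q" using mem[of 1 1] pr by (auto simp: poly_prime_def)
    then show "carrier L \<noteq> g Q" using frac_carr[OF polys_1 den_closed(2)] by metis
    fix x y assume "x \<in> carrier L" "y \<in> carrier L" "x \<otimes>\<^bsub>L\<^esub> y \<in> g Q"
    then obtain p s q t where pq: "p \<in> polys V" "den s" "x = fr p s" "q \<in> polys V" "den t" "y = fr q t"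
      "fr (p * q) (s * t) \<in> g Q" by (auto elim!: L_carrE simp: L_mult)
    then have "p * q \<in> Q" using mem[of "p * q" "s * t"] polys_den_arith by simp
    then have "p \<in> Q \<or> q \<in> Q" using pr pq unfolding poly_prime_def by blast
    then show "x \<in> g Q \<or> y \<in> g Q" using pq mem by auto
  qed
  fix Q' assume Q': "Q' \<in> primes_L" "Q \<subset> Q'"
  then obtain p where p: "p \<in> Q'" "p \<notin> Q" by auto
  then have "p \<in> polys V" using Q' poly_idealD(2) by (auto simp: primes_L_def poly_prime_def)
  then have "fr p 1 \<notin> g Q" using mem[of p 1] p by auto
  moreover have "fr p 1 \<in> g Q'" using p by (auto simp: g_def)
  moreover have "g Q \<subseteq> g Q'" using Q'(2) by (auto simp: g_def)
  ultimately show "g Q \<subset> g Q'" by blast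
qed

text \<open>As \<open>\<beta>\<close> preserves values, it takes denominators to denominators, and
  so it induces a surjection of local rings.\<close>

lemma noetherian_transfer:
  assumes F: "point_quotient V' b' J'" and noeth: "noetherian_ring L"
    and \<beta>: "\<beta> ` polys V = polys V'" "\<beta> 1 = 1" "\<And>p q. \<beta> (p + q) = \<beta> p + \<beta> q"
      "\<And>p q. \<beta> (p * q) = \<beta> p * \<beta> q" "\<And>p q. \<beta> (p - q) = \<beta> p - \<beta> q" "\<And>p. ev b' (\<beta> p) = ev b p" "\<beta> ` J \<subseteq> J'"
  shows "noetherian_ring (point_quotient.L V' b' J')"
proof -
  interpret F: point_quotient V' b' J' by fact
  have den: "F.den (\<beta> s) \<longleftrightarrow> ev b s \<noteq> 0" if "s \<in> polys V" for s
    using that \<beta> by (auto simp: F.den_def)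
  have \<beta>V: "\<beta> p \<in> polys V'" if "p \<in> polys V" for p using that \<beta>(1) by auto
  \<comment> \<open>The map is defined through a chosen fraction; the choice is immaterial because
    \<open>\<beta>\<close> carries the relation between two representing fractions into
    \<open>J'\<close>.\<close>
  define \<phi> where "\<phi> X = (case SOME (p, s). p \<in> polys V \<and> den s \<and> X = fr p s of (p, s) \<Rightarrow> F.fr (\<beta> p) (\<beta> s))" for X
  have \<phi>: "\<phi> (fr p s) = F.fr (\<beta> p) (\<beta> s)" if p: "p \<in> polys V" "den s" for p s
  proof -
    define x where "x = (SOME x. case x of (q, t) \<Rightarrow> q \<in> polys V \<and> den t \<and> fr p s = fr q t)"
    have "case x of (q, t) \<Rightarrow> q \<in> polys V \<and> den t \<and> fr p s = fr q t"
      unfolding x_def by (rule someI[of _ "(p, s)"]) (use p in simp)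
    then obtain q t where x: "x = (q, t)" "q \<in> polys V" "den t" "fr p s = fr q t" by (cases x) auto
    then obtain u where u: "den u" "u * (t * p - s * q) \<in> J" using p by (auto simp: frac_eq_iff)
    have "\<beta> (u * (t * p - s * q)) \<in> J'" using u \<beta>(7) by blast
    then have "F.fr (\<beta> p) (\<beta> s) = F.fr (\<beta> q) (\<beta> t)"
      using p x u den \<beta>V by (subst F.frac_eq_iff) (auto simp: \<beta> den_def intro!: exI[of _ "\<beta> u"])
    then show ?thesis unfolding \<phi>_def x_def[symmetric] x(1) by simp
  qed
  show ?thesis
  proof (rule noetherian_ring_image[OF noeth F.L.ring_axioms, of \<phi>])
    show "\<phi> \<in> Ring.ring_hom L F.L"
    proof (rule ring_hom_memI)
      fix x y assume "x \<in> carrier L" "y \<in> carrier L"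
      then obtain p s q t where xy: "p \<in> polys V" "den s" "x = fr p s" "q \<in> polys V" "den t" "y = fr q t"
        by (elim L_carrE) blast
      have d: "F.den (\<beta> s)" "F.den (\<beta> t)" "s \<in> polys V" "t \<in> polys V" using xy den by (auto simp: den_def)
      show "\<phi> x \<in> carrier F.L" using xy d \<beta>V by (simp add: \<phi>)
      show "\<phi> (x \<otimes>\<^bsub>L\<^esub> y) = \<phi> x \<otimes>\<^bsub>F.L\<^esub> \<phi> y"
        using xy d \<beta>V by (simp add: \<phi> L_mult F.L_mult polys_den_arith \<beta>)
      show "\<phi> (x \<oplus>\<^bsub>L\<^esub> y) = \<phi> x \<oplus>\<^bsub>F.L\<^esub> \<phi> y"
        using xy d \<beta>V by (simp add: \<phi> L_add F.L_add polys_den_arith \<beta>)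
    next
      show "\<phi> \<one>\<^bsub>L\<^esub> = \<one>\<^bsub>F.L\<^esub>" by (simp add: L_ops F.L_ops \<phi> \<beta> den_closed)
    qed
    show "\<phi> ` carrier L = carrier F.L"
    proof
      show "\<phi> ` carrier L \<subseteq> carrier F.L"
        using \<beta>V den by (auto elim!: L_carrE simp: \<phi> den_def)
      show "carrier F.L \<subseteq> \<phi> ` carrier L"
      proof
        fix y assume "y \<in> carrier F.L"
        then obtain q t where y: "q \<in> polys V'" "F.den t" "y = F.fr q t" by (rule F.L_carrE)
        then have "q \<in> \<beta> ` polys V" "t \<in> \<beta> ` polys V" unfolding \<beta>(1) by auto
        then obtain p s where p: "p \<in> polys V" "q = \<beta> p" "s \<in> polys V" "t = \<beta> s" by (elim imageE)
        then have "den s" using y den by (simp add: den_def)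
        then have "y = \<phi> (fr p s)" "fr p s \<in> carrier L" using p y by (simp_all add: \<phi>)
        then show "y \<in> \<phi> ` carrier L" by (rule image_eqI)
      qed
    qed
  qed
qed

end

text \<open>The \<open>d _ k\<close> are derivations at \<open>b\<close> that kill \<open>J\<close>.
  The kernel condition is stated for every ideal \<open>Z\<close> that contains \<open>J\<close> and
  all products of two polynomials vanishing at \<open>b\<close>; thus \<open>Z\<close> may be the
  preimage of the square of the maximal ideal of A or of L.\<close>

locale point_coordinates = point_quotient V b J
  for V and b :: "nat \<Rightarrow> 'k::field" and J +
  fixes d :: "'k mpoly \<Rightarrow> nat \<Rightarrow> 'k" and Y :: "nat set"
  assumes d_add: "\<And>p q k. d (p + q) k = d p k + d q k"
    and d_mult: "\<And>p q k. d (p * q) k = ev b p * d q k + d p k * ev b q"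
    and d_Const: "\<And>c k. d (Const c) k = 0"
    and d_J: "\<And>p k. p \<in> J \<Longrightarrow> d p k = 0"
    and Y_V: "Y \<subseteq> V"
    and d_Var: "\<And>j k. j \<in> Y \<Longrightarrow> k \<in> Y \<Longrightarrow> d (Var j) k = (if j = k then 1 else 0)"
    and d_ker: "\<And>Z p. poly_ideal V Z \<Longrightarrow> J \<subseteq> Z \<Longrightarrow>
      (\<And>p q. p \<in> polys V \<Longrightarrow> q \<in> polys V \<Longrightarrow> ev b p = 0 \<Longrightarrow> ev b q = 0 \<Longrightarrow> p * q \<in> Z) \<Longrightarrow>
      p \<in> polys V \<Longrightarrow> ev b p = 0 \<Longrightarrow> (\<And>k. k \<in> Y \<Longrightarrow> d p k = 0) \<Longrightarrow> p \<in> Z"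
begin

section \<open>Coordinates on the cotangent spaces of \<open>A\<close> and \<open>L\<close>\<close>

lemma d_diff: "d (p - q) k = d p k - d q k"
  using d_add[of "p - q" q k] by simp

definition "DA X = d (SOME p. p \<in> polys V \<and> cls p = X)"

lemma DA_cls: assumes "p \<in> polys V" shows "DA (cls p) k = d p k"
proof -
  define q where "q = (SOME q. q \<in> polys V \<and> cls q = cls p)"
  have "q \<in> polys V \<and> cls q = cls p" unfolding q_def by (rule someI[of _ p]) (use assms in simp)
  then have "q - p \<in> J" using assms cls_eq_iff by blast
  from d_J[OF this, of k] show ?thesis by (simp add: DA_def q_def d_diff)
qed

text \<open>The quotient rule for p/s at \<open>b\<close>, whose second term drops out because p
  vanishes there.\<close>

definition "DL X = (case SOME (p, s). p \<in> M \<and> den s \<and> X = fr p s of (p, s) \<Rightarrow> (\<lambda>k. d p k / ev b s))"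

lemma DL_fr: assumes p: "p \<in> M" "den s" shows "DL (fr p s) k = d p k / ev b s"
proof -
  define x where "x = (SOME x. case x of (q, t) \<Rightarrow> q \<in> M \<and> den t \<and> fr p s = fr q t)"
  have "case x of (q, t) \<Rightarrow> q \<in> M \<and> den t \<and> fr p s = fr q t"
    unfolding x_def by (rule someI[of _ "(p, s)"]) (use p in simp)
  then obtain q t where x: "x = (q, t)" "q \<in> M" "den t" "fr p s = fr q t" by (cases x) auto
  then obtain u where u: "den u" "u * (t * p - s * q) \<in> J" using p by (auto simp: frac_eq_iff M_def)
  have ev: "ev b u \<noteq> 0" "ev b s \<noteq> 0" "ev b t \<noteq> 0" "ev b p = 0" "ev b q = 0"
    using u p x by (auto simp: den_def M_def)
  have "ev b t * d p k = ev b s * d q k"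
    using d_J[OF u(2), of k] ev by (simp add: d_mult d_diff ev_hom)
  then have "d p k / ev b s = d q k / ev b t" using ev by (simp add: field_simps)
  then show ?thesis unfolding DL_def x_def[symmetric] x(1) by simp
qed

lemma M_arith: "p \<in> M \<Longrightarrow> q \<in> M \<Longrightarrow> p + q \<in> M" "p \<in> polys V \<Longrightarrow> q \<in> M \<Longrightarrow> p * q \<in> M"
  by (auto simp: M_def ev_hom)

lemma Var_M: "k \<in> V \<Longrightarrow> Var k - Const (b k) \<in> M"
  by (auto simp: M_def ev_hom intro!: polys_diff)

lemma d_shift: "j \<in> Y \<Longrightarrow> k \<in> Y \<Longrightarrow> d (Var j - Const (b j)) k = (if j = k then 1 else 0)"
  by (simp add: d_diff d_Var d_Const)

text \<open>Applies \<open>d_ker\<close> to the preimage of \<open>N \<cdot> N\<close> under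
  \<open>\<pi>\<close>; it serves both the quotient and the localization.\<close>

lemma image_in_square:
  assumes R: "cring R" and N: "ideal N R" and \<pi>: "\<pi> \<in> Ring.ring_hom (poly_alg V) R"
    and \<pi>J: "\<And>p. p \<in> J \<Longrightarrow> \<pi> p = \<zero>\<^bsub>R\<^esub>" and \<pi>N: "\<And>p. p \<in> polys V \<Longrightarrow> ev b p = 0 \<Longrightarrow> \<pi> p \<in> N"
    and p: "p \<in> M" and d0: "\<And>k. k \<in> Y \<Longrightarrow> d p k = 0"
  shows "\<pi> p \<in> N \<cdot>\<^bsub>R\<^esub> N"
proof -
  interpret R: cring R by (rule R)
  interpret S: ideal "N \<cdot>\<^bsub>R\<^esub> N" R by (rule R.ideal_prod_is_ideal[OF N N])
  interpret \<pi>: ring_hom_ring "poly_alg V" R \<pi> by (intro ring_hom_ringI2 \<pi> P.ring_axioms R.ring_axioms)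
  let ?Z = "{p \<in> polys V. \<pi> p \<in> N \<cdot>\<^bsub>R\<^esub> N}"
  have "p \<in> ?Z"
  proof (rule d_ker)
    show "poly_ideal V ?Z"
      using \<pi>.ideal_vimage[OF S.ideal_axioms] by (simp add: ideal_poly_alg_iff)
    show "J \<subseteq> ?Z"
      using J_sub \<pi>J additive_subgroup.zero_closed[OF S.is_additive_subgroup] by auto
    fix p q :: "'k mpoly" assume pq: "p \<in> polys V" "q \<in> polys V" "ev b p = 0" "ev b q = 0"
    then have "\<pi> p \<otimes>\<^bsub>R\<^esub> \<pi> q \<in> N \<cdot>\<^bsub>R\<^esub> N" by (intro ideal_prod.prod \<pi>N)
    then show "p * q \<in> ?Z" using pq \<pi>.hom_mult[of p q] by (simp add: polys_mult)
  qed (use p d0 in \<open>auto simp: M_def\<close>)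
  then show ?thesis by simp
qed

lemma coordinates_A: "coordinates A mA DA (\<lambda>c. cls (Const c)) (\<lambda>k. cls (Var k - Const (b k))) Y"
proof (rule coordinates.intro)
  show "cring A" by (rule cring_A)
  have poly_ideal_M: "poly_ideal V M" unfolding M_def by (rule poly_ideal_ev_kernel)
  show id: "ideal mA A" unfolding mA_eq by (rule ideal_cls_image[OF poly_ideal_M])
  show "\<one>\<^bsub>A\<^esub> \<notin> mA" by (simp add: A_ops cls_in_mA)
  show "finite Y" using Y_V finite_V by (rule finite_subset)
  show "cls (Const 0) = \<zero>\<^bsub>A\<^esub>" "cls (Const 1) = \<one>\<^bsub>A\<^esub>" by (simp_all add: A_ops Const_arith)
  fix c e show "cls (Const c) \<in> carrier A" by (simp add: carrier_A)
  show "cls (Const (c + e)) = cls (Const c) \<oplus>\<^bsub>A\<^esub> cls (Const e)" "cls (Const (c * e)) = cls (Const c) \<otimes>\<^bsub>A\<^esub> cls (Const e)"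
    by (simp_all add: A_ops Const_arith)
next
  fix x y k assume "x \<in> mA" "y \<in> mA"
  then obtain p q where pq: "p \<in> M" "x = cls p" "q \<in> M" "y = cls q" by (auto simp: mA_eq)
  then have "p \<in> polys V" "ev b p = 0" "q \<in> polys V" "ev b q = 0" by (auto simp: M_def)
  then show "DA (x \<oplus>\<^bsub>A\<^esub> y) k = DA x k + DA y k" "DA (x \<otimes>\<^bsub>A\<^esub> y) k = 0"
    by (simp_all add: pq(2,4) A_ops DA_cls polys_add polys_mult d_add d_mult)
next
  fix c x k assume "x \<in> mA"
  then obtain p where "p \<in> polys V" "x = cls p" using M_sub by (auto simp: mA_eq)
  then show "DA (cls (Const c) \<otimes>\<^bsub>A\<^esub> x) k = c * DA x k"
    by (simp add: A_ops DA_cls polys_mult d_mult d_Const)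
next
  fix k assume "k \<in> Y"
  then show "cls (Var k - Const (b k)) \<in> mA" using Var_M Y_V by (auto simp: mA_eq)
next
  fix j k assume "j \<in> Y" "k \<in> Y"
  then show "DA (cls (Var j - Const (b j))) k = (if j = k then 1 else 0)"
    using Y_V Var_M M_sub by (subst DA_cls) (auto simp: d_shift)
next
  have poly_ideal_M: "poly_ideal V M" unfolding M_def by (rule poly_ideal_ev_kernel)
  have id: "ideal mA A" unfolding mA_eq by (rule ideal_cls_image[OF poly_ideal_M])
  fix x assume "x \<in> mA" and x0: "\<And>k. k \<in> Y \<Longrightarrow> DA x k = 0"
  then obtain p where p: "p \<in> M" "x = cls p" by (auto simp: mA_eq)
  have d0: "d p k = 0" if "k \<in> Y" for k using x0[OF that] p M_sub by (simp add: DA_cls)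
  show "x \<in> mA \<cdot>\<^bsub>A\<^esub> mA"
    unfolding p(2) by (rule image_in_square[OF cring_A id cls_hom cls_J _ p(1)]) (simp_all add: cls_in_mA d0)
qed

lemma dim_cotangent_A: "vectorspace.dim class_ring (cotangent A mA) = card Y"
  by (rule dim_cotangent[OF coordinates_A]) (auto simp: carrier_A A_smult A_ops)

lemma coordinates_L: "coordinates L mL DL (\<lambda>c. fr (Const c) 1) (\<lambda>k. fr (Var k - Const (b k)) 1) Y"
proof (rule coordinates.intro)
  show "cring L" by (rule cring_L)
  show "ideal mL L" by (rule ideal_mL)
  show "\<one>\<^bsub>L\<^esub> \<notin> mL" by (simp add: L_ops frac_in_mL den_closed)
  show "finite Y" using Y_V finite_V by (rule finite_subset)
  show "fr (Const 0) 1 = \<zero>\<^bsub>L\<^esub>" "fr (Const 1) 1 = \<one>\<^bsub>L\<^esub>" by (simp_all add: L_ops Const_arith)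
  fix c e show "fr (Const c) 1 \<in> carrier L" by (simp add: den_closed)
  show "fr (Const (c + e)) 1 = fr (Const c) 1 \<oplus>\<^bsub>L\<^esub> fr (Const e) 1" "fr (Const (c * e)) 1 = fr (Const c) 1 \<otimes>\<^bsub>L\<^esub> fr (Const e) 1"
    by (simp_all add: L_add L_mult Const_arith den_closed)
next
  fix x y k assume "x \<in> mL" "y \<in> mL"
  then obtain p s q t where pq: "p \<in> M" "den s" "x = fr p s" "q \<in> M" "den t" "y = fr q t" by (auto simp: mL_def)
  have c: "p \<in> polys V" "q \<in> polys V" "s \<in> polys V" "t \<in> polys V" "ev b s \<noteq> 0" "ev b t \<noteq> 0" "ev b p = 0" "ev b q = 0"
    using pq by (auto simp: M_def den_def)
  have m: "t * p + s * q \<in> M" "p * q \<in> M" using pq c by (auto intro!: M_arith)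
  show "DL (x \<oplus>\<^bsub>L\<^esub> y) k = DL x k + DL y k"
    using pq c m by (simp add: L_add DL_fr polys_den_arith d_add d_mult ev_hom field_simps)
  show "DL (x \<otimes>\<^bsub>L\<^esub> y) k = 0"
    using pq c m by (simp add: L_mult DL_fr polys_den_arith d_mult)
next
  fix c x k assume "x \<in> mL"
  then obtain p s where pq: "p \<in> M" "den s" "x = fr p s" by (auto simp: mL_def)
  then have "Const c * p \<in> M" "p \<in> polys V" by (simp_all add: M_arith M_sub)
  with pq show "DL (fr (Const c) 1 \<otimes>\<^bsub>L\<^esub> x) k = c * DL x k"
    by (simp add: L_mult DL_fr den_closed d_mult d_Const)
next
  fix k assume "k \<in> Y"
  then have "Var k - Const (b k) \<in> M" using Var_M Y_V by auto
  then show "fr (Var k - Const (b k)) 1 \<in> mL" by (auto simp: mL_def den_closed)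
next
  fix j k assume "j \<in> Y" "k \<in> Y"
  then show "DL (fr (Var j - Const (b j)) 1) k = (if j = k then 1 else 0)"
    using Y_V Var_M by (subst DL_fr) (auto simp: d_shift den_closed)
next
  interpret S: ideal "mL \<cdot>\<^bsub>L\<^esub> mL" L by (rule L.ideal_prod_is_ideal[OF ideal_mL ideal_mL])
  fix x assume "x \<in> mL" and x0: "\<And>k. k \<in> Y \<Longrightarrow> DL x k = 0"
  then obtain p s where p: "p \<in> M" "den s" "x = fr p s" by (auto simp: mL_def)
  have pV: "p \<in> polys V" "ev b p = 0" using p by (auto simp: M_def)
  have d0: "d p k = 0" if "k \<in> Y" for k using x0[OF that] p by (simp add: DL_fr den_def)
  have "fr p 1 \<in> mL \<cdot>\<^bsub>L\<^esub> mL"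
    by (rule image_in_square[OF cring_L ideal_mL fr_hom fr_J _ p(1)])
      (simp_all add: frac_in_mL den_closed d0)
  then have "fr 1 s \<otimes>\<^bsub>L\<^esub> fr p 1 \<in> mL \<cdot>\<^bsub>L\<^esub> mL" using p by (intro S.I_l_closed) auto
  then show "x \<in> mL \<cdot>\<^bsub>L\<^esub> mL" using p pV by (simp add: L_mult den_closed)
qed

lemma dim_residue_cotangent_L: "vectorspace.dim (L Quot mL) (residue_cotangent L mL) = card Y"
proof (rule coordinates.dim_residue_cotangent[OF coordinates_L maximal_mL])
  fix r assume "r \<in> carrier L"
  then obtain p s where p: "p \<in> polys V" "den s" "r = fr p s" by (rule L_carrE)
  then have "ev b s \<noteq> 0" "s \<in> polys V" by (auto simp: den_def)
  \<comment> \<open>The residue of a fraction is the quotient of the values at \<open>b\<close>, so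
    the residue field is K.\<close>
  then have "r \<ominus>\<^bsub>L\<^esub> fr (Const (ev b p / ev b s)) 1 \<in> mL"
    using p by (simp add: L_minus den_closed frac_in_mL polys_diff polys_mult ev_hom)
  then show "\<exists>c. r \<ominus>\<^bsub>L\<^esub> fr (Const c) 1 \<in> mL" ..
qed

text \<open>Reduces regularity, apart from the Noetherian property, to the lengths of chains of
  polynomial primes between \<open>J\<close> and \<open>M\<close>.\<close>

lemma regular_L_iff_dim: "regular_local_ring L \<longleftrightarrow> noetherian_ring L \<and> enat (card Y) = prime_dim primes_L"
  by (simp add: regular_L_iff dim_residue_cotangent_L krull_dim_L)

end

section \<open>Coordinates from an echelon system\<close>

text \<open>Expansion to first order at \<open>b\<close>. In the product case the error is the
  product of p - p(b) and q - q(b), which lies in \<open>Z\<close>, plus multiples of the errors of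
  the factors.\<close>

lemma taylor_mod_square:
  assumes V: "finite V" and Z: "poly_ideal V Z"
    and sq: "\<And>p q. p \<in> polys V \<Longrightarrow> q \<in> polys V \<Longrightarrow> ev b p = 0 \<Longrightarrow> ev b q = 0 \<Longrightarrow> p * q \<in> Z"
    and p: "p \<in> polys V"
  shows "p - Const (ev b p) - (\<Sum>j\<in>V. Const (dcoef b j p) * (Var j - Const (b j))) \<in> Z"
  using p
proof (induction rule: polys_induct)
  case (Const c)
  then show ?case using poly_idealD(3)[OF Z] by (simp add: Const_arith)
next
  case (Var i)
  have "(\<Sum>j\<in>V. Const (if i = j then 1 else 0) * (Var j - Const (b j))) = (\<Sum>j\<in>V. if i = j then Var j - Const (b j) else 0)"
    by (rule sum.cong) (auto simp: Const_arith)
  then have "(\<Sum>j\<in>V. Const (if i = j then 1 else 0) * (Var j - Const (b j))) = Var i - Const (b i)"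
    using Var V by simp
  then show ?case using poly_idealD(3)[OF Z] by simp
next
  case (add p q)
  let ?l = "\<lambda>p. \<Sum>j\<in>V. Const (dcoef b j p) * (Var j - Const (b j))"
  have e: "p + q - Const (ev b (p + q)) - ?l (p + q) = (p - Const (ev b p) - ?l p) + (q - Const (ev b q) - ?l q)"
    by (simp add: ev_hom dcoef_hom Const_arith distrib_right sum.distrib)
  show ?case unfolding e by (rule poly_idealD(4)[OF Z]) (use add in auto)
next
  case (mult p q)
  define l where "l p = (\<Sum>j\<in>V. Const (dcoef b j p) * (Var j - Const (b j)))" for p
  have l_mult: "l (p * q) = Const (ev b p) * l q + Const (ev b q) * l p"
    unfolding l_def sum_distrib_left sum.distrib[symmetric]
    by (rule sum.cong[OF refl]) (simp only: dcoef_mult Const_arith(3,4) distrib_left distrib_right mult_ac)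
  have e: "p * q - Const (ev b (p * q)) - l (p * q) = (p - Const (ev b p)) * (q - Const (ev b q)) +
      (Const (ev b p) * (q - Const (ev b q) - l q) + Const (ev b q) * (p - Const (ev b p) - l p))"
    unfolding l_mult ev_mult Const_arith(4) by (simp add: algebra_simps)
  have "(p - Const (ev b p)) * (q - Const (ev b q)) \<in> Z"
    using mult by (intro sq polys_diff) (auto simp: ev_hom)
  then show ?case unfolding l_def[symmetric] e
    by (rule poly_idealD(4)[OF Z _ poly_idealD(4)[OF Z poly_idealD(5)[OF Z] poly_idealD(5)[OF Z]]])
      (use mult in \<open>auto simp: l_def\<close>)
qed

text \<open>From the first order coefficients of p the part explained by the rows is subtracted. The
  difference is 0 for indices in \<open>T\<close> by \<open>diag\<close> and for p in
  \<open>J\<close> by \<open>spans\<close>; the indices outside \<open>T\<close> remain as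
  coordinates.\<close>

lemma point_coordinatesI:
  assumes PQ: "point_quotient V b J" and T: "T \<subseteq> V" and e: "e \<noteq> 0"
    and fJ: "\<And>t. t \<in> T \<Longrightarrow> f t \<in> J"
    and diag: "\<And>t t'. t \<in> T \<Longrightarrow> t' \<in> T \<Longrightarrow> dcoef b t' (f t) = (if t' = t then e else 0)"
    and spans: "\<And>p k. p \<in> J \<Longrightarrow> e * dcoef b k p = (\<Sum>t\<in>T. dcoef b t p * dcoef b k (f t))"
  shows "point_coordinates V b J (\<lambda>p k. dcoef b k p - (\<Sum>t\<in>T. dcoef b t p * dcoef b k (f t)) / e) (V - T)"
proof -
  interpret point_quotient V b J by fact
  have finT: "finite T" using T finite_V by (rule finite_subset)
  show ?thesis
  proof (rule point_coordinates.intro[OF PQ point_coordinates_axioms.intro])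
    fix p q k
    show "dcoef b k (p + q) - (\<Sum>t\<in>T. dcoef b t (p + q) * dcoef b k (f t)) / e =
        (dcoef b k p - (\<Sum>t\<in>T. dcoef b t p * dcoef b k (f t)) / e) + (dcoef b k q - (\<Sum>t\<in>T. dcoef b t q * dcoef b k (f t)) / e)"
      by (simp add: dcoef_hom distrib_right sum.distrib add_divide_distrib)
    have "(\<Sum>t\<in>T. dcoef b t (p * q) * dcoef b k (f t)) =
        ev b p * (\<Sum>t\<in>T. dcoef b t q * dcoef b k (f t)) + (\<Sum>t\<in>T. dcoef b t p * dcoef b k (f t)) * ev b q"
      unfolding sum_distrib_left sum_distrib_right sum.distrib[symmetric]
      by (rule sum.cong) (auto simp: dcoef_mult algebra_simps)
    then show "dcoef b k (p * q) - (\<Sum>t\<in>T. dcoef b t (p * q) * dcoef b k (f t)) / e =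
        ev b p * (dcoef b k q - (\<Sum>t\<in>T. dcoef b t q * dcoef b k (f t)) / e) + (dcoef b k p - (\<Sum>t\<in>T. dcoef b t p * dcoef b k (f t)) / e) * ev b q"
      by (simp add: dcoef_mult algebra_simps add_divide_distrib)
  next
    fix p k assume "p \<in> J"
    from spans[OF this, of k] show "dcoef b k p - (\<Sum>t\<in>T. dcoef b t p * dcoef b k (f t)) / e = 0"
      using e by (simp add: field_simps)
  next
    fix j k assume jk: "j \<in> V - T" "k \<in> V - T"
    have "(\<Sum>t\<in>T. dcoef b t (Var j) * dcoef b k (f t)) = 0" using jk by (intro sum.neutral) auto
    then show "dcoef b k (Var j) - (\<Sum>t\<in>T. dcoef b t (Var j) * dcoef b k (f t)) / e = (if j = k then 1 else 0)" by simp
  next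
    fix Z p
    assume Z: "poly_ideal V Z" and JZ: "J \<subseteq> Z"
      and sq: "\<And>p q. p \<in> polys V \<Longrightarrow> q \<in> polys V \<Longrightarrow> ev b p = 0 \<Longrightarrow> ev b q = 0 \<Longrightarrow> p * q \<in> Z"
      and p: "p \<in> polys V" "ev b p = 0"
      and d: "\<And>k. k \<in> V - T \<Longrightarrow> dcoef b k p - (\<Sum>t\<in>T. dcoef b t p * dcoef b k (f t)) / e = 0"
    let ?l = "\<lambda>p. \<Sum>j\<in>V. Const (dcoef b j p) * (Var j - Const (b j))"
    have l: "q - ?l q \<in> Z" if "q \<in> polys V" "ev b q = 0" for q
    proof -
      have "q - Const (ev b q) - ?l q \<in> Z"
        by (rule taylor_mod_square[OF finite_V Z _ that(1)]) (rule sq)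
      then show ?thesis unfolding that(2) by (simp only: Const_arith(1) diff_zero)
    qed
    have lf: "?l (f t) \<in> Z" if "t \<in> T" for t
    proof -
      have "f t - (f t - ?l (f t)) \<in> Z"
        using fJ[OF that] JZ J_sub ev_J by (intro poly_ideal_diff[OF Z] l) auto
      then show ?thesis by simp
    qed
    \<comment> \<open>When all coordinates of p vanish, its linear part is a combination of the
      linear parts of the rows, which lie in \<open>Z\<close>.\<close>
    have D: "dcoef b j p = (\<Sum>t\<in>T. dcoef b t p / e * dcoef b j (f t))" if "j \<in> V" for j
    proof (cases "j \<in> T")
      case True
      then have "(\<Sum>t\<in>T. dcoef b t p / e * dcoef b j (f t)) = (\<Sum>t\<in>T. if j = t then dcoef b j p else 0)"
        using e by (intro sum.cong) (auto simp: diag)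
      then show ?thesis using True finT by simp
    next
      case False
      then show ?thesis using d[of j] that by (simp add: sum_divide_distrib)
    qed
    have "?l p = (\<Sum>j\<in>V. \<Sum>t\<in>T. Const (dcoef b t p / e) * (Const (dcoef b j (f t)) * (Var j - Const (b j))))"
      by (rule sum.cong) (auto simp: D Const_sum Const_arith sum_distrib_right mult.assoc)
    also have "\<dots> = (\<Sum>t\<in>T. Const (dcoef b t p / e) * ?l (f t))"
      by (subst sum.swap) (simp add: sum_distrib_left)
    also have "\<dots> \<in> Z" by (rule poly_ideal_sum[OF Z], rule poly_idealD(5)[OF Z polys_Const], rule lf)
    finally have "(p - ?l p) + ?l p \<in> Z" using l[OF p] poly_idealD(4)[OF Z] by blast
    then show "p \<in> Z" by simp
  qed (auto)
qed

section \<open>Contraction of prime chains to a polynomial subring\<close>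

text \<open>After inverting \<open>h\<close>, the class of p modulo \<open>J\<close> comes from the
  subring in the indeterminates \<open>B\<close>.\<close>

definition reducible_mod :: "nat set \<Rightarrow> 'k::field mpoly \<Rightarrow> 'k mpoly set \<Rightarrow> 'k mpoly \<Rightarrow> bool" where
  "reducible_mod B h J p \<longleftrightarrow> (\<exists>N. \<exists>q\<in>polys B. h ^ N * p - q \<in> J)"

text \<open>Powers of \<open>h\<close> multiply, so reducible polynomials are closed under sums and
  products. The set \<open>V'\<close> may be smaller than \<open>V\<close>, for use within an
  induction where only some indeterminates have been treated.\<close>

lemma reducible_mod_subring:
  assumes J: "poly_ideal V J" and h: "h \<in> polys B" and BV: "B \<subseteq> V" and V': "V' \<subseteq> V"
    and Var: "\<And>i. i \<in> V' \<Longrightarrow> reducible_mod B h J (Var i)" and p: "p \<in> polys V'"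
  shows "reducible_mod B h J p"
  using p
proof (induction rule: polys_induct)
  case (Const c)
  show ?case unfolding reducible_mod_def using poly_idealD(3)[OF J]
    by (intro exI[of _ 0] bexI[of _ "Const c"]) auto
next
  case (add p p')
  then obtain N q N' q' where q: "q \<in> polys B" "h ^ N * p - q \<in> J" "q' \<in> polys B" "h ^ N' * p' - q' \<in> J"
    unfolding reducible_mod_def by blast
  have hV: "h \<in> polys V" using h BV by (rule polys_mono)
  have e: "h ^ (N + N') * (p + p') - (h ^ N' * q + h ^ N * q') = h ^ N' * (h ^ N * p - q) + h ^ N * (h ^ N' * p' - q')"
    by (simp add: algebra_simps power_add)
  have "h ^ (N + N') * (p + p') - (h ^ N' * q + h ^ N * q') \<in> J"
    unfolding e using q hV by (intro poly_idealD(4)[OF J poly_idealD(5)[OF J] poly_idealD(5)[OF J]]) auto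
  moreover have "h ^ N' * q + h ^ N * q' \<in> polys B" using q h by auto
  ultimately show ?case unfolding reducible_mod_def by blast
next
  case (mult p p')
  then obtain N q N' q' where q: "q \<in> polys B" "h ^ N * p - q \<in> J" "q' \<in> polys B" "h ^ N' * p' - q' \<in> J"
    unfolding reducible_mod_def by blast
  have V: "h \<in> polys V" "q \<in> polys V" "p' \<in> polys V" using h BV q mult V' by (auto intro: polys_mono)
  have e: "h ^ (N + N') * (p * p') - q * q' = (h ^ N' * p') * (h ^ N * p - q) + q * (h ^ N' * p' - q')"
    by (simp add: algebra_simps power_add)
  have "h ^ (N + N') * (p * p') - q * q' \<in> J"
    unfolding e using q V by (intro poly_idealD(4)[OF J poly_idealD(5)[OF J] poly_idealD(5)[OF J]]) auto
  moreover have "q * q' \<in> polys B" using q by auto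
  ultimately show ?case unfolding reducible_mod_def by blast
qed (rule Var)

lemma poly_prime_0: "poly_prime V {0}"
  by (auto simp: poly_prime_def poly_ideal_def)

lemma poly_prime_contract:
  assumes "poly_prime V Q" "B \<subseteq> V" shows "poly_prime B (Q \<inter> polys B)"
proof -
  have "p \<in> polys V" if "p \<in> polys B" for p :: "'a mpoly" using that assms(2) by (rule polys_mono)
  then show ?thesis using assms(1) unfolding poly_prime_def poly_ideal_def by (auto 4 3)
qed

text \<open>Inclusions stay strict: for x in \<open>P (Suc i)\<close> outside \<open>P i\<close>, a
  polynomial q in \<open>B\<close> congruent to \<open>h ^ N * x\<close> lies in the larger prime
  only, because \<open>h\<close> can be cancelled modulo the smaller one.\<close>

lemma prime_chain_contract:
  fixes P :: "nat \<Rightarrow> 'k::field mpoly set"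
  assumes V: "finite V" and BV: "B \<subseteq> V" and J: "poly_ideal V J"
    and red: "\<And>p. p \<in> polys V \<Longrightarrow> reducible_mod B h J p" and hB: "h \<in> polys B"
    and P: "\<And>i. i \<le> k \<Longrightarrow> poly_prime V (P i)" "\<And>i. i \<le> k \<Longrightarrow> J \<subseteq> P i" "\<And>i. i \<le> k \<Longrightarrow> h \<notin> P i"
    and chain: "\<And>i. i < k \<Longrightarrow> P i \<subset> P (Suc i)"
  shows "k \<le> card B" "k = card B \<Longrightarrow> g \<in> J \<Longrightarrow> g \<in> polys B \<Longrightarrow> g = 0"
proof -
  have finB: "finite B" using BV V by (rule finite_subset)
  have id: "poly_ideal V (P i)" if "i \<le> k" for i using P(1)[OF that] by (simp add: poly_prime_def)
  have strict: "P i \<inter> polys B \<subset> P (Suc i) \<inter> polys B" if i: "i < k" for i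
  proof -
    obtain x where x: "x \<in> P (Suc i)" "x \<notin> P i" using chain[OF i] by blast
    have xV: "x \<in> polys V" using x(1) poly_idealD(2)[OF id[of "Suc i"]] i by simp
    obtain N q where q: "q \<in> polys B" "h ^ N * x - q \<in> J" using red[OF xV] unfolding reducible_mod_def by blast
    have hV: "h \<in> polys V" using hB BV by (rule polys_mono)
    have "h ^ N * x - (h ^ N * x - q) \<in> P (Suc i)"
      by (rule poly_ideal_diff[OF id poly_idealD(5)[OF id]]) (use i q x hV P(2)[of "Suc i"] in auto)
    then have "q \<in> P (Suc i)" by simp
    moreover have "q \<notin> P i"
    proof
      assume "q \<in> P i"
      then have "(h ^ N * x - q) + q \<in> P i" using i q P(2)[of i] by (intro poly_idealD(4)[OF id]) auto
      then have "h ^ N * x \<in> P i" by simp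
      then have "x \<in> P i" using poly_prime_powerD[of V "P i" h x N] P(1)[of i] P(3)[of i] i hV xV by simp
      then show False using x by simp
    qed
    ultimately show ?thesis using q chain[OF i] by blast
  qed
  show "k \<le> card B"
    using finB by (rule prime_chain_length_le[of _ _ "\<lambda>i. P i \<inter> polys B"]) (use poly_prime_contract[OF P(1) BV] strict in auto)
  assume k: "k = card B" and g: "g \<in> J" "g \<in> polys B"
  show "g = 0"
  proof (rule ccontr)
    assume g0: "g \<noteq> 0"
    \<comment> \<open>The zero ideal is put in front of the contracted chain; \<open>g\<close> makes
      this first inclusion strict, and the chain becomes one step too long.\<close>
    define R where "R i = (case i of 0 \<Rightarrow> {0} | Suc j \<Rightarrow> P j \<inter> polys B)" for i
    have "Suc k \<le> card B"
    proof (rule prime_chain_length_le[OF finB, of _ R])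
      fix i assume "i \<le> Suc k"
      then show "poly_prime B (R i)"
        using poly_prime_contract[OF P(1) BV] poly_prime_0 by (cases i) (auto simp: R_def)
    next
      fix i assume i: "i < Suc k"
      show "R i \<subset> R (Suc i)"
      proof (cases i)
        case 0
        have "g \<in> P 0 \<inter> polys B" using g P(2)[of 0] by auto
        then show ?thesis using 0 g0 poly_idealD(3)[OF id[of 0]] by (auto simp: R_def)
      next
        case (Suc j)
        then show ?thesis using strict[of j] i by (simp add: R_def)
      qed
    qed
    then show False using k by simp
  qed
qed

section \<open>Spans in polynomial algebras\<close>

lemma module_poly_alg: "module class_ring (poly_alg V :: ('k::field, 'k mpoly) module)"
proof (rule moduleI)
  show "cring (class_ring :: 'k ring)" by (rule class_cring.cring_axioms)
  show "abelian_group (poly_alg V :: ('k, 'k mpoly) module)"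
    using cring_poly_alg cring.axioms(1) ring.is_abelian_group by blast
qed (auto simp: Const_arith algebra_simps)

lemma vectorspace_poly_alg: "vectorspace class_ring (poly_alg V :: ('k::field, 'k mpoly) module)"
  by (intro vectorspace.intro module_poly_alg class_field.field_axioms)

lemma finsum_poly_alg:
  assumes "finite A" "\<And>x. x \<in> A \<Longrightarrow> f x \<in> polys V"
  shows "finsum (poly_alg V) f A = sum f A"
proof -
  interpret cring "poly_alg V :: ('b, 'b mpoly) module" by (rule cring_poly_alg)
  show ?thesis using assms
    by (induction rule: finite_induct) (auto simp: finsum_insert)
qed

text \<open>The right-hand side does not depend on \<open>V\<close>, so a set of linear forms has
  the same span in P and in K[X^+].\<close>

lemma span_poly_alg:
  fixes S :: "'k::field mpoly set"
  assumes "S \<subseteq> polys V"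
  shows "LinearCombinations.module.span class_ring (poly_alg V) S =
    {\<Sum>v\<in>A. Const (a v) * v |a A. finite A \<and> A \<subseteq> S}"
proof -
  interpret Module.module class_ring "poly_alg V :: ('k, 'k mpoly) module" by (rule module_poly_alg)
  have "lincomb a A = (\<Sum>v\<in>A. Const (a v) * v)" if "finite A" "A \<subseteq> S" for a A
    unfolding lincomb_def using that assms by (subst finsum_poly_alg) auto
  then have "{lincomb a A |a A. finite A \<and> A \<subseteq> S \<and> a \<in> A \<rightarrow> carrier class_ring} =
      {\<Sum>v\<in>A. Const (a v) * v |a A. finite A \<and> A \<subseteq> S}"
    by (intro Collect_cong iff_exI) auto
  then show ?thesis unfolding span_def .
qed

lemma vectorspace_lin_space:
  assumes "lin_part b ` J \<subseteq> polys V"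
  shows "vectorspace class_ring (lin_space V b J)"
  unfolding lin_space_def
  using vectorspace.subspace_is_vs[OF vectorspace_poly_alg vectorspace.span_is_subspace[OF vectorspace_poly_alg assms]] .

section \<open>The fiber\<close>

lemma Var_neq_0 [simp]: "Var i \<noteq> (0 :: 'k::field mpoly)"
  by (metis Var_def lookup_single_eq lookup_zero zero_neq_one)

context point_quotient
begin

text \<open>Provides the member of \<open>primes_L\<close> that \<open>prime_dim_eqD\<close> asks
  for.\<close>

lemma M_prime: "M \<in> primes_L"
proof -
  have "poly_prime V M"
    unfolding poly_prime_def M_def using poly_ideal_ev_kernel[of V b] by (auto simp: ev_hom)
  moreover have "J \<subseteq> M" using J_sub ev_J by (auto simp: M_def)
  ultimately show ?thesis by (simp add: primes_L_def)
qed

end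

context graded_fiber
begin

section \<open>The specialization a = c: fiber ideal and linear parts\<close>

definition \<beta> :: "'k mpoly \<Rightarrow> 'k mpoly" where
  "\<beta> = poly_subst (\<lambda>i. if i < m then Const (b i) else Var i)"

lemma \<beta>_hom: "\<beta> (p + q) = \<beta> p + \<beta> q" "\<beta> (p * q) = \<beta> p * \<beta> q" "\<beta> (p - q) = \<beta> p - \<beta> q"
  "\<beta> (p ^ k) = \<beta> p ^ k" "\<beta> 0 = 0" "\<beta> 1 = 1" "\<beta> (Const a) = Const a"
  "\<beta> (Var i) = (if i < m then Const (b i) else Var i)"
  by (simp_all add: \<beta>_def poly_subst_hom)

lemma \<beta>_closed: "p \<in> polys {..<n} \<Longrightarrow> \<beta> p \<in> polys {m..<n}"
  unfolding \<beta>_def by (erule poly_subst_closed) auto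

lemma \<beta>_id: "p \<in> polys {m..<n} \<Longrightarrow> \<beta> p = p"
  unfolding \<beta>_def by (erule poly_subst_id) auto

lemma \<beta>_base: "p \<in> polys {..<m} \<Longrightarrow> \<beta> p = Const (ev b p)"
  by (induction rule: polys_induct) (auto simp: \<beta>_hom ev_hom Const_arith)

lemma ev_\<beta>: "ev (\<lambda>_. 0) (\<beta> p) = ev b p"
proof -
  have "p \<in> polys UNIV" by simp
  then show ?thesis by (induction rule: polys_induct) (auto simp: \<beta>_hom ev_hom b0)
qed

lemma dcoef_\<beta>: "dcoef (\<lambda>_. 0) k (\<beta> p) = (if k < m then 0 else dcoef b k p)"
proof -
  have "p \<in> polys UNIV" by simp
  then show ?thesis by (induction rule: polys_induct) (auto simp: \<beta>_hom dcoef_hom ev_\<beta>)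
qed

lemma polys_fiber_mono: "p \<in> polys {m..<n} \<Longrightarrow> p \<in> polys {..<n}"
  by (erule polys_mono) auto

lemma \<beta>_surj: "\<beta> ` polys {..<n} = polys {m..<n}"
proof
  show "polys {m..<n} \<subseteq> \<beta> ` polys {..<n}"
  proof
    fix p :: "'k mpoly" assume "p \<in> polys {m..<n}"
    then show "p \<in> \<beta> ` polys {..<n}" using \<beta>_id[of p] polys_fiber_mono[of p] by (metis imageI)
  qed
qed (use \<beta>_closed in auto)

text \<open>K[X^+] is a subring of P fixed by \<open>\<beta>\<close>, so a multiplier in K[X^+]
  lifts to itself.\<close>

lemma ideal_fiber: "poly_ideal {m..<n} (\<beta> ` I)"
  unfolding poly_ideal_def
proof (intro conjI ballI)
  show "\<beta> ` I \<subseteq> polys {m..<n}" using \<beta>_closed I_subset by auto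
  show "0 \<in> \<beta> ` I" using poly_idealD(3)[OF ideal_I] \<beta>_hom(5) by (metis imageI)
  fix p q assume "p \<in> \<beta> ` I" "q \<in> \<beta> ` I"
  then show "p + q \<in> \<beta> ` I" using poly_idealD(4)[OF ideal_I] \<beta>_hom(1) by (auto simp: image_iff) metis
next
  fix p q :: "'k mpoly" assume p: "p \<in> polys {m..<n}" and "q \<in> \<beta> ` I"
  then obtain g where g: "g \<in> I" "q = \<beta> g" by auto
  have "p * q = \<beta> (p * g)" using g p by (simp add: \<beta>_hom \<beta>_id)
  moreover have "p * g \<in> I" using g p by (intro poly_idealD(5)[OF ideal_I] polys_fiber_mono)
  ultimately show "p * q \<in> \<beta> ` I" by blast
qed

text \<open>The homogeneous components have only columns x_j and remainders of second order. Hence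
  linear parts of I have no component along the a_i, the directions that \<open>\<beta>\<close>
  would destroy.\<close>

lemma I_dcoef_base:
  assumes "p \<in> I" "k < m" shows "dcoef b k p = 0"
proof -
  have "dcoef b k (hom_comp W d p) = 0" if d: "d > 0" for d
  proof -
    obtain g r where "\<forall>j. g j \<in> polys {..<m}" "r \<in> higher d" "hom_comp W d p = (\<Sum>j\<in>X_deg d. g j * Var j) + r"
      using hom_comp_form[OF I_subset[OF assms(1)] d] by blast
    then show ?thesis using form_ev(2)[of g r d "X_deg d" k] assms(2) by (simp add: X_deg_def)
  qed
  then have "dcoef b k (\<Sum>d\<in>wdeg W ` Poly_Mapping.keys p - {0}. hom_comp W d p) = 0"
    using I_sum_hom_comp(2)[OF assms(1)] by (simp add: dcoef_sum)
  then show ?thesis using I_sum_hom_comp(1)[OF assms(1)] by simp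
qed

lemma lin_part_fiber:
  assumes p: "p \<in> I"
  shows "lin_part (\<lambda>_. 0) (\<beta> p) = lin_part b p" "lin_part b p \<in> polys {m..<n}"
proof -
  have "lin_part b p = (\<Sum>j\<in>{..<n}. Const (dcoef b j p) * (Var j - Const (b j)))"
    using I_subset[OF p] by (intro lin_part_eq) auto
  also have "\<dots> = (\<Sum>j\<in>{m..<n}. Const (dcoef b j p) * Var j)"
    using I_dcoef_base[OF p] by (intro sum.mono_neutral_cong_right) (auto simp: b0 Const_arith)
  finally have e: "lin_part b p = (\<Sum>j\<in>{m..<n}. Const (dcoef b j p) * Var j)" .
  then show "lin_part b p \<in> polys {m..<n}" by (auto intro!: polys_sum polys_mult)
  have "lin_part (\<lambda>_. 0) (\<beta> p) = (\<Sum>j\<in>{m..<n}. Const (dcoef (\<lambda>_. 0) j (\<beta> p)) * (Var j - Const 0))"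
    using \<beta>_closed[OF I_subset[OF p]] by (intro lin_part_eq) auto
  then show "lin_part (\<lambda>_. 0) (\<beta> p) = lin_part b p"
    unfolding e by (simp add: dcoef_\<beta> Const_arith)
qed

lemma lin_spaces:
  "carrier (lin_space {..<n} b I) = carrier (lin_space {m..<n} (\<lambda>_. 0) (\<beta> ` I))"
  "carrier (lin_space {..<n} b I) \<subseteq> polys {m..<n}"
  "vectorspace class_ring (lin_space {..<n} b I)"
  "vectorspace class_ring (lin_space {m..<n} (\<lambda>_. 0) (\<beta> ` I))"
proof -
  have im: "lin_part (\<lambda>_. 0) ` \<beta> ` I = lin_part b ` I"
    using lin_part_fiber(1) by (auto simp: image_image)
  have sub: "lin_part b ` I \<subseteq> polys {m..<n}" using lin_part_fiber(2) by auto
  then have sub': "lin_part b ` I \<subseteq> polys {..<n}" using polys_fiber_mono by auto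
  show "vectorspace class_ring (lin_space {..<n} b I)" by (rule vectorspace_lin_space[OF sub'])
  show "vectorspace class_ring (lin_space {m..<n} (\<lambda>_. 0) (\<beta> ` I))"
    by (rule vectorspace_lin_space) (use sub im in simp)
  have 1: "carrier (lin_space {..<n} b I) = {\<Sum>v\<in>A. Const (a v) * v |a A. finite A \<and> A \<subseteq> lin_part b ` I}"
    by (simp add: lin_space_def span_poly_alg[OF sub'])
  have 2: "carrier (lin_space {m..<n} (\<lambda>_. 0) (\<beta> ` I)) = {\<Sum>v\<in>A. Const (a v) * v |a A. finite A \<and> A \<subseteq> lin_part b ` I}"
    by (simp add: lin_space_def im span_poly_alg[OF sub])
  show "carrier (lin_space {..<n} b I) = carrier (lin_space {m..<n} (\<lambda>_. 0) (\<beta> ` I))" unfolding 1 2 ..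
  show "carrier (lin_space {..<n} b I) \<subseteq> polys {m..<n}"
    unfolding 1 using sub by (auto intro!: polys_sum polys_mult)
qed

text \<open>The two spaces of linear parts are the same set of linear forms in the x_j, and
  \<open>\<beta>\<close> restricts to the identity on it.\<close>

lemma linear_iso:
  "linear_map class_ring (lin_space {..<n} b I) (lin_space {m..<n} (\<lambda>_. 0) (\<beta> ` I)) \<beta>"
  "bij_betw \<beta> (carrier (lin_space {..<n} b I)) (carrier (lin_space {m..<n} (\<lambda>_. 0) (\<beta> ` I)))"
  "f \<in> I \<Longrightarrow> \<beta> (lin_part b f) = lin_part (\<lambda>_. 0) (\<beta> f)"
proof -
  let ?L = "lin_space {..<n} b I" and ?L' = "lin_space {m..<n} (\<lambda>_. 0) (\<beta> ` I)"
  have id: "\<beta> v = v" if "v \<in> carrier ?L" for v using that lin_spaces(2) \<beta>_id by auto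
  show "bij_betw \<beta> (carrier ?L) (carrier ?L')"
    using id lin_spaces(1) by (auto simp: bij_betw_def inj_on_def image_iff)
  show "linear_map class_ring ?L ?L' \<beta>"
  proof (intro linear_map.intro mod_hom.intro mod_hom_axioms.intro lin_spaces vectorspace.axioms(1))
    have ops: "add ?L = (+)" "add ?L' = (+)" "c \<odot>\<^bsub>?L\<^esub> v = Const c * v" "c \<odot>\<^bsub>?L'\<^esub> v = Const c * v" for c v
      by (simp_all add: lin_space_def)
    have "\<beta> \<in> carrier ?L \<rightarrow> carrier ?L'" using id unfolding lin_spaces(1) by auto
    then show "\<beta> \<in> LinearCombinations.module_hom class_ring ?L ?L'"
      unfolding LinearCombinations.module_hom_def ops by (simp add: \<beta>_hom)
  qed
  show "\<beta> (lin_part b f) = lin_part (\<lambda>_. 0) (\<beta> f)" if "f \<in> I"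
    using lin_part_fiber[OF that] by (simp add: \<beta>_id)
qed

end

locale echelon_fiber = graded_fiber m n W b I
  for m n W and b :: "nat \<Rightarrow> 'k::field" and I +
  fixes T :: "nat set" and h :: "'k mpoly" and f :: "nat \<Rightarrow> 'k mpoly"
  assumes ech: "echelon T h f" and max: "\<And>T' h' f'. echelon T' h' f' \<Longrightarrow> card T' \<le> card T"
begin

definition "S = {m..<n} - T"
definition "B = {..<m} \<union> S"

lemma T_sub: "T \<subseteq> {m..<n}" and h_base: "h \<in> polys {..<m}" and ev_h: "ev b h \<noteq> 0"
  using ech by (auto simp: echelon_def)

lemma fin: "finite T" "finite S" "finite B"
  using finite_subset[OF T_sub] by (auto simp: S_def B_def)

lemma B_eq: "{..<n} - T = B" and B_sub: "B \<subseteq> {..<n}" and S_sub: "S \<subseteq> {m..<n}" "S \<subseteq> B" and h_B: "h \<in> polys B"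
  using T_sub m_le_n polys_mono[OF h_base, of B] by (auto simp: B_def S_def)

lemma card_B: "card B = m + card S"
  unfolding B_def using fin by (subst card_Un_disjoint) (auto simp: S_def)

lemma spans: "p \<in> I \<Longrightarrow> ev b h * dcoef b k p = (\<Sum>t\<in>T. dcoef b t p * dcoef b k (f t))"
  by (rule echelon_spans[OF ech max])

lemma pq_total: "point_quotient {..<n} b I"
  by unfold_locales (auto simp: ideal_I I_ev)

lemma pq_fiber: "point_quotient {m..<n} (\<lambda>_. 0) (\<beta> ` I)"
  by unfold_locales (auto simp: ideal_fiber I_ev ev_\<beta>)

text \<open>One system of rows serves both rings, since \<open>\<beta>\<close> keeps first order
  coefficients along the x_j. The cotangent coordinates are indexed by \<open>B\<close> for the
  total ring and by \<open>S\<close> for the fiber, which differ by the m indices of the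
  a_i.\<close>

sublocale PA: point_coordinates "{..<n}" b I
  "\<lambda>p k. dcoef b k p - (\<Sum>t\<in>T. dcoef b t p * dcoef b k (f t)) / ev b h" B
  unfolding B_eq[symmetric]
proof (rule point_coordinatesI[OF pq_total _ ev_h])
  show "T \<subseteq> {..<n}" using T_sub by auto
qed (use echelon_row[OF ech] spans in auto)

sublocale PF: point_coordinates "{m..<n}" "\<lambda>_. 0" "\<beta> ` I"
  "\<lambda>p k. dcoef (\<lambda>_. 0) k p - (\<Sum>t\<in>T. dcoef (\<lambda>_. 0) t p * dcoef (\<lambda>_. 0) k (\<beta> (f t))) / ev b h" S
  unfolding S_def
proof (rule point_coordinatesI[OF pq_fiber T_sub ev_h])
  fix t t' assume "t \<in> T" "t' \<in> T"
  then show "dcoef (\<lambda>_. 0) t' (\<beta> (f t)) = (if t' = t then ev b h else 0)"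
    using echelon_row(3)[OF ech] T_sub by (auto simp: dcoef_\<beta>)
next
  fix p k assume "p \<in> \<beta> ` I"
  then obtain g where g: "g \<in> I" "p = \<beta> g" by auto
  have "dcoef (\<lambda>_. 0) t p = dcoef b t g" if "t \<in> T" for t using that T_sub g by (auto simp: dcoef_\<beta>)
  then show "ev b h * dcoef (\<lambda>_. 0) k p = (\<Sum>t\<in>T. dcoef (\<lambda>_. 0) t p * dcoef (\<lambda>_. 0) k (\<beta> (f t)))"
    using spans[OF g(1), of k] by (simp add: dcoef_\<beta> g(2))
qed (use echelon_row(1)[OF ech] in auto)

lemma dim_cotangent: "vectorspace.dim class_ring (cotangent PF.A PF.mA) + m = vectorspace.dim class_ring (cotangent PA.A PA.mA)"
  by (simp add: PA.dim_cotangent_A PF.dim_cotangent_A card_B)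

text \<open>By induction on the degree of the indeterminate: the row rewrites
  \<open>h * Var i\<close> by terms whose indeterminates in \<open>T\<close> have smaller degree.
  Any ideal containing the rows is allowed; \<open>fiber_killed\<close> applies the lemma to an
  ideal inside I.\<close>

lemma reducible_total:
  assumes J: "poly_ideal {..<n} J" and fJ: "\<And>t. t \<in> T \<Longrightarrow> f t \<in> J" and p: "p \<in> polys {..<n}"
  shows "reducible_mod B h J p"
proof (rule reducible_mod_subring[OF J h_B B_sub subset_refl _ p])
  fix i assume "i \<in> {..<n}"
  then show "reducible_mod B h J (Var i)"
  proof (induction "nat (W i)" arbitrary: i rule: less_induct)
    case less
    show ?case
    proof (cases "i \<in> T")
      case False
      then have "Var i \<in> polys B" using less.prems B_eq by auto
      then show ?thesis unfolding reducible_mod_def using poly_idealD(3)[OF J]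
        by (intro exI[of _ 0] bexI[of _ "Var i"]) auto
    next
      case True
      obtain \<psi> where \<psi>: "\<psi> \<in> polys ({..<m} \<union> ({m..<n} - T) \<union> {j \<in> {m..<n}. W j < W i})" "f i = h * Var i + \<psi>"
        using echelon_row(2)[OF ech True] by blast
      have "reducible_mod B h J \<psi>"
      proof (rule reducible_mod_subring[OF J h_B B_sub _ _ \<psi>(1)])
        fix j assume j: "j \<in> {..<m} \<union> ({m..<n} - T) \<union> {j \<in> {m..<n}. W j < W i}"
        show "reducible_mod B h J (Var j)"
        proof (cases "j \<in> B")
          case True
          then show ?thesis unfolding reducible_mod_def using poly_idealD(3)[OF J]
            by (intro exI[of _ 0] bexI[of _ "Var j"]) auto
        next
          case False
          then have "j \<in> {m..<n}" "W j < W i" using j by (auto simp: B_def S_def)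
          then show ?thesis using less.hyps[of j] Wpos[of j] by auto
        qed
      qed (use m_le_n in auto)
      then obtain N q where q: "q \<in> polys B" "h ^ N * \<psi> - q \<in> J" unfolding reducible_mod_def by blast
      have hV: "h \<in> polys {..<n}" using h_B B_sub by (rule polys_mono)
      have e: "h ^ Suc N * Var i - (- q) = h ^ N * f i - (h ^ N * \<psi> - q)"
        by (simp add: \<psi>(2) algebra_simps)
      have "h ^ Suc N * Var i - (- q) \<in> J"
        unfolding e by (rule poly_ideal_diff[OF J poly_idealD(5)[OF J]]) (use hV fJ[OF True] q in auto)
      moreover have "- q \<in> polys B" using q by auto
      ultimately show ?thesis unfolding reducible_mod_def by blast
    qed
  qed
qed

text \<open>Specialization turns \<open>h\<close> into the nonzero constant h(c), which can be
  divided out. The multiplier is therefore 1, which no prime contains.\<close>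

lemma reducible_fiber:
  assumes "p \<in> polys {m..<n}"
  shows "reducible_mod S 1 (\<beta> ` I) p"
proof -
  obtain N q where q: "q \<in> polys B" "h ^ N * p - q \<in> I"
    using reducible_total[OF ideal_I echelon_row(1)[OF ech] polys_fiber_mono[OF assms]]
    unfolding reducible_mod_def by blast
  have "\<beta> (h ^ N * p - q) \<in> \<beta> ` I" using q(2) by (rule imageI)
  moreover have "\<beta> (h ^ N * p - q) = Const (ev b h ^ N) * p - \<beta> q"
    by (simp only: \<beta>_hom(2-4) \<beta>_id[OF assms] \<beta>_base[OF h_base] Const_power)
  ultimately have "Const (ev b h ^ N) * p - \<beta> q \<in> \<beta> ` I" by (simp only:)
  then have "Const (inverse (ev b h ^ N)) * (Const (ev b h ^ N) * p - \<beta> q) \<in> \<beta> ` I"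
    by (rule poly_idealD(5)[OF ideal_fiber polys_Const])
  moreover have "Const (inverse (ev b h ^ N)) * (Const (ev b h ^ N) * p - \<beta> q) =
      1 ^ 0 * p - Const (inverse (ev b h ^ N)) * \<beta> q"
  proof -
    have "Const (inverse (ev b h ^ N)) * Const (ev b h ^ N) = 1"
      using ev_h by (simp flip: Const_arith)
    then have "Const (inverse (ev b h ^ N)) * (Const (ev b h ^ N) * p) = p"
      by (simp only: mult.assoc[symmetric] mult_1_left)
    then show ?thesis by (simp only: right_diff_distrib power_0 mult_1_left)
  qed
  ultimately have 1: "1 ^ 0 * p - Const (inverse (ev b h ^ N)) * \<beta> q \<in> \<beta> ` I" by (simp only:)
  have "\<beta> q \<in> polys S"
    unfolding \<beta>_def using q(1) by (rule poly_subst_closed) (auto simp: B_def S_def)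
  then have "Const (inverse (ev b h ^ N)) * \<beta> q \<in> polys S" by (rule polys_mult[OF polys_Const])
  with 1 show ?thesis unfolding reducible_mod_def by blast
qed

text \<open>The primes of an optimal chain lie in \<open>PA.M\<close> and avoid \<open>h\<close>,
  since h(c) \<noteq> 0; the equality case of \<open>prime_chain_contract\<close> applies.\<close>

lemma total_regular_imp:
  assumes "enat (card B) = prime_dim PA.primes_L"
  shows "I \<inter> polys B = {0}"
proof -
  obtain P where P: "\<And>i. i \<le> card B \<Longrightarrow> P i \<in> PA.primes_L" "\<And>i. i < card B \<Longrightarrow> P i \<subset> P (Suc i)"
    using prime_dim_eqD[OF assms[symmetric]] PA.M_prime by blast
  have "g = 0" if "g \<in> I" "g \<in> polys B" for g
  proof (rule prime_chain_contract(2)[where V = "{..<n}" and B = B and J = I and h = h and P = P and k = "card B"])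
    fix i assume "i \<le> card B"
    from P(1)[OF this] show "poly_prime {..<n} (P i)" "I \<subseteq> P i" "h \<notin> P i"
      using ev_h by (auto simp: PA.primes_L_def PA.M_def)
  qed (use B_sub ideal_I h_B P(2) that reducible_total[OF ideal_I echelon_row(1)[OF ech]] in auto)
  then show ?thesis using poly_idealD(3)[OF ideal_I] by auto
qed

text \<open>Stated for all primes over the fiber ideal and not only those at the origin, so that it
  also bounds the dimension of the whole fiber.\<close>

lemma fiber_chain:
  assumes P: "\<And>i. i \<le> k \<Longrightarrow> P i \<in> PF.primes_A" "\<And>i. i < k \<Longrightarrow> P i \<subset> P (Suc i)"
  shows "k \<le> card S" "k = card S \<Longrightarrow> g \<in> \<beta> ` I \<Longrightarrow> g \<in> polys S \<Longrightarrow> g = 0"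
proof -
  have P': "poly_prime {m..<n} (P i)" "\<beta> ` I \<subseteq> P i" "1 \<notin> P i" if "i \<le> k" for i
    using P(1)[OF that] by (auto simp: PF.primes_A_def poly_prime_def)
  note contract = prime_chain_contract[where V = "{m..<n}" and B = S and J = "\<beta> ` I" and h = 1 and P = P and k = k]
  show "k \<le> card S"
    by (rule contract(1)) (use S_sub ideal_fiber reducible_fiber P' P(2) in auto)
  assume "k = card S" "g \<in> \<beta> ` I" "g \<in> polys S"
  then show "g = 0"
    by (intro contract(2)) (use S_sub ideal_fiber reducible_fiber P' P(2) in auto)
qed

text \<open>The solution is the limit of the iteration \<open>x\<^sub>t := - \<psi>\<^sub>t(c, x) / h(c)\<close>; after \<open>k\<close> steps it is
  stationary in degrees up to \<open>k\<close>.\<close>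

lemma triangular_solution:
  obtains \<sigma> where "\<And>s. s \<in> S \<Longrightarrow> \<sigma> s = Var s" "\<And>i. \<sigma> i \<in> polys S" "\<And>i. ev (\<lambda>_. 0) (\<sigma> i) = 0"
    "\<And>t. t \<in> T \<Longrightarrow> poly_subst \<sigma> (\<beta> (f t)) = 0"
proof -
  have "\<forall>t\<in>T. \<exists>\<psi>. \<psi> \<in> polys ({..<m} \<union> S \<union> {j \<in> {m..<n}. W j < W t}) \<and> f t = h * Var t + \<psi>"
    using echelon_row(2)[OF ech] unfolding S_def by blast
  from bchoice[OF this] obtain \<psi> where
    \<psi>: "\<And>t. t \<in> T \<Longrightarrow> \<psi> t \<in> polys ({..<m} \<union> S \<union> {j \<in> {m..<n}. W j < W t})" "\<And>t. t \<in> T \<Longrightarrow> f t = h * Var t + \<psi> t"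
    by blast
  let ?e = "ev b h"
  define next' where "next' \<sigma> i = (if i \<in> S then Var i else if i \<in> T then - (Const (inverse ?e) * poly_subst \<sigma> (\<beta> (\<psi> i))) else 0)"
    for \<sigma> :: "nat \<Rightarrow> 'k mpoly" and i
  define \<sigma> where "\<sigma> k = (next' ^^ k) (\<lambda>i. if i \<in> S then Var i else 0)" for k
  have \<sigma>_Suc: "\<sigma> (Suc k) = next' (\<sigma> k)" for k by (simp add: \<sigma>_def)
  have S: "\<sigma> k s = Var s" if "s \<in> S" for k s
    using that by (cases k) (simp_all add: \<sigma>_Suc next'_def \<sigma>_def)
  have \<beta>\<psi>: "\<beta> (\<psi> t) \<in> polys (S \<union> {j \<in> {m..<n}. W j < W t})" if "t \<in> T" for t
    unfolding \<beta>_def using \<psi>(1)[OF that] by (rule poly_subst_closed) auto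
  have closed: "\<sigma> k i \<in> polys S" for k i
  proof (induction k arbitrary: i)
    case (Suc k)
    then have "poly_subst (\<sigma> k) (\<beta> (\<psi> t)) \<in> polys S" if "t \<in> T" for t
      using \<beta>\<psi>[OF that] by (intro poly_subst_closed)
    then show ?case by (auto simp: \<sigma>_Suc next'_def)
  qed (simp add: \<sigma>_def)
  \<comment> \<open>The right-hand sides have no constant term, so every iterate, and with it the
    solution, fixes the origin.\<close>
  have ev\<psi>: "ev (\<lambda>_. 0) (\<beta> (\<psi> t)) = 0" if "t \<in> T" for t
  proof -
    have "ev b (f t) = 0" using echelon_row(1)[OF ech that] by (rule I_ev)
    moreover have "b t = 0" using that T_sub b0 by auto
    ultimately show ?thesis using \<psi>(2)[OF that] by (simp add: ev_\<beta> ev_hom)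
  qed
  have ev: "ev (\<lambda>_. 0) (\<sigma> k i) = 0" for k i
  proof (induction k arbitrary: i)
    case (Suc k)
    have "ev (\<lambda>_. 0) (poly_subst (\<sigma> k) (\<beta> (\<psi> i))) = 0" if "i \<in> T"
      using ev_poly_subst_origin[of "\<sigma> k" "\<beta> (\<psi> i)"] Suc.IH ev\<psi>[OF that] by simp
    then show ?case by (simp add: \<sigma>_Suc next'_def ev_hom)
  qed (simp add: \<sigma>_def)
  \<comment> \<open>A value in degree at most k + 1 depends only on values in degrees at most k,
    which are stationary one step earlier. No indeterminate in \<open>T\<close> has degree 0, which
    starts the induction.\<close>
  have stable: "\<sigma> (Suc k) t = \<sigma> k t" if "t \<in> T" "W t \<le> int k" for k t
    using that
  proof (induction k arbitrary: t)
    case 0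
    then show ?case using Wpos[of t] T_sub by auto
  next
    case (Suc k)
    have "poly_subst (\<sigma> (Suc k)) (\<beta> (\<psi> t)) = poly_subst (\<sigma> k) (\<beta> (\<psi> t))"
    proof (rule poly_subst_cong[OF \<beta>\<psi>[OF Suc.prems(1)]])
      fix i assume i: "i \<in> S \<union> {j \<in> {m..<n}. W j < W t}"
      show "\<sigma> (Suc k) i = \<sigma> k i"
      proof (cases "i \<in> S")
        case False
        then have "i \<in> T" "W i < W t" using i by (auto simp: S_def)
        then show ?thesis using Suc.prems(2) by (intro Suc.IH) auto
      qed (simp add: S)
    qed
    then show ?case by (simp add: \<sigma>_Suc[of "Suc k"] \<sigma>_Suc[of k] next'_def)
  qed
  obtain N where N: "\<And>t. t \<in> T \<Longrightarrow> W t \<le> int N"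
  proof -
    \<comment> \<open>The sum bounds every degree and also covers the case of empty
      \<open>T\<close>.\<close>
    have "W t \<le> int (\<Sum>t\<in>T. nat (W t))" if "t \<in> T" for t
      using member_le_sum[of t T "\<lambda>t. nat (W t)"] that fin(1) nat_le_iff by blast
    then show ?thesis using that by blast
  qed
  show ?thesis
  proof (rule that[of "\<sigma> N"])
    fix t assume t: "t \<in> T"
    then have "\<sigma> N t = - (Const (inverse ?e) * poly_subst (\<sigma> N) (\<beta> (\<psi> t)))"
      using stable[OF t N[OF t]] by (simp add: \<sigma>_Suc next'_def S_def)
    moreover have "\<not> t < m" using t T_sub by auto
    ultimately have "poly_subst (\<sigma> N) (\<beta> (f t)) = poly_subst (\<sigma> N) (\<beta> (\<psi> t)) - (Const ?e * Const (inverse ?e)) * poly_subst (\<sigma> N) (\<beta> (\<psi> t))"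
      by (simp add: \<psi>(2)[OF t] \<beta>_hom \<beta>_base[OF h_base] poly_subst_hom mult.assoc)
    also have "Const ?e * Const (inverse ?e) = 1" using ev_h by (simp flip: Const_arith)
    finally show "poly_subst (\<sigma> N) (\<beta> (f t)) = 0" by simp
  qed (use S closed ev in auto)
qed

text \<open>The reduction is done modulo the killed elements rather than modulo I. Its remainder
  then lies in I \<inter> B = 0, so \<open>h ^ N * p\<close> itself is killed, and
  \<open>h ^ N\<close> specializes to a nonzero constant.\<close>

lemma fiber_killed:
  assumes IB: "I \<inter> polys B = {0}" and \<sigma>: "\<And>t. t \<in> T \<Longrightarrow> poly_subst \<sigma> (\<beta> (f t)) = 0" and g: "g \<in> \<beta> ` I"
  shows "poly_subst \<sigma> g = 0"
proof -
  let ?J = "{p \<in> I. poly_subst \<sigma> (\<beta> p) = 0}"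
  have J: "poly_ideal {..<n} ?J"
    using ideal_I I_subset unfolding poly_ideal_def by (auto simp: \<beta>_hom poly_subst_hom)
  obtain p where p: "p \<in> I" "g = \<beta> p" using g by auto
  obtain N q where q: "q \<in> polys B" "h ^ N * p - q \<in> ?J"
    using reducible_total[OF J _ I_subset[OF p(1)]] echelon_row(1)[OF ech] \<sigma> unfolding reducible_mod_def by blast
  have hV: "h \<in> polys {..<n}" using h_B B_sub by (rule polys_mono)
  have "h ^ N * p - (h ^ N * p - q) \<in> I"
    by (rule poly_ideal_diff[OF ideal_I poly_idealD(5)[OF ideal_I]]) (use hV p q in auto)
  then have "q = 0" using IB q(1) by auto
  then have "poly_subst \<sigma> (\<beta> (h ^ N * p)) = 0" using q(2) by simp
  then have "Const (ev b h ^ N) * poly_subst \<sigma> g = 0"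
    by (simp add: \<beta>_hom \<beta>_base[OF h_base] poly_subst_hom p(2) Const_power)
  then show ?thesis using ev_h by simp
qed

text \<open>The upper bound is \<open>fiber_chain\<close>. For the lower bound, \<open>P k\<close>
  is the kernel of the solution followed by killing the first k free indeterminates: it is prime as
  the kernel of a map into a domain, and lies in \<open>PF.M\<close> as the map fixes the
  origin.\<close>

lemma fiber_dim:
  assumes IB: "I \<inter> polys B = {0}"
  shows "prime_dim PF.primes_L = enat (card S)" "prime_dim PF.primes_A = enat (card S)"
proof -
  obtain \<sigma> where \<sigma>: "\<And>s. s \<in> S \<Longrightarrow> \<sigma> s = Var s" "\<And>i. \<sigma> i \<in> polys S" "\<And>i. ev (\<lambda>_. 0) (\<sigma> i) = 0"
    "\<And>t. t \<in> T \<Longrightarrow> poly_subst \<sigma> (\<beta> (f t)) = 0" by (rule triangular_solution) blast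
  obtain enum where enum: "bij_betw enum {0..<card S} S" using ex_bij_betw_nat_finite[OF fin(2)] by blast
  define \<zeta> :: "nat \<Rightarrow> nat \<Rightarrow> 'k mpoly" where "\<zeta> k i = (if i \<in> enum ` {..<k} then 0 else Var i)" for k i
  define \<tau> where "\<tau> k i = poly_subst (\<zeta> k) (\<sigma> i)" for k i
  define P where "P k = {p \<in> polys {m..<n}. poly_subst (\<tau> k) p = 0}" for k
  have \<tau>: "poly_subst (\<tau> k) p = poly_subst (\<zeta> k) (poly_subst \<sigma> p)" for k p
    unfolding poly_subst_poly_subst by (rule arg_cong[of _ _ "\<lambda>\<rho>. poly_subst \<rho> p"]) (simp add: \<tau>_def fun_eq_iff)
  have PL: "P k \<in> PF.primes_L" for k
  proof -
    have "poly_prime {m..<n} (P k)"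
      unfolding poly_prime_def poly_ideal_def P_def by (auto simp: poly_subst_hom)
    moreover have "\<beta> ` I \<subseteq> P k"
      using fiber_killed[OF IB \<sigma>(4)] poly_idealD(2)[OF ideal_fiber] by (auto simp: P_def \<tau>)
    moreover have "P k \<subseteq> PF.M"
    proof
      fix p assume p: "p \<in> P k"
      have "ev (\<lambda>_. 0) (\<tau> k i) = 0" for i
        unfolding \<tau>_def using \<sigma>(3) by (subst ev_poly_subst_origin) (auto simp: \<zeta>_def)
      then have "ev (\<lambda>_. 0) (poly_subst (\<tau> k) p) = ev (\<lambda>_. 0) p" by (rule ev_poly_subst_origin)
      then show "p \<in> PF.M" using p by (simp add: P_def PF.M_def)
    qed
    ultimately show ?thesis by (simp add: PF.primes_L_def)
  qed
  have sub: "PF.primes_L \<subseteq> PF.primes_A" by (auto simp: PF.primes_L_def PF.primes_A_def)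
  have strict: "P k \<subset> P (Suc k)" if k: "k < card S" for k
  proof -
    have inj: "inj_on enum {0..<card S}" and im: "enum ` {0..<card S} = S"
      using enum by (auto simp: bij_betw_def)
    have "enum k \<noteq> enum i" if "i < k" for i using inj_onD[OF inj, of k i] that k by auto
    then have e: "enum k \<in> S" "enum k \<notin> enum ` {..<k}" using im k by auto
    \<comment> \<open>Killing k + 1 indeterminates factors through killing k of them, so the kernels
      increase.\<close>
    have z: "(\<lambda>i. poly_subst (\<zeta> (Suc k)) (\<zeta> k i)) = \<zeta> (Suc k)"
      by (auto simp: \<zeta>_def lessThan_Suc fun_eq_iff)
    have "poly_subst (\<tau> (Suc k)) p = poly_subst (\<zeta> (Suc k)) (poly_subst (\<tau> k) p)" for p
      unfolding \<tau> poly_subst_poly_subst[of "\<zeta> (Suc k)" "\<zeta> k"] z ..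
    then have "P k \<subseteq> P (Suc k)" by (auto simp: P_def)
    moreover have "Var (enum k) \<in> P (Suc k)" "Var (enum k) \<notin> P k"
      using e S_sub(1) \<sigma>(1) by (auto simp: P_def \<tau> \<zeta>_def)
    ultimately show ?thesis by blast
  qed
  show "prime_dim PF.primes_A = enat (card S)"
  proof (rule prime_dim_eqI[of _ P])
    show "l \<le> card S" if "\<And>i. i \<le> l \<Longrightarrow> P' i \<in> PF.primes_A" "\<And>i. i < l \<Longrightarrow> P' i \<subset> P' (Suc i)" for l P'
      using that by (rule fiber_chain(1))
  qed (use PL sub strict in auto)
  show "prime_dim PF.primes_L = enat (card S)"
  proof (rule prime_dim_eqI[of _ P])
    fix l P' assume "\<And>i. i \<le> l \<Longrightarrow> P' i \<in> PF.primes_L" "\<And>i. i < l \<Longrightarrow> P' i \<subset> P' (Suc i)"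
    then show "l \<le> card S" using sub by (intro fiber_chain(1)[of l P']) auto
  qed (use PL strict in auto)
qed

text \<open>A chain of length \<open>card B\<close> forces I \<inter> B = 0, and then the dimension
  of the fiber equals \<open>card S\<close>, the dimension of its cotangent space.\<close>

lemma regular_fiber:
  assumes "regular_local_ring PA.L"
  shows "regular_local_ring PF.L" "krull_dim PF.A + enat m = krull_dim PA.L"
proof -
  have noeth: "noetherian_ring PA.L" and dim: "enat (card B) = prime_dim PA.primes_L"
    using assms by (simp_all add: PA.regular_L_iff_dim)
  note IB = total_regular_imp[OF dim]
  have "noetherian_ring PF.L"
    by (rule PA.noetherian_transfer[OF pq_fiber noeth \<beta>_surj]) (auto simp: \<beta>_hom ev_\<beta>)
  then show "regular_local_ring PF.L" by (simp add: PF.regular_L_iff_dim fiber_dim[OF IB])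
  show "krull_dim PF.A + enat m = krull_dim PA.L"
    by (simp add: PF.krull_dim_A PA.krull_dim_L dim[symmetric] fiber_dim[OF IB] card_B)
qed

text \<open>The polynomial ring in the free x_s maps onto the fiber by
  \<open>reducible_fiber\<close>. Regularity provides a chain of length \<open>card S\<close>, so
  the fiber ideal contains no nonzero polynomial in these x_s and the map is injective.\<close>

lemma free_fiber:
  assumes "regular_local_ring PF.L"
  shows "free_algebra PF.A"
proof -
  have dim: "prime_dim PF.primes_L = enat (card S)" using assms by (simp add: PF.regular_L_iff_dim)
  obtain P where P: "\<And>i. i \<le> card S \<Longrightarrow> P i \<in> PF.primes_L" "\<And>i. i < card S \<Longrightarrow> P i \<subset> P (Suc i)"
    using prime_dim_eqD[OF dim] PF.M_prime by blast
  have zero: "g = 0" if "g \<in> \<beta> ` I" "g \<in> polys S" for g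
    using that by (intro fiber_chain(2)[of "card S" P]) (use P in \<open>auto simp: PF.primes_A_def PF.primes_L_def\<close>)
  \<comment> \<open>The free indeterminates are renumbered from 0, as \<open>free_algebra\<close>
    uses an initial segment of indices.\<close>
  obtain enum where enum: "bij_betw enum {0..<card S} S" using ex_bij_betw_nat_finite[OF fin(2)] by blast
  define \<rho> where "\<rho> = (poly_subst (\<lambda>i. Var (enum i)) :: 'k mpoly \<Rightarrow> 'k mpoly)"
  define \<rho>' where "\<rho>' = (poly_subst (\<lambda>i. Var (the_inv_into {0..<card S} enum i)) :: 'k mpoly \<Rightarrow> 'k mpoly)"
  have inj: "inj_on enum {0..<card S}" and im: "enum ` {0..<card S} = S" using enum by (auto simp: bij_betw_def)
  have \<rho>: "\<rho> p \<in> polys S" if "p \<in> polys {..<card S}" for p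
    unfolding \<rho>_def using that by (rule poly_subst_closed) (use im in auto)
  have \<rho>': "\<rho>' p \<in> polys {..<card S}" if "p \<in> polys S" for p
    unfolding \<rho>'_def using that
    by (rule poly_subst_closed) (use the_inv_into_into[OF inj] im in force)
  have inv1: "\<rho>' (\<rho> p) = p" if "p \<in> polys {..<card S}" for p
    unfolding \<rho>'_def \<rho>_def poly_subst_poly_subst using that
    by (rule poly_subst_id) (auto simp: the_inv_into_f_f[OF inj])
  have inv2: "\<rho> (\<rho>' p) = p" if "p \<in> polys S" for p
    unfolding \<rho>'_def \<rho>_def poly_subst_poly_subst using that
    by (rule poly_subst_id) (use f_the_inv_into_f[OF inj] im in auto)
  have \<rho>V: "\<rho> p \<in> polys {m..<n}" if "p \<in> polys {..<card S}" for p
    using \<rho>[OF that] S_sub(1) by (rule polys_mono)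
  let ?h = "\<lambda>p. PF.cls (\<rho> p)"
  have "bij_betw ?h (polys {..<card S}) (carrier PF.A)"
    unfolding bij_betw_def
  proof
    show "inj_on ?h (polys {..<card S})"
    proof (rule inj_onI)
      fix p q assume pq: "p \<in> polys {..<card S}" "q \<in> polys {..<card S}" "?h p = ?h q"
      then have "\<rho> p - \<rho> q \<in> \<beta> ` I" using PF.cls_eq_iff \<rho>V by blast
      then have "\<rho> p - \<rho> q = 0" using \<rho> pq by (intro zero) auto
      then show "p = q" using inv1 pq by (metis eq_iff_diff_eq_0)
    qed
    show "?h ` polys {..<card S} = carrier PF.A"
    proof
      show "?h ` polys {..<card S} \<subseteq> carrier PF.A" using \<rho>V by (auto simp: PF.carrier_A)
      show "carrier PF.A \<subseteq> ?h ` polys {..<card S}"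
      proof
        fix x assume "x \<in> carrier PF.A"
        then obtain p where p: "p \<in> polys {m..<n}" "x = PF.cls p" by (auto simp: PF.carrier_A)
        obtain q where q: "q \<in> polys S" "p - q \<in> \<beta> ` I"
          using reducible_fiber[OF p(1)] unfolding reducible_mod_def by auto
        have "q \<in> polys {m..<n}" using q(1) S_sub(1) by (rule polys_mono)
        then have "x = ?h (\<rho>' q)" using p q PF.cls_eq_iff by (simp add: inv2)
        then show "x \<in> ?h ` polys {..<card S}" using \<rho>'[OF q(1)] by blast
      qed
    qed
  qed
  moreover have "?h \<in> Ring.ring_hom (poly_alg {..<card S}) PF.A"
    by (rule ring_hom_memI) (use \<rho>V in \<open>auto simp: PF.A_ops PF.carrier_A\<close>, simp_all add: \<rho>_def poly_subst_hom)
  moreover have "?h (c \<odot>\<^bsub>poly_alg {..<card S}\<^esub> p) = c \<odot>\<^bsub>PF.A\<^esub> ?h p" if "p \<in> polys {..<card S}" for c p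
    using \<rho>V[OF that] by (simp add: PF.A_smult) (simp add: \<rho>_def poly_subst_hom)
  ultimately show ?thesis unfolding free_algebra_def ring_iso_def by blast
qed

end

text \<open>That the isomorphism is induced by \<beta> is rendered twice: it agrees with \<beta> on
  Lin(I), and it sends the linear part of f to the linear part of \<beta>(f). The dimension formulas
  are written additively to avoid truncated subtraction.\<close>

theorem theorem5p9:
  fixes m n :: nat and W :: "nat \<Rightarrow> int"
    and I :: "'k::field mpoly set" and c :: "nat \<Rightarrow> 'k"
  assumes "m < n"
    and "\<forall>i<m. W i = 0"
    and "\<forall>j\<in>{m..<n}. W j > 0"
    and "homogeneous_ideal {..<n} W I"
    and "I \<inter> carrier (poly_alg {..<m}) = {0}"
  shows
    "let P = poly_alg {..<n} :: ('k, 'k mpoly) module;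
         KX = poly_alg {m..<n} :: ('k, 'k mpoly) module;
         I\<^sub>\<Gamma> = fiber_ideal m c I;
         MM = point_ideal {..<n} (fiber_point m c);
         XX = point_ideal {m..<n} (\<lambda>_. 0);
         LinI = lin_space {..<n} (fiber_point m c) I;
         LinF = lin_space {m..<n} (\<lambda>_. 0) I\<^sub>\<Gamma>;
         A = quot_alg P I;
         F = quot_alg KX I\<^sub>\<Gamma>;
         A_loc = local_at A (quot_ideal P MM I);
         F_loc = local_at F (quot_ideal KX XX I\<^sub>\<Gamma>)
     in
      (\<exists>\<alpha>. linear_map class_ring LinI LinF \<alpha> \<and>
           bij_betw \<alpha> (carrier LinI) (carrier LinF) \<and>
           (\<forall>v\<in>carrier LinI. \<alpha> v = fiber_map m c v) \<and>
           (\<forall>f\<in>I. \<alpha> (lin_part (fiber_point m c) f) = lin_part (\<lambda>_. 0) (fiber_map m c f))) \<and>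
      vectorspace.dim class_ring (cotangent F (quot_ideal KX XX I\<^sub>\<Gamma>)) + m
        = vectorspace.dim class_ring (cotangent A (quot_ideal P MM I)) \<and>
      (regular_local_ring A_loc \<longrightarrow>
         regular_local_ring F_loc \<and> krull_dim F + enat m = krull_dim A_loc) \<and>
      (regular_local_ring F_loc \<longrightarrow> free_algebra F)"
proof -
  interpret graded_fiber m n W "fiber_point m c" I
    by unfold_locales (use assms in \<open>auto simp: fiber_point_def\<close>)
  obtain T h f where "echelon T h f" "\<And>T' h' f'. echelon T' h' f' \<Longrightarrow> card T' \<le> card T"
    by (rule echelon_maximal) (erule that, blast)
  then interpret echelon_fiber m n W "fiber_point m c" I T h f
    by unfold_locales
  have \<beta>: "fiber_map m c = \<beta>"
    unfolding fiber_map_def \<beta>_def by (rule arg_cong[of _ _ poly_subst]) (auto simp: fiber_point_def)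
  have "\<exists>\<alpha>. linear_map class_ring (lin_space {..<n} (fiber_point m c) I) (lin_space {m..<n} (\<lambda>_. 0) (\<beta> ` I)) \<alpha> \<and>
      bij_betw \<alpha> (carrier (lin_space {..<n} (fiber_point m c) I)) (carrier (lin_space {m..<n} (\<lambda>_. 0) (\<beta> ` I))) \<and>
      (\<forall>v\<in>carrier (lin_space {..<n} (fiber_point m c) I). \<alpha> v = \<beta> v) \<and>
      (\<forall>f\<in>I. \<alpha> (lin_part (fiber_point m c) f) = lin_part (\<lambda>_. 0) (\<beta> f))"
    using linear_iso by blast
  moreover note dim_cotangent[unfolded PF.A_def PF.mA_def PA.A_def PA.mA_def]
  moreover note regular_fiber[unfolded PF.L_def PA.L_def, unfolded PF.A_def PF.mA_def PA.A_def PA.mA_def]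
  moreover note free_fiber[unfolded PF.L_def, unfolded PF.A_def PF.mA_def]
  ultimately show ?thesis unfolding Let_def fiber_ideal_def \<beta> by blast
qed

end
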